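(* Let $\mu:\mathbb{R}^N\to\mathbb{R}^N$ be a $\mathcal G$-periodic vector field in $L^2_{\rm loc}(\mathbb{R}^N,\mathbb{R}^N)$ whose distributional divergence $\operatorname{div}\mu$ belongs to $L^2_{\rm loc}(\mathbb{R}^N)$ (that is, $\mu\in H_\#(\operatorname{div})$). Then the traces of the normal component of $\mu$ on opposite faces of $Y$, taken with the same unit normal vector on both faces, are equal; that is, for every $k\in\{1,\dots,N\}$, $$\bigl\langle \operatorname{tr}_{F_k^+}(\mu\cdot n_k),\ \varphi(\cdot-\vec g_k)\bigr\rangle=\bigl\langle\operatorname{tr}_{F_k^-}(\mu\cdot n_k),\ \varphi\bigr\rangle$$ for all $\varphi\in H^{1/2}_{00}(F_k^-)$.
   Context: Let $N\ge2$, let $\vec g_1,\dots,\vec g_N$ be linearly independent vectors in $\mathbb{R}^N$, let $\mathcal G$ be the additive group (lattice) they generate, and let $Y=\{\sum_k s_k\vec g_k : s_k\in[0,1]\}$ be the periodicity cell. A function on $\mathbb{R}^N$ is $\mathcal G$-periodic if it is invariant under translations by vectors of $\mathcal G$. The boundary $\partial Y$ is the union of the pairs of opposite faces $F_k^-=\{y\in Y: s_k=0\}$ and $F_k^+=\{y\in Y: s_k=1\}=F_k^-+\vec g_k$. Let $n_k$ be the unit vector normal to $F_k^\pm$ which is outward to $Y$ on $F_k^+$ (so the outward unit normal on $F_k^-$ is $-n_k$). For a face $F$, $H^{1/2}_{00}(F)$ is the set of $\varphi\in L^2(F)$ whose extension $\tilde\varphi$ by zero to $\partial Y$ belongs to $H^{1/2}(\partial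 Y)$. The restriction of $\mu$ to the interior of $Y$ lies in $H(\operatorname{div},Y)=\{\mu\in L^2(Y,\mathbb{R}^N):\operatorname{div}\mu\in L^2(Y)\}$, and its outward normal trace $\gamma_\nu\mu\in H^{-1/2}(\partial Y)$ is defined by $\langle\gamma_\nu\mu,\Phi|_{\partial Y}\rangle=\int_Y(\operatorname{div}\mu)\,\Phi\,dy+\int_Y\mu\cdot\nabla\Phi\,dy$ for $\Phi\in H^1(Y)$. The traces on faces with respect to the common normal $n_k$ are $\langle\operatorname{tr}_{F_k^+}(\mu\cdot n_k),\varphi\rangle=\langle\gamma_\nu\mu,\tilde\varphi\rangle$ for $\varphi\in H^{1/2}_{00}(F_k^+)$ and $\langle\operatorname{tr}_{F_k^-}(\mu\cdot n_k),\varphi\rangle=-\langle\gamma_\nu\mu,\tilde\varphi\rangle$ for $\varphi\in H^{1/2}_{00}(F_k^-)$. *)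

theory Defs
  imports "HOL-Analysis.Analysis"
begin

section \<open>Lattice, periodicity cell and its faces\<close>

text \<open>The dimension is \<open>CARD('n)\<close>; the generators are a family \<open>g :: 'n \<Rightarrow> real^'n\<close>.\<close>

definition lattice :: "('n::finite \<Rightarrow> real^'n) \<Rightarrow> (real^'n) set" where
  "lattice g = {(\<Sum>k\<in>UNIV. real_of_int (m k) *\<^sub>R g k) | m :: 'n \<Rightarrow> int. True}"

text \<open>Elements of Lebesgue spaces are represented by functions, so periodicity is understood
  almost everywhere.\<close>

definition periodic :: "('n::finite \<Rightarrow> real^'n) \<Rightarrow> (real^'n \<Rightarrow> 'b) \<Rightarrow> bool" where
  "periodic g f \<longleftrightarrow> (\<forall>v\<in>lattice g. AE x in lebesgue. f (x + v) = f x)"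

definition cell :: "('n::finite \<Rightarrow> real^'n) \<Rightarrow> (real^'n) set" where
  "cell g = {(\<Sum>j\<in>UNIV. s j *\<^sub>R g j) | s :: 'n \<Rightarrow> real. \<forall>j. 0 \<le> s j \<and> s j \<le> 1}"

text \<open>\<open>face g k 0\<close> is $F_k^-$ and \<open>face g k 1\<close> is $F_k^+$.\<close>

definition face :: "('n::finite \<Rightarrow> real^'n) \<Rightarrow> 'n \<Rightarrow> real \<Rightarrow> (real^'n) set" where
  "face g k c = {(\<Sum>j\<in>UNIV. s j *\<^sub>R g j) | s :: 'n \<Rightarrow> real.
      (\<forall>j. 0 \<le> s j \<and> s j \<le> 1) \<and> s k = c}"

definition face_normal :: "('n::finite \<Rightarrow> real^'n) \<Rightarrow> 'n \<Rightarrow> real^'n" where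
  "face_normal g k = (THE n. norm n = 1 \<and> (\<forall>j. j \<noteq> k \<longrightarrow> n \<bullet> g j = 0) \<and> n \<bullet> g k > 0)"

text \<open>Surface measure on a face \<open>F\<close>, normalised by: the area of a Borel set \<open>A \<subseteq> F\<close> is the
  volume of the right prism of height 1 over \<open>A\<close>. It is obtained by pushing the Lebesgue
  measure on the prism over \<open>F\<close> forward under the orthogonal projection onto the hyperplane
  of \<open>F\<close>, and it is a measure on the whole space concentrated on \<open>F\<close>. By completeness, the
  values of a function outside \<open>F\<close> do not matter for measurability or integrals.\<close>

definition face_measure :: "('n::finite \<Rightarrow> real^'n) \<Rightarrow> 'n \<Rightarrow> real \<Rightarrow> (real^'n) measure" where
  "face_measure g k c = completion
     (distr
       (restrict_space lborel
         {y + t *\<^sub>R face_normal g k | y t. y \<in> face g k c \<and> 0 \<le> t \<and> t \<le> 1})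
       borel
       (\<lambda>x. x - ((x - c *\<^sub>R g k) \<bullet> face_normal g k) *\<^sub>R face_normal g k))"


section \<open>Function spaces\<close>

definition L2 :: "'a measure \<Rightarrow> ('a \<Rightarrow> 'b::euclidean_space) set" where
  "L2 M = {f. f \<in> borel_measurable M \<and> integrable M (\<lambda>x. (norm (f x))\<^sup>2)}"

definition L2_loc :: "(real^'n::finite \<Rightarrow> 'b::euclidean_space) set" where
  "L2_loc = {f. \<forall>K. compact K \<longrightarrow> f \<in> L2 (lebesgue_on K)}"

definition partial_deriv :: "'n::finite \<Rightarrow> (real^'n \<Rightarrow> real) \<Rightarrow> real^'n \<Rightarrow> real" where
  "partial_deriv i f x = frechet_derivative f (at x) (axis i 1)"

definition grad :: "(real^'n::finite \<Rightarrow> real) \<Rightarrow> real^'n \<Rightarrow> real^'n" where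
  "grad f x = (\<chi> i. partial_deriv i f x)"

primrec C_k :: "nat \<Rightarrow> (real^'n::finite \<Rightarrow> real) \<Rightarrow> bool" where
  "C_k 0 f \<longleftrightarrow> continuous_on UNIV f"
| "C_k (Suc m) f \<longleftrightarrow> (\<forall>x. f differentiable (at x)) \<and> (\<forall>i. C_k m (partial_deriv i f))"

definition smooth :: "(real^'n::finite \<Rightarrow> real) \<Rightarrow> bool" where
  "smooth f \<longleftrightarrow> (\<forall>m. C_k m f)"

definition test_functions :: "(real^'n::finite) set \<Rightarrow> (real^'n \<Rightarrow> real) set" where
  "test_functions U = {\<eta>. smooth \<eta> \<and> (\<exists>K. compact K \<and> K \<subseteq> U \<and> (\<forall>x. x \<notin> K \<longrightarrow> \<eta> x = 0))}"

definition has_weak_grad ::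
    "(real^'n::finite) set \<Rightarrow> (real^'n \<Rightarrow> real) \<Rightarrow> (real^'n \<Rightarrow> real^'n) \<Rightarrow> bool" where
  "has_weak_grad U \<Phi> G \<longleftrightarrow> (\<forall>\<eta>\<in>test_functions U. \<forall>i.
     (\<integral>x. \<Phi> x * partial_deriv i \<eta> x \<partial>lebesgue_on U) = - (\<integral>x. G x $ i * \<eta> x \<partial>lebesgue_on U))"

definition has_weak_div ::
    "(real^'n::finite) set \<Rightarrow> (real^'n \<Rightarrow> real^'n) \<Rightarrow> (real^'n \<Rightarrow> real) \<Rightarrow> bool" where
  "has_weak_div U \<mu> d \<longleftrightarrow> (\<forall>\<eta>\<in>test_functions U.
     (\<integral>x. \<mu> x \<bullet> grad \<eta> x \<partial>lebesgue_on U) = - (\<integral>x. d x * \<eta> x \<partial>lebesgue_on U))"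

text \<open>The square integrable weak gradient and divergence on \<open>U\<close>, unique up to null sets
  where they exist.\<close>

definition weak_grad :: "(real^'n::finite) set \<Rightarrow> (real^'n \<Rightarrow> real) \<Rightarrow> real^'n \<Rightarrow> real^'n" where
  "weak_grad U \<Phi> = (SOME G. G \<in> L2 (lebesgue_on U) \<and> has_weak_grad U \<Phi> G)"

definition weak_div :: "(real^'n::finite) set \<Rightarrow> (real^'n \<Rightarrow> real^'n) \<Rightarrow> real^'n \<Rightarrow> real" where
  "weak_div U \<mu> = (SOME d. d \<in> L2 (lebesgue_on U) \<and> has_weak_div U \<mu> d)"

definition H1 :: "(real^'n::finite) set \<Rightarrow> (real^'n \<Rightarrow> real) set" where
  "H1 U = {\<Phi>. \<Phi> \<in> L2 (lebesgue_on U) \<and> (\<exists>G. G \<in> L2 (lebesgue_on U) \<and> has_weak_grad U \<Phi> G)}"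

definition Hdiv_per :: "('n::finite \<Rightarrow> real^'n) \<Rightarrow> (real^'n \<Rightarrow> real^'n) set" where
  "Hdiv_per g = {\<mu>. \<mu> \<in> L2_loc \<and> periodic g \<mu> \<and> (\<exists>d. d \<in> L2_loc \<and> has_weak_div UNIV \<mu> d)}"


section \<open>Traces\<close>

text \<open>\<open>\<psi>\<close> is the trace on the boundary of the cell of \<open>\<Phi> \<in> H1\<close>: the trace operator is the
  continuous extension of the restriction of functions smooth up to the boundary, from the
  $H^1$ norm to the $L^2$ norm of the boundary. The latter is the sum over all faces.\<close>

definition is_trace ::
    "('n::finite \<Rightarrow> real^'n) \<Rightarrow> (real^'n \<Rightarrow> real) \<Rightarrow> (real^'n \<Rightarrow> real) \<Rightarrow> bool" where
  "is_trace g \<Phi> \<psi> \<longleftrightarrow>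
     \<Phi> \<in> H1 (interior (cell g)) \<and>
     (\<forall>k. \<forall>c\<in>{0, 1}. \<psi> \<in> L2 (face_measure g k c)) \<and>
     (\<exists>f :: nat \<Rightarrow> real^'n \<Rightarrow> real.
        (\<forall>m. smooth (f m)) \<and>
        (\<lambda>m. \<integral>x. (f m x - \<Phi> x)\<^sup>2 \<partial>lebesgue_on (interior (cell g))) \<longlonglongrightarrow> 0 \<and>
        (\<lambda>m. \<integral>x. (norm (grad (f m) x - weak_grad (interior (cell g)) \<Phi> x))\<^sup>2
               \<partial>lebesgue_on (interior (cell g))) \<longlonglongrightarrow> 0 \<and>
        (\<forall>k. \<forall>c\<in>{0, 1}. (\<lambda>m. \<integral>x. (f m x - \<psi> x)\<^sup>2 \<partial>face_measure g k c) \<longlonglongrightarrow> 0))"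

text \<open>$H^{1/2}(\partial Y)$ is the space of traces of $H^1(Y)$; values of its elements outside
  the boundary are irrelevant.\<close>

definition H_half :: "('n::finite \<Rightarrow> real^'n) \<Rightarrow> (real^'n \<Rightarrow> real) set" where
  "H_half g = {\<psi>. \<exists>\<Phi>. is_trace g \<Phi> \<psi>}"

definition zero_ext :: "(real^'n::finite) set \<Rightarrow> (real^'n \<Rightarrow> real) \<Rightarrow> real^'n \<Rightarrow> real" where
  "zero_ext F \<phi> x = (if x \<in> F then \<phi> x else 0)"

definition H_half_00 :: "('n::finite \<Rightarrow> real^'n) \<Rightarrow> 'n \<Rightarrow> real \<Rightarrow> (real^'n \<Rightarrow> real) set" where
  "H_half_00 g k c =
     {\<phi>. \<phi> \<in> L2 (face_measure g k c) \<and> zero_ext (face g k c) \<phi> \<in> H_half g}"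

text \<open>The outward normal trace of \<open>\<mu>\<close>, as a functional on \<open>H_half g\<close>. Its value at \<open>\<psi>\<close> does
  not depend on the function \<open>\<Phi>\<close> with trace \<open>\<psi>\<close>.\<close>

definition normal_trace ::
    "('n::finite \<Rightarrow> real^'n) \<Rightarrow> (real^'n \<Rightarrow> real^'n) \<Rightarrow> (real^'n \<Rightarrow> real) \<Rightarrow> real" where
  "normal_trace g \<mu> \<psi> = (THE r. \<exists>\<Phi>. is_trace g \<Phi> \<psi> \<and>
     r = (\<integral>x. weak_div (interior (cell g)) \<mu> x * \<Phi> x \<partial>lebesgue_on (interior (cell g))) +
         (\<integral>x. \<mu> x \<bullet> weak_grad (interior (cell g)) \<Phi> x \<partial>lebesgue_on (interior (cell g))))"

text \<open>Traces of the normal component with respect to the common normal \<open>face_normal g k\<close>, which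
  is the outward one on \<open>face g k 1\<close> and the inward one on \<open>face g k 0\<close>.\<close>

definition tr_plus ::
    "('n::finite \<Rightarrow> real^'n) \<Rightarrow> 'n \<Rightarrow> (real^'n \<Rightarrow> real^'n) \<Rightarrow> (real^'n \<Rightarrow> real) \<Rightarrow> real" where
  "tr_plus g k \<mu> \<phi> = normal_trace g \<mu> (zero_ext (face g k 1) \<phi>)"

definition tr_minus ::
    "('n::finite \<Rightarrow> real^'n) \<Rightarrow> 'n \<Rightarrow> (real^'n \<Rightarrow> real^'n) \<Rightarrow> (real^'n \<Rightarrow> real) \<Rightarrow> real" where
  "tr_minus g k \<mu> \<phi> = - normal_trace g \<mu> (zero_ext (face g k 0) \<phi>)"

end

theory Submission
  imports Defs
begin

text \<open>
  A field with square integrable divergence on the whole space has no jump of its normal component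
  across a face. In weak form: if $\Theta \in H^1(\mathbb{R}^N)$ has compact support, then
  $\int (\mathrm{div}\,\mu)\, \Theta + \int \mu \cdot \nabla\Theta = 0$ (lemma \<open>weak_div_pairing\<close>).

  Let \<open>\<Phi>\<close> have the trace \<open>\<phi>\<close> on $F_k^-$ and 0 on the other faces. The reflection $s_k \mapsto 1 - s_k$ of the
  cell turns \<open>\<Phi>\<close> into a function \<open>\<Phi>'\<close> whose trace is $\varphi(\cdot - \vec g_k)$ on $F_k^+$ and 0 elsewhere
  (\<open>is_trace_flip\<close>, \<open>zero_ext_flip\<close>); in particular that function belongs to $H^{1/2}_{00}(F_k^+)$. Define
  \<open>\<Theta>\<close> as \<open>\<Phi>\<close> on \<open>Y\<close>, as $\Phi'(\cdot + \vec g_k)$ on $Y - \vec g_k$, and as 0 elsewhere. The traces agree on the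
  common face $F_k^-$ of the two cells and vanish on the rest of their boundaries, so \<open>\<Theta>\<close> is in
  $H^1(\mathbb{R}^N)$. Since \<open>\<mu>\<close> and its divergence are periodic (\<open>weak_div_periodic\<close>), the weak form yields
  $\langle\gamma_\nu\mu, \tilde\varphi\rangle + \langle\gamma_\nu\mu, \tilde\varphi(\cdot - \vec g_k)\rangle = 0$
  (\<open>pairing_flip\<close>). The outward normals of the two faces are opposite, so this is the claim. The same
  argument for the difference of two functions with equal traces, extended by zero, shows that the
  normal trace is well defined (\<open>pairing_unique\<close>).

  That glued functions are Sobolev functions follows from Green's formula for the smooth functions
  that approximate them: their boundary integrals converge, and cancel in the limit (\<open>green_limit\<close>,
  \<open>glue_weak_grad\<close>). Green's formula itself is the limit of a difference quotient, where moving the cell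
  along \<open>g k\<close> exchanges one thin slab for another (\<open>green_direction\<close>). The surface measure enters through
  the oblique projection of the cell to the face, which has it as image of the volume up to a constant
  factor (\<open>face_measure_eq_slice\<close>).
\<close>

section \<open>Smooth functions\<close>

lemma partial_deriv_eq:
  fixes f :: "real^'n::finite \<Rightarrow> real"
  assumes "(f has_derivative D) (at x)"
  shows "partial_deriv i f x = D (axis i 1)"
  unfolding partial_deriv_def using frechet_derivative_at[OF assms] by simp

lemma has_derivative_grad:
  fixes f :: "real^'n::finite \<Rightarrow> real"
  assumes "f differentiable (at x)"
  shows "(f has_derivative (\<lambda>h. grad f x \<bullet> h)) (at x)"
proof -
  let ?D = "frechet_derivative f (at x)"
  have D: "(f has_derivative ?D) (at x)"
    using assms frechet_derivative_works by blast
  then have lin: "linear ?D" by (rule has_derivative_linear)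
  have "?D h = grad f x \<bullet> h" for h
  proof -
    have "h = (\<Sum>i\<in>UNIV. (h $ i) *\<^sub>R axis i 1)"
      by (simp add: basis_expansion scalar_mult_eq_scaleR[symmetric])
    then have "?D h = ?D (\<Sum>i\<in>UNIV. (h $ i) *\<^sub>R axis i 1)" by simp
    also have "\<dots> = (\<Sum>i\<in>UNIV. (h $ i) * ?D (axis i 1))"
      by (simp add: linear_sum[OF lin] linear_cmul[OF lin])
    finally show ?thesis
      by (simp add: grad_def partial_deriv_def inner_vec_def mult.commute)
  qed
  then have "?D = (\<lambda>h. grad f x \<bullet> h)" by (rule ext)
  with D show ?thesis by simp
qed

lemma C_k_mono_Suc: "C_k (Suc m) f \<Longrightarrow> C_k m f"
proof (induction m arbitrary: f)
  case 0
  then show ?case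
    by (auto simp: continuous_on_eq_continuous_at intro!: differentiable_imp_continuous_within)
next
  case (Suc m)
  then show ?case by (metis C_k.simps(2))
qed

lemma C_k_const: "C_k m (\<lambda>x::real^'n::finite. c)"
proof (induction m arbitrary: c)
  case (Suc m)
  have "partial_deriv i (\<lambda>x::real^'n. c) = (\<lambda>x. 0)" for i
    by (rule ext, subst partial_deriv_eq[where D="\<lambda>h. 0"]) (auto intro: derivative_eq_intros)
  then show ?case using Suc by simp
qed simp

lemma C_k_add: "C_k m f \<Longrightarrow> C_k m h \<Longrightarrow> C_k m (\<lambda>x. f x + h x)"
proof (induction m arbitrary: f h)
  case (Suc m)
  then have d: "f differentiable (at x)" "h differentiable (at x)" for x by auto
  have "partial_deriv i (\<lambda>x. f x + h x) = (\<lambda>x. partial_deriv i f x + partial_deriv i h x)" for i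
  proof
    fix x
    show "partial_deriv i (\<lambda>x. f x + h x) x = partial_deriv i f x + partial_deriv i h x"
      by (subst partial_deriv_eq[OF has_derivative_add[OF d(1)[unfolded frechet_derivative_works]
        d(2)[unfolded frechet_derivative_works]]]) (simp add: partial_deriv_def)
  qed
  then show ?case using Suc d by auto
qed (auto intro: continuous_intros)

lemma partial_deriv_mult:
  assumes d: "f differentiable (at x)" "h differentiable (at x)"
  shows "partial_deriv i (\<lambda>x. f x * h x) x = f x * partial_deriv i h x + partial_deriv i f x * h x"
  by (subst partial_deriv_eq[OF has_derivative_mult[OF d(1)[unfolded frechet_derivative_works]
    d(2)[unfolded frechet_derivative_works]]]) (simp add: partial_deriv_def)

lemma C_k_mult: "C_k m f \<Longrightarrow> C_k m h \<Longrightarrow> C_k m (\<lambda>x. f x * h x)"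
proof (induction m arbitrary: f h)
  case (Suc m)
  then have d: "f differentiable (at x)" "h differentiable (at x)" for x by auto
  have "partial_deriv i (\<lambda>x. f x * h x) = (\<lambda>x. f x * partial_deriv i h x + partial_deriv i f x * h x)" for i
    by (rule ext) (rule partial_deriv_mult[OF d])
  moreover have "C_k m f" "C_k m h" using Suc.prems by (blast intro: C_k_mono_Suc)+
  ultimately show ?case using Suc d by (auto intro!: C_k_add)
qed (auto intro: continuous_intros)

lemma C_k_sum: "(\<And>i. i \<in> I \<Longrightarrow> C_k m (f i)) \<Longrightarrow> C_k m (\<lambda>x. \<Sum>i\<in>I. f i x)"
  by (induction I rule: infinite_finite_induct) (auto intro: C_k_add C_k_const)

lemma C_k_prod: "(\<And>i. i \<in> I \<Longrightarrow> C_k m (f i)) \<Longrightarrow> C_k m (\<lambda>x. \<Prod>i\<in>I. f i x)"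
  by (induction I rule: infinite_finite_induct) (auto intro: C_k_mult C_k_const)

lemma smooth_differentiable: "smooth f \<Longrightarrow> f differentiable (at x)"
  unfolding smooth_def by (metis C_k.simps(2))

lemma smooth_continuous: "smooth f \<Longrightarrow> continuous_on UNIV f"
  unfolding smooth_def by (metis C_k.simps(1))

lemma smooth_partial_deriv: "smooth f \<Longrightarrow> smooth (partial_deriv i f)"
  unfolding smooth_def by (metis C_k.simps(2))

lemma smooth_mult: "smooth f \<Longrightarrow> smooth h \<Longrightarrow> smooth (\<lambda>x. f x * h x)"
  unfolding smooth_def by (auto intro: C_k_mult)

lemma smooth_diff:
  assumes "smooth f" "smooth h" shows "smooth (\<lambda>x. f x - h x)"
proof -
  have "smooth (\<lambda>x. f x + (-1) * h x)"
    using assms unfolding smooth_def by (intro allI C_k_add C_k_mult C_k_const) auto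
  then show ?thesis by simp
qed

lemma grad_affine:
  fixes f :: "real^'n::finite \<Rightarrow> real" and a :: "real^'n \<Rightarrow> real^'n"
  assumes "linear a" "f differentiable (at (a x + b))"
  shows "grad (\<lambda>x. f (a x + b)) x = adjoint a (grad f (a x + b))"
    and "(\<lambda>x. f (a x + b)) differentiable (at x)"
proof -
  have bl: "bounded_linear a" using assms(1) by (simp add: linear_conv_bounded_linear)
  have T: "((\<lambda>x. a x + b) has_derivative a) (at x)"
    by (auto intro!: derivative_eq_intros bounded_linear_imp_has_derivative[OF bl])
  from has_derivative_compose[OF T has_derivative_grad[OF assms(2)]]
  have D: "((\<lambda>x. f (a x + b)) has_derivative (\<lambda>h. grad f (a x + b) \<bullet> a h)) (at x)" .
  then show "(\<lambda>x. f (a x + b)) differentiable (at x)" by (auto simp: differentiable_def)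
  show "grad (\<lambda>x. f (a x + b)) x = adjoint a (grad f (a x + b))"
  proof (subst vec_eq_iff, rule allI)
    fix i
    have "grad (\<lambda>x. f (a x + b)) x $ i = grad f (a x + b) \<bullet> a (axis i 1)"
      by (simp add: grad_def partial_deriv_eq[OF D])
    also have "\<dots> = adjoint a (grad f (a x + b)) \<bullet> axis i 1"
      using adjoint_works[OF assms(1), of "axis i 1" "grad f (a x + b)"] by (simp add: inner_commute)
    finally show "grad (\<lambda>x. f (a x + b)) x $ i = adjoint a (grad f (a x + b)) $ i"
      by (simp add: inner_axis)
  qed
qed

lemma C_k_affine:
  fixes f :: "real^'n::finite \<Rightarrow> real" and a :: "real^'n \<Rightarrow> real^'n"
  assumes "linear a"
  shows "C_k m f \<Longrightarrow> C_k m (\<lambda>x. f (a x + b))"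
proof (induction m arbitrary: f)
  case 0
  have bl: "bounded_linear a" using assms by (simp add: linear_conv_bounded_linear)
  have "continuous_on UNIV (\<lambda>x. a x + b)"
    by (intro continuous_intros linear_continuous_on bl)
  then show ?case using 0 by (auto intro: continuous_on_compose2)
next
  case (Suc m)
  then have d: "f differentiable (at x)" for x by auto
  have "partial_deriv j (\<lambda>x. f (a x + b)) = (\<lambda>x. \<Sum>i\<in>UNIV. (a (axis j 1) $ i) * partial_deriv i f (a x + b))" for j
  proof
    fix x
    have "partial_deriv j (\<lambda>x. f (a x + b)) x = grad (\<lambda>x. f (a x + b)) x \<bullet> axis j 1"
      by (simp add: grad_def inner_axis)
    also have "\<dots> = a (axis j 1) \<bullet> grad f (a x + b)"
      unfolding grad_affine(1)[OF assms d] using adjoint_works[OF assms] by (simp add: inner_commute)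
    finally show "partial_deriv j (\<lambda>x. f (a x + b)) x = (\<Sum>i\<in>UNIV. (a (axis j 1) $ i) * partial_deriv i f (a x + b))"
      by (simp add: inner_vec_def grad_def)
  qed
  moreover have "C_k m (\<lambda>x. \<Sum>i\<in>UNIV. (a (axis j 1) $ i) * partial_deriv i f (a x + b))" for j
    using Suc by (intro C_k_sum C_k_mult C_k_const) auto
  ultimately show ?case using grad_affine(2)[OF assms d] by auto
qed

lemma smooth_affine:
  fixes f :: "real^'n::finite \<Rightarrow> real" and a :: "real^'n \<Rightarrow> real^'n"
  shows "linear a \<Longrightarrow> smooth f \<Longrightarrow> smooth (\<lambda>x. f (a x + b))"
  unfolding smooth_def using C_k_affine by blast

lemma smooth_translate:
  fixes f :: "real^'n::finite \<Rightarrow> real"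
  assumes "smooth f" shows "smooth (\<lambda>x. f (x - v))"
proof -
  have "smooth (\<lambda>x. f (x + (- v)))"
    by (rule smooth_affine[where a="\<lambda>x. x", OF _ assms]) (rule linear_id[unfolded id_def])
  then show ?thesis by simp
qed

lemma smooth_borel:
  fixes f :: "real^'n::finite \<Rightarrow> real"
  assumes "smooth f"
  shows "f \<in> borel_measurable borel" "partial_deriv i f \<in> borel_measurable borel"
    "grad f \<in> borel_measurable borel"
  unfolding grad_def
  by (intro borel_measurable_continuous_onI continuous_intros smooth_continuous smooth_partial_deriv assms)+

subsection \<open>Bump functions\<close>

text \<open>The functions $t^{-n} e^{-1/t}$, extended by zero to $t \le 0$.  Their span is closed under
  differentiation, which is why \<open>flat 0\<close> is smooth.\<close>

definition flat :: "nat \<Rightarrow> real \<Rightarrow> real" where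
  "flat n t = (if t > 0 then (1 / t) ^ n * exp (- (1 / t)) else 0)"

lemma flat_tendsto_0: "(flat n \<longlongrightarrow> 0) (at_right 0)"
proof -
  have "((\<lambda>t. inverse t ^ n / exp (inverse t)) \<longlongrightarrow> (0::real)) (at_right 0)"
    by (rule filterlim_compose[OF tendsto_power_div_exp_0 filterlim_inverse_at_top_right])
  then show ?thesis
    by (rule Lim_transform_eventually)
       (auto simp: eventually_at_filter flat_def exp_minus field_simps inverse_eq_divide)
qed

lemma flat_has_derivative:
  "(flat n has_real_derivative (flat (n + 2) t - real n * flat (n + 1) t)) (at t)"
proof (cases t "0::real" rule: linorder_cases)
  case less
  have "((\<lambda>t. 0) has_real_derivative 0) (at t)" by simp
  then have "(flat n has_real_derivative 0) (at t)"
    by (rule has_field_derivative_transform_within_open[where S="{..<0}"]) (use less in \<open>auto simp: flat_def\<close>)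
  then show ?thesis using less by (simp add: flat_def)
next
  case greater
  have "((\<lambda>t. (1 / t) ^ n * exp (- (1 / t))) has_real_derivative (flat (n + 2) t - real n * flat (n + 1) t)) (at t)"
  proof -
    define u where "u = 1 / t"
    have D: "((\<lambda>t. 1 / t) has_real_derivative - u\<^sup>2) (at t)"
      using greater by (auto intro!: derivative_eq_intros simp: u_def power2_eq_square)
    have "((\<lambda>t. (1 / t) ^ n * exp (- (1 / t))) has_real_derivative
        real n * (- u\<^sup>2 * u ^ (n - Suc 0)) * exp (- u) + exp (- u) * (- (- u\<^sup>2)) * u ^ n) (at t)"
      using DERIV_mult[OF DERIV_power[OF D, of n] DERIV_fun_exp[OF DERIV_minus[OF D]]]
      by (simp add: u_def)
    moreover have "real n * (- u\<^sup>2 * u ^ (n - Suc 0)) * exp (- u) + exp (- u) * (- (- u\<^sup>2)) * u ^ n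
        = flat (n + 2) t - real n * flat (n + 1) t"
      using greater by (cases n) (auto simp: flat_def u_def[symmetric] power2_eq_square algebra_simps)
    ultimately show ?thesis by simp
  qed
  then show ?thesis
    by (rule has_field_derivative_transform_within_open[where S="{0<..}"]) (use greater in \<open>auto simp: flat_def\<close>)
next
  case equal
  \<comment> \<open>The right difference quotient at 0 is \<open>flat (n + 1)\<close>, the left one vanishes.\<close>
  have r: "((\<lambda>h. (flat n h - flat n 0) / h) \<longlongrightarrow> 0) (at_right 0)"
    using flat_tendsto_0[of "n+1"]
    by (rule Lim_transform_eventually) (auto simp: eventually_at_filter flat_def)
  have l: "((\<lambda>h. (flat n h - flat n 0) / h) \<longlongrightarrow> 0) (at_left 0)"
    by (rule tendsto_eventually) (auto simp: eventually_at_filter flat_def)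
  have "((\<lambda>h. (flat n (0 + h) - flat n 0) / h) \<longlongrightarrow> 0) (at 0)"
    using filterlim_split_at[OF l r] by simp
  then have "(flat n has_real_derivative 0) (at 0)" by (simp only: DERIV_def)
  then show ?thesis using equal by (simp add: flat_def)
qed

text \<open>The induction has to run over all \<open>n\<close> at once, because one derivative raises \<open>n\<close> by one or two.\<close>

lemma C_k_flat_component:
  "C_k m (\<lambda>x::real^'n::finite. flat n (c * x $ i + d))"
proof (induction m arbitrary: n)
  case 0
  have "continuous_on UNIV (flat n)"
    by (meson DERIV_isCont continuous_at_imp_continuous_on flat_has_derivative)
  then show ?case
    by (auto intro!: continuous_on_compose2[of UNIV "flat n"] continuous_intros)
next
  case (Suc m)
  let ?l = "\<lambda>x::real^'n. c * x $ i + d"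
  let ?D = "\<lambda>x. flat (n + 2) (?l x) - real n * flat (n + 1) (?l x)"
  have D: "((\<lambda>x. flat n (?l x)) has_derivative (\<lambda>h. ?D x * (c * h $ i))) (at x)" for x
  proof -
    have l: "(?l has_derivative (\<lambda>h. c * h $ i)) (at x)"
      by (auto intro!: derivative_eq_intros bounded_linear_imp_has_derivative bounded_linear_vec_nth
          simp: mult.commute)
    show ?thesis
      using has_derivative_compose[OF l flat_has_derivative[of n "?l x", unfolded has_field_derivative_def]] .
  qed
  have "partial_deriv j (\<lambda>x. flat n (?l x)) =
     (\<lambda>x. (c * axis j 1 $ i) * (flat (n + 2) (?l x) + (- real n) * flat (n + 1) (?l x)))" for j
    by (rule ext, subst partial_deriv_eq[OF D]) (simp add: algebra_simps)
  moreover have "C_k m (\<lambda>x. (c * axis j 1 $ i) * (flat (n + 2) (?l x) + (- real n) * flat (n + 1) (?l x)))" for j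
    by (intro C_k_mult C_k_add C_k_const Suc)
  ultimately show ?case using D by (auto simp: differentiable_def)
qed

text \<open>A product over the coordinates of one-dimensional bumps of half-width \<open>\<delta>\<close> vanishes off a cube.
  With \<open>\<delta> = r / N\<close> that cube lies in the ball of radius \<open>r\<close>, as the norm is at most the sum of the
  absolute values of the coordinates.\<close>

lemma ex_bump:
  assumes "r > 0"
  obtains \<rho> :: "real^'n::finite \<Rightarrow> real"
  where "smooth \<rho>" "\<And>x. \<rho> x \<ge> 0" "\<rho> 0 > 0" "\<And>x. norm x \<ge> r \<Longrightarrow> \<rho> x = 0"
proof -
  define \<delta> where "\<delta> = r / CARD('n)"
  have \<delta>: "\<delta> > 0" using assms by (simp add: \<delta>_def)
  define \<rho> :: "real^'n \<Rightarrow> real" where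
    "\<rho> x = (\<Prod>i\<in>UNIV. flat 0 (1 * x $ i + \<delta>) * flat 0 ((-1) * x $ i + \<delta>))" for x
  show ?thesis
  proof
    show "smooth \<rho>"
      unfolding smooth_def \<rho>_def by (intro allI C_k_prod C_k_mult C_k_flat_component)
    show "\<rho> x \<ge> 0" for x unfolding \<rho>_def by (intro prod_nonneg) (auto simp: flat_def)
    show "\<rho> 0 > 0" unfolding \<rho>_def using \<delta> by (intro prod_pos) (auto simp: flat_def)
    show "\<rho> x = 0" if "norm x \<ge> r" for x
    proof -
      have "\<exists>i. \<bar>x $ i\<bar> \<ge> \<delta>"
      proof (rule ccontr)
        assume "\<not> ?thesis"
        then have "(\<Sum>i\<in>UNIV. \<bar>x $ i\<bar>) < (\<Sum>i\<in>(UNIV::'n set). \<delta>)"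
          by (intro sum_strict_mono) (auto simp: not_le)
        also have "\<dots> = r" by (simp add: \<delta>_def)
        finally show False using norm_le_l1_cart[of x] that by simp
      qed
      then obtain i where "\<bar>x $ i\<bar> \<ge> \<delta>" ..
      then have "flat 0 (1 * x $ i + \<delta>) * flat 0 ((-1) * x $ i + \<delta>) = 0"
        by (auto simp: flat_def)
      then show ?thesis unfolding \<rho>_def by (intro prod_zero) auto
    qed
  qed
qed

section \<open>Affine substitutions in Lebesgue measure\<close>

text \<open>Uniqueness of Haar measure by the classical double integral: $\int\int 1_A(x)\, 1_B(x + y)$ over
  \<open>M\<close> in \<open>x\<close> and Lebesgue measure in \<open>y\<close> is evaluated in both orders, and each measure is used once
  for its translation invariance.\<close>

lemma translation_invariant_measure_unique:
  fixes M :: "'a::euclidean_space measure"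
  assumes M [measurable_cong]: "sets M = sets borel" and "sigma_finite_measure M"
    and inv: "\<And>v. distr M borel ((+) v) = M"
    and [measurable]: "A \<in> sets borel" "B \<in> sets borel"
  shows "emeasure M A * emeasure lborel B = emeasure M B * emeasure lborel A"
proof -
  interpret M: sigma_finite_measure M by fact
  interpret pair_sigma_finite M "lborel :: 'a measure" ..
  have spM: "space M = UNIV" using sets_eq_imp_space_eq[OF M] by simp
  have invM: "(\<integral>\<^sup>+x. f (v + x) \<partial>M) = (\<integral>\<^sup>+x. f x \<partial>M)"
    if [measurable]: "f \<in> borel_measurable borel" for f :: "'a \<Rightarrow> ennreal" and v
  proof -
    have "(\<integral>\<^sup>+x. f x \<partial>M) = (\<integral>\<^sup>+x. f x \<partial>distr M borel ((+) v))" by (simp add: inv)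
    also have "\<dots> = (\<integral>\<^sup>+x. f (v + x) \<partial>M)" by (rule nn_integral_distr) (simp_all add: measurable_cong_sets[OF M refl])
    finally show ?thesis by simp
  qed
  have invL: "(\<integral>\<^sup>+x. f (v + x) \<partial>lborel) = (\<integral>\<^sup>+x. f x \<partial>lborel)"
    if [measurable]: "f \<in> borel_measurable borel" for f :: "'a \<Rightarrow> ennreal" and v
  proof -
    have "(\<integral>\<^sup>+x. f x \<partial>lborel) = (\<integral>\<^sup>+x. f x \<partial>distr lborel borel ((+) v))" by (simp add: lborel_distr_plus)
    also have "\<dots> = (\<integral>\<^sup>+x. f (v + x) \<partial>lborel)" by (rule nn_integral_distr) measurable
    finally show ?thesis by simp
  qed
  have reflL: "(\<integral>\<^sup>+x. f (v - x) \<partial>lborel) = (\<integral>\<^sup>+x. f x \<partial>lborel)"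
    if [measurable]: "f \<in> borel_measurable borel" for f :: "'a \<Rightarrow> ennreal" and v
  proof -
    have eq: "distr lborel borel (\<lambda>x. v - x) = (lborel :: 'a measure)"
      using lborel_affine[of "-1" v] by (simp add: density_1)
    have "(\<integral>\<^sup>+x. f x \<partial>lborel) = (\<integral>\<^sup>+x. f x \<partial>distr lborel borel (\<lambda>x. v - x))" by (simp add: eq)
    also have "\<dots> = (\<integral>\<^sup>+x. f (v - x) \<partial>lborel)" by (rule nn_integral_distr) measurable
    finally show ?thesis by simp
  qed
  have "emeasure M A * emeasure lborel B = (\<integral>\<^sup>+x. indicator A x * emeasure lborel B \<partial>M)"
    by (subst nn_integral_multc) (auto simp: M)
  also have "\<dots> = (\<integral>\<^sup>+x. \<integral>\<^sup>+y. indicator A x * indicator B (x + y) \<partial>lborel \<partial>M)"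
    by (intro nn_integral_cong, subst nn_integral_cmult) (auto simp: invL)
  also have "\<dots> = (\<integral>\<^sup>+y. \<integral>\<^sup>+x. indicator A x * indicator B (x + y) \<partial>M \<partial>lborel)"
    by (rule Fubini'[symmetric]) measurable
  also have "\<dots> = (\<integral>\<^sup>+y. \<integral>\<^sup>+x. indicator A (x - y) * indicator B x \<partial>M \<partial>lborel)"
  proof (rule nn_integral_cong)
    fix y :: 'a
    show "(\<integral>\<^sup>+x. indicator A x * indicator B (x + y) \<partial>M) = (\<integral>\<^sup>+x. indicator A (x - y) * indicator B x \<partial>M)"
      using invM[of "\<lambda>x. indicator A (x - y) * indicator B x" y] by (simp add: add.commute)
  qed
  also have "\<dots> = (\<integral>\<^sup>+x. \<integral>\<^sup>+y. indicator A (x - y) * indicator B x \<partial>lborel \<partial>M)"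
    by (rule Fubini') measurable
  also have "\<dots> = (\<integral>\<^sup>+x. indicator B x * emeasure lborel A \<partial>M)"
    by (intro nn_integral_cong, subst nn_integral_multc) (auto simp: reflL mult.commute)
  also have "\<dots> = emeasure M B * emeasure lborel A"
    by (subst nn_integral_multc) (auto simp: M)
  finally show ?thesis .
qed

text \<open>The image of Lebesgue measure under a linear bijection is again translation invariant, so it is
  a multiple of Lebesgue measure. The factor is $1/|\det T|$, but its value can always be avoided
  below: either only its existence matters, or one explicit integral determines it.\<close>

lemma distr_lborel_linear:
  fixes T :: "'a::euclidean_space \<Rightarrow> 'a"
  assumes T: "linear T" "inj T"
  obtains c :: real where "c > 0" "\<And>b. distr lborel borel (\<lambda>x. T x + b) = density lborel (\<lambda>_. ennreal c)"
proof -
  have [measurable]: "T \<in> borel_measurable borel"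
    by (intro borel_measurable_continuous_onI linear_continuous_on) (use T in \<open>simp add: linear_conv_bounded_linear\<close>)
  have surj: "surj T" using T linear_injective_imp_surjective by blast
  define M where "M = distr lborel borel T"
  have sM: "sets M = sets borel" by (simp add: M_def)
  have inv: "distr M borel ((+) v) = M" for v
  proof -
    obtain u where u: "T u = v" using surj by (metis surjD)
    have "distr M borel ((+) v) = distr lborel borel (\<lambda>x. T (u + x))"
      unfolding M_def by (subst distr_distr) (auto simp: o_def linear_add[OF T(1)] u)
    also have "\<dots> = distr (distr lborel borel ((+) u)) borel T"
      by (subst distr_distr) (auto simp: o_def)
    finally show ?thesis by (simp add: lborel_distr_plus M_def)
  qed
  have fin: "emeasure M (cball 0 r) < \<infinity>" for r
  proof -
    obtain T' where T': "linear T'" "\<And>x. T' (T x) = x" 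
      using linear_injective_left_inverse[OF T] by (auto simp: fun_eq_iff)
    have "T -` cball 0 r \<subseteq> T' ` cball 0 r"
    proof
      fix x assume "x \<in> T -` cball 0 r"
      then show "x \<in> T' ` cball 0 r" using T'(2)[of x] by (intro image_eqI[where x="T x"]) auto
    qed
    moreover have "bounded (T' ` cball 0 r)"
      using T'(1) by (intro bounded_linear_image) (auto simp: linear_conv_bounded_linear)
    ultimately have "bounded (T -` cball 0 r)" by (rule bounded_subset[rotated])
    then show ?thesis
      using emeasure_bounded_finite[of "T -` cball 0 r"] by (simp add: M_def emeasure_distr)
  qed
  have sf: "sigma_finite_measure M"
  proof (rule sigma_finite_measure.intro, intro exI[of _ "range (\<lambda>n::nat. cball 0 (real n))"] conjI)
    show "\<Union> (range (\<lambda>n::nat. cball (0::'a) (real n))) = space M"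
      by (auto simp: M_def real_arch_simple)
  qed (use fin in \<open>auto simp: sM less_top\<close>)
  define q where "q = emeasure M (cball 0 1) / emeasure lborel (cball (0::'a) 1)"
  have pos: "emeasure lborel (cball (0::'a) 1) \<noteq> 0" "emeasure lborel (cball (0::'a) 1) < \<infinity>"
  proof -
    show "emeasure lborel (cball (0::'a) 1) < \<infinity>" using emeasure_bounded_finite[of "cball (0::'a) 1"] by simp
    have "(0::'a) \<in> interior (cball 0 1)" by (simp add: interior_cball)
    then have "\<not> negligible (cball (0::'a) 1)"
      using open_not_negligible[of "ball (0::'a) 1"] negligible_subset[of "cball (0::'a) 1" "ball 0 1"] by auto
    then show "emeasure lborel (cball (0::'a) 1) \<noteq> 0"
      by (simp add: negligible_iff_null_sets null_sets_completion_iff null_sets_def)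
  qed
  have qfin: "q < \<infinity>" unfolding q_def using pos fin[of 1] by (auto simp: less_top[symmetric] ennreal_divide_eq_top_iff)
  have eq: "emeasure M A = q * emeasure lborel A" if "A \<in> sets borel" for A
  proof -
    have "emeasure M A * emeasure lborel (cball (0::'a) 1) = emeasure M (cball 0 1) * emeasure lborel A"
      using translation_invariant_measure_unique[OF sM sf inv that, of "cball 0 1"] by simp
    then have "emeasure M A * emeasure lborel (cball (0::'a) 1) / emeasure lborel (cball (0::'a) 1) 
        = emeasure M (cball 0 1) * emeasure lborel A / emeasure lborel (cball (0::'a) 1)" by simp
    then show ?thesis using pos
      by (simp add: q_def ennreal_mult_divide_eq ennreal_times_divide less_top mult.commute)
  qed
  have "emeasure M UNIV = \<infinity>" by (simp add: M_def emeasure_distr)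
  then have "q \<noteq> 0" using eq[of UNIV] by auto
  define c where "c = enn2real q"
  have c: "c > 0" "ennreal c = q" using \<open>q \<noteq> 0\<close> qfin by (auto simp: c_def enn2real_positive_iff less_top zero_less_iff_neq_zero)
  have d: "M = density lborel (\<lambda>_. ennreal c)"
    by (rule measure_eqI) (auto simp: sM eq c emeasure_density nn_integral_cmult_indicator)
  have "distr lborel borel (\<lambda>x. T x + b) = M" for b
    using inv[of b] unfolding M_def by (subst (asm) distr_distr) (auto simp: o_def add.commute)
  with c d that show ?thesis by metis
qed

text \<open>The substitution rule as a property of \<open>S\<close>, stated for a general measure so that it passes from
  Borel to Lebesgue measure and from there to restrictions.\<close>

definition scales :: "'a measure \<Rightarrow> real \<Rightarrow> ('a \<Rightarrow> 'a) \<Rightarrow> bool" where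
  "scales M c S \<longleftrightarrow> c > 0 \<and> S \<in> M \<rightarrow>\<^sub>M M \<and> distr M M S = density M (\<lambda>_. ennreal c)"

lemma distr_lborel_codomain: "distr M lborel S = distr M borel S"
  by (rule distr_cong) auto

text \<open>Since \<open>c > 0\<close>, preimages of null sets are null sets; this is what measurability needs in order to
  survive the completion.\<close>

lemma scales_lebesgue:
  fixes S :: "'a::euclidean_space \<Rightarrow> 'a"
  assumes "scales lborel c S" shows "scales lebesgue c S"
proof -
  have c: "c > 0" and S [measurable]: "S \<in> borel_measurable borel"
    and d: "distr lborel borel S = density lborel (\<lambda>_. ennreal c)"
    using assms by (auto simp: scales_def distr_lborel_codomain)
  have dl: "distr lebesgue lborel S = density lborel (\<lambda>_. ennreal c)"
    using d by (simp add: distr_completion distr_lborel_codomain)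
  have ns: "null_sets (distr lebesgue lborel S) = null_sets lborel"
    unfolding dl using c by (auto simp: null_sets_def emeasure_density nn_integral_cmult_indicator)
  have m: "S \<in> lebesgue \<rightarrow>\<^sub>M lebesgue"
    by (rule completion.measurable_completion2) (auto simp: ns measurable_completion)
  have "distr lebesgue lebesgue S = completion (distr lebesgue lborel S)"
    by (rule completion.completion_distr_eq[symmetric]) (auto simp: ns measurable_completion)
  also have "\<dots> = density lebesgue (\<lambda>_. ennreal c)"
    unfolding dl using c by (subst completion_density_eq) auto
  finally show ?thesis using c m by (simp add: scales_def)
qed

lemma restrict_space_UNIV: "space M = UNIV \<Longrightarrow> restrict_space M UNIV = M"
  by (rule measure_eqI) (auto simp: emeasure_restrict_space)

lemma scales_restrict:
  assumes "scales M c S" and "space M = UNIV" and V: "V \<in> sets M"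
  shows "S \<in> restrict_space M (S -` V) \<rightarrow>\<^sub>M restrict_space M V"
    and "distr (restrict_space M (S -` V)) (restrict_space M V) S = density (restrict_space M V) (\<lambda>_. ennreal c)"
proof -
  have c: "c > 0" and S [measurable]: "S \<in> M \<rightarrow>\<^sub>M M" and d: "distr M M S = density M (\<lambda>_. ennreal c)"
    using assms by (auto simp: scales_def)
  have U: "S -` V \<in> sets M" using measurable_sets[OF S V] assms(2) by simp
  show m: "S \<in> restrict_space M (S -` V) \<rightarrow>\<^sub>M restrict_space M V"
    by (rule measurable_restrict_space3[OF S]) auto
  show "distr (restrict_space M (S -` V)) (restrict_space M V) S = density (restrict_space M V) (\<lambda>_. ennreal c)"
  proof (rule measure_eqI)
    fix A assume "A \<in> sets (distr (restrict_space M (S -` V)) (restrict_space M V) S)"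
    then have A: "A \<in> sets (restrict_space M V)" by simp
    then have A': "A \<in> sets M" "A \<subseteq> V" using V by (auto simp: sets_restrict_space_iff assms(2))
    have "emeasure (distr (restrict_space M (S -` V)) (restrict_space M V) S) A
        = emeasure (restrict_space M (S -` V)) (S -` A)"
      using A A' m U by (subst emeasure_distr) (auto simp: space_restrict_space assms(2) intro!: arg_cong2[where f=emeasure])
    also have "\<dots> = emeasure M (S -` A)"
      using A' U by (subst emeasure_restrict_space) (auto simp: assms(2))
    also have "\<dots> = emeasure (distr M M S) A" using A' by (subst emeasure_distr) (auto simp: assms(2))
    also have "\<dots> = ennreal c * emeasure M A"
      unfolding d using A' by (simp add: emeasure_density nn_integral_cmult_indicator)
    also have "\<dots> = emeasure (density (restrict_space M V) (\<lambda>_. ennreal c)) A"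
      using A A' V by (simp add: emeasure_density nn_integral_cmult_indicator emeasure_restrict_space assms(2))
    finally show "emeasure (distr (restrict_space M (S -` V)) (restrict_space M V) S) A
      = emeasure (density (restrict_space M V) (\<lambda>_. ennreal c)) A" .
  qed simp
qed

lemma scales_integral:
  fixes f :: "'a \<Rightarrow> 'b::{banach, second_countable_topology}"
  assumes "scales M c S" and "space M = UNIV" and V: "V \<in> sets M"
    and f [measurable]: "f \<in> borel_measurable (restrict_space M V)"
  shows "(\<lambda>x. f (S x)) \<in> borel_measurable (restrict_space M (S -` V))"
    and "(\<integral>x. f (S x) \<partial>restrict_space M (S -` V)) = c *\<^sub>R (\<integral>x. f x \<partial>restrict_space M V)"
    and "integrable (restrict_space M (S -` V)) (\<lambda>x. f (S x)) \<longleftrightarrow> integrable (restrict_space M V) f"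
proof -
  note r = scales_restrict[OF assms(1-3)]
  note [measurable] = r(1)
  have c: "c > 0" using assms by (simp add: scales_def)
  show "(\<lambda>x. f (S x)) \<in> borel_measurable (restrict_space M (S -` V))" by measurable
  have "(\<integral>x. f (S x) \<partial>restrict_space M (S -` V)) = (\<integral>x. f x \<partial>density (restrict_space M V) (\<lambda>_. ennreal c))"
    unfolding r(2)[symmetric] by (rule integral_distr[symmetric]) measurable
  also have "\<dots> = c *\<^sub>R (\<integral>x. f x \<partial>restrict_space M V)"
    using c by (subst integral_density) auto
  finally show "(\<integral>x. f (S x) \<partial>restrict_space M (S -` V)) = c *\<^sub>R (\<integral>x. f x \<partial>restrict_space M V)" .
  have "integrable (restrict_space M (S -` V)) (\<lambda>x. f (S x)) \<longleftrightarrow>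
      integrable (density (restrict_space M V) (\<lambda>_. ennreal c)) f"
    unfolding r(2)[symmetric] by (rule integrable_distr_eq[symmetric]) measurable
  also have "\<dots> \<longleftrightarrow> integrable (restrict_space M V) f"
  proof -
    have "integrable (restrict_space M V) f" if "integrable (restrict_space M V) (\<lambda>x. c *\<^sub>R f x)"
      using integrable_scaleR_right[of "1 / c", OF that] c by simp
    then show ?thesis using c by (subst integrable_density) auto
  qed
  finally show "integrable (restrict_space M (S -` V)) (\<lambda>x. f (S x)) \<longleftrightarrow> integrable (restrict_space M V) f" .
qed

lemma scales_affine:
  fixes T :: "'a::euclidean_space \<Rightarrow> 'a"
  assumes "linear T" "inj T"
  obtains c where "\<And>b. scales lborel c (\<lambda>x. T x + b)"
proof -
  have [measurable]: "T \<in> borel_measurable borel"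
    by (intro borel_measurable_continuous_onI linear_continuous_on) (use assms in \<open>simp add: linear_conv_bounded_linear\<close>)
  obtain c :: real where c: "c > 0" "\<And>b. distr lborel borel (\<lambda>x. T x + b) = density lborel (\<lambda>_. ennreal c)"
    using distr_lborel_linear[OF assms] by blast
  have "scales lborel c (\<lambda>x. T x + b)" for b
    using c by (simp add: scales_def distr_lborel_codomain)
  then show ?thesis by (rule that)
qed

lemma scales_translation:
  fixes v :: "'a::euclidean_space"
  shows "scales lborel 1 (\<lambda>x. x + v)"
proof -
  have "distr lborel borel (\<lambda>x. x + v) = lborel"
    proof -
    have "(\<lambda>x. x + v) = (+) v" by (auto simp: add.commute)
    then show ?thesis by (simp add: lborel_distr_plus)
  qed
  then show ?thesis by (simp add: scales_def density_1 distr_lborel_codomain)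
qed

text \<open>Substituting twice multiplies the measure of a ball by \<open>c * c\<close>.\<close>

lemma scales_involution:
  fixes S :: "'a::euclidean_space \<Rightarrow> 'a"
  assumes "scales lborel c S" "\<And>x. S (S x) = x"
  shows "c = 1"
proof -
  have c: "c > 0" and [measurable]: "S \<in> borel_measurable borel"
    using assms by (auto simp: scales_def)
  have m: "integral\<^sup>L lborel (\<lambda>x. f (S x)) = c * integral\<^sup>L lborel f"
    if "f \<in> borel_measurable borel" for f :: "'a \<Rightarrow> real"
    using scales_integral(2)[OF assms(1), of UNIV f] that by (simp add: restrict_space_UNIV)
  let ?f = "indicator (cball (0::'a) 1) :: 'a \<Rightarrow> real"
  have "integral\<^sup>L lborel ?f = c * (c * integral\<^sup>L lborel ?f)"
  proof -
    have 1: "integral\<^sup>L lborel (\<lambda>x. ?f (S (S x))) = c * integral\<^sup>L lborel (\<lambda>x. ?f (S x))"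
      by (rule m, rule measurable_compose[where g = ?f and N = borel]) (auto intro!: borel_measurable_indicator)
    have 2: "integral\<^sup>L lborel (\<lambda>x. ?f (S x)) = c * integral\<^sup>L lborel ?f"
      by (rule m) (auto intro!: borel_measurable_indicator)
    show ?thesis using 1 unfolding 2 assms(2) .
  qed
  moreover have "integral\<^sup>L lborel ?f > 0"
    using content_cball_pos[of 1 "0::'a"] by simp
  ultimately have "c * c = 1" by (metis less_irrefl mult.assoc mult_cancel_right1)
  then show ?thesis using c by (simp add: square_eq_1_iff)
qed

section \<open>Square integrable functions\<close>

lemma abs_mult_le_sum_squares: "\<bar>x * y\<bar> \<le> x\<^sup>2 + y\<^sup>2" for x y :: real
proof -
  have "0 \<le> (\<bar>x\<bar> - \<bar>y\<bar>)\<^sup>2" by simp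
  also have "\<dots> = x\<^sup>2 + y\<^sup>2 - 2 * \<bar>x * y\<bar>" by (simp add: power2_diff abs_mult)
  finally show ?thesis using abs_ge_zero[of "x * y"] by linarith
qed

lemma integrable_mult_square:
  fixes f g :: "'a \<Rightarrow> real"
  assumes [measurable]: "f \<in> borel_measurable M" "g \<in> borel_measurable M"
    and "integrable M (\<lambda>x. (f x)\<^sup>2)" "integrable M (\<lambda>x. (g x)\<^sup>2)"
  shows "integrable M (\<lambda>x. f x * g x)"
proof (rule Bochner_Integration.integrable_bound)
  show "integrable M (\<lambda>x. (f x)\<^sup>2 + (g x)\<^sup>2)" using assms by auto
  show "AE x in M. norm (f x * g x) \<le> norm ((f x)\<^sup>2 + (g x)\<^sup>2)"
    using abs_mult_le_sum_squares by simp
qed measurable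

lemma integrable_square_diff:
  fixes f g :: "'a \<Rightarrow> real"
  assumes [measurable]: "f \<in> borel_measurable M" "g \<in> borel_measurable M"
    and "integrable M (\<lambda>x. (f x)\<^sup>2)" "integrable M (\<lambda>x. (g x)\<^sup>2)"
  shows "integrable M (\<lambda>x. (f x - g x)\<^sup>2)"
  using integrable_mult_square[OF assms] assms(3,4) by (simp add: power2_diff mult.assoc)

lemma integral_Cauchy_Schwarz:
  fixes f g :: "'a \<Rightarrow> real"
  assumes [measurable]: "f \<in> borel_measurable M" "g \<in> borel_measurable M"
    and f: "integrable M (\<lambda>x. (f x)\<^sup>2)" and g: "integrable M (\<lambda>x. (g x)\<^sup>2)"
  shows "(\<integral>x. f x * g x \<partial>M)\<^sup>2 \<le> (\<integral>x. (f x)\<^sup>2 \<partial>M) * (\<integral>x. (g x)\<^sup>2 \<partial>M)"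
proof -
  define F G C where "F = (\<integral>x. (f x)\<^sup>2 \<partial>M)" "G = (\<integral>x. (g x)\<^sup>2 \<partial>M)" "C = (\<integral>x. f x * g x \<partial>M)"
  have fg: "integrable M (\<lambda>x. f x * g x)" by (rule integrable_mult_square[OF assms])
  have q: "0 \<le> F - 2 * t * C + t\<^sup>2 * G" for t
  proof -
    have "0 \<le> (\<integral>x. (f x - t * g x)\<^sup>2 \<partial>M)" by simp
    also have "\<dots> = (\<integral>x. (f x)\<^sup>2 - (2 * t) * (f x * g x) + t\<^sup>2 * (g x)\<^sup>2 \<partial>M)"
      by (intro Bochner_Integration.integral_cong) (auto simp: power2_diff power_mult_distrib)
    also have "\<dots> = F - 2 * t * C + t\<^sup>2 * G"
      unfolding F_G_C_def using f g fg by simp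
    finally show ?thesis .
  qed
  have "F \<ge> 0" "G \<ge> 0" by (auto simp: F_G_C_def)
  show ?thesis
  proof (cases "G = 0")
    case True
    have "C = 0"
    proof (rule ccontr)
      assume "C \<noteq> 0"
      then show False using q[of "(F + 1) / (2 * C)"] True \<open>F \<ge> 0\<close> by (simp add: field_simps)
    qed
    then show ?thesis using \<open>F \<ge> 0\<close> \<open>G \<ge> 0\<close> by (simp add: F_G_C_def[symmetric])
  next
    case False
    then have "G > 0" using \<open>G \<ge> 0\<close> by simp
    then have "C\<^sup>2 \<le> F * G" using q[of "C / G"] by (simp add: field_simps power2_eq_square)
    then show ?thesis by (simp add: F_G_C_def)
  qed
qed

text \<open>The Cauchy--Schwarz inequality makes integration against a fixed square integrable function
  continuous.\<close>

lemma L2_tendsto_integral_mult: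
  fixes f g :: "'a \<Rightarrow> real"
  assumes [measurable]: "\<And>m. fm m \<in> borel_measurable M" "f \<in> borel_measurable M" "g \<in> borel_measurable M"
    and fm: "\<And>m::nat. integrable M (\<lambda>x. (fm m x)\<^sup>2)" and f: "integrable M (\<lambda>x. (f x)\<^sup>2)"
    and g: "integrable M (\<lambda>x. (g x)\<^sup>2)"
    and lim: "(\<lambda>m. \<integral>x. (fm m x - f x)\<^sup>2 \<partial>M) \<longlonglongrightarrow> 0"
  shows "(\<lambda>m. \<integral>x. fm m x * g x \<partial>M) \<longlonglongrightarrow> (\<integral>x. f x * g x \<partial>M)"
proof -
  have "(\<lambda>m. (\<integral>x. (fm m x - f x)\<^sup>2 \<partial>M) * (\<integral>x. (g x)\<^sup>2 \<partial>M)) \<longlonglongrightarrow> 0"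
    using tendsto_mult_right[OF lim, of "\<integral>x. (g x)\<^sup>2 \<partial>M"] by simp
  then have "(\<lambda>m. ((\<integral>x. fm m x * g x \<partial>M) - (\<integral>x. f x * g x \<partial>M))\<^sup>2) \<longlonglongrightarrow> 0"
  proof (rule tendsto_sandwich[OF _ _ tendsto_const, rotated -1])
    show "\<forall>\<^sub>F m in sequentially. ((\<integral>x. fm m x * g x \<partial>M) - (\<integral>x. f x * g x \<partial>M))\<^sup>2
        \<le> (\<integral>x. (fm m x - f x)\<^sup>2 \<partial>M) * (\<integral>x. (g x)\<^sup>2 \<partial>M)"
    proof (rule always_eventually, rule allI)
      fix m
      have "(\<integral>x. fm m x * g x \<partial>M) - (\<integral>x. f x * g x \<partial>M) = (\<integral>x. (fm m x - f x) * g x \<partial>M)"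
        using integrable_mult_square[OF _ _ fm g, of m] integrable_mult_square[OF _ _ f g]
        by (simp add: left_diff_distrib)
      then show "((\<integral>x. fm m x * g x \<partial>M) - (\<integral>x. f x * g x \<partial>M))\<^sup>2
        \<le> (\<integral>x. (fm m x - f x)\<^sup>2 \<partial>M) * (\<integral>x. (g x)\<^sup>2 \<partial>M)"
        using integral_Cauchy_Schwarz[of "\<lambda>x. fm m x - f x" M g] integrable_square_diff[OF _ _ fm f] g by simp
    qed
  qed auto
  then have "(\<lambda>m. (\<integral>x. fm m x * g x \<partial>M) - (\<integral>x. f x * g x \<partial>M)) \<longlonglongrightarrow> 0" by simp
  then show ?thesis by (simp add: LIM_zero_iff)
qed

text \<open>Truncation reduces the claim to a bounded function. A measurable function is a pointwise limit
  almost everywhere of continuous functions; after clamping these to the same bound and cutting them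
  off outside a ball, the convergence is dominated.\<close>

lemma L2_approx_continuous:
  fixes b :: "'a::euclidean_space \<Rightarrow> real"
  assumes [measurable]: "b \<in> borel_measurable borel" and b: "integrable lborel (\<lambda>x. (b x)\<^sup>2)"
    and supp: "\<And>x. x \<notin> cball 0 R \<Longrightarrow> b x = 0" and e: "e > 0"
  obtains s :: "'a \<Rightarrow> real" and B where "continuous_on UNIV s" "\<And>x. \<bar>s x\<bar> \<le> B"
    "integrable lborel (\<lambda>x. (s x)\<^sup>2)" "(\<integral>x. (b x - s x)\<^sup>2 \<partial>lborel) < e"
proof -
  define bn where "bn n x = max (- real n) (min (real n) (b x))" for n :: nat and x
  have [measurable]: "bn n \<in> borel_measurable borel" for n unfolding bn_def by measurable
  have bn_le: "\<bar>bn n x\<bar> \<le> \<bar>b x\<bar>" "\<bar>bn n x\<bar> \<le> real n" "\<bar>b x - bn n x\<bar> \<le> \<bar>b x\<bar>" for n x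
    by (auto simp: bn_def)
  have "(\<lambda>n. \<integral>x. (b x - bn n x)\<^sup>2 \<partial>lborel) \<longlonglongrightarrow> (\<integral>x. 0 \<partial>(lborel::'a measure))"
  proof (rule integral_dominated_convergence[where w="\<lambda>x. (b x)\<^sup>2"])
    show "AE x in lborel. (\<lambda>n. (b x - bn n x)\<^sup>2) \<longlonglongrightarrow> 0"
    proof (rule AE_I2, rule tendsto_eventually)
      fix x
      obtain N :: nat where "\<bar>b x\<bar> \<le> real N" using real_arch_simple by blast
      then show "\<forall>\<^sub>F n in sequentially. (b x - bn n x)\<^sup>2 = 0"
        unfolding eventually_sequentially by (intro exI[of _ N]) (auto simp: bn_def)
    qed
    show "AE x in lborel. norm ((b x - bn n x)\<^sup>2) \<le> (b x)\<^sup>2" for n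
      using bn_le(3) by (auto simp: abs_le_square_iff)
  qed (use b in measurable)
  then have "\<forall>\<^sub>F n in sequentially. (\<integral>x. (b x - bn n x)\<^sup>2 \<partial>lborel) < e / 4"
    using e by (intro order_tendstoD(2)[of _ 0]) auto
  then obtain n where n: "(\<integral>x. (b x - bn n x)\<^sup>2 \<partial>lborel) < e / 4"
    by (auto simp: eventually_sequentially)
  have bnint: "integrable lborel (\<lambda>x. (bn n x)\<^sup>2)"
    by (rule Bochner_Integration.integrable_bound[OF b]) (use bn_le(1) in \<open>auto simp: abs_le_square_iff\<close>)
  have "bn n measurable_on UNIV"
    by (rule lebesgue_measurable_imp_measurable_on) (auto simp: measurable_completion)
  then obtain N g where N: "negligible N" and gc: "\<And>k. continuous_on UNIV (g k)"
    and gl: "\<And>x. x \<notin> N \<Longrightarrow> (\<lambda>k. g k x) \<longlonglongrightarrow> bn n x"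
    unfolding measurable_on_def by auto
  define cutoff where "cutoff x = max 0 (min 1 (R + 1 - norm x))" for x :: 'a
  define s where "s k x = max (- real n) (min (real n) (g k x)) * cutoff x" for k :: nat and x
  have sc: "continuous_on UNIV (s k)" for k
    unfolding s_def cutoff_def by (intro continuous_intros gc)
  have [measurable]: "s k \<in> borel_measurable borel" for k
    by (rule borel_measurable_continuous_onI[OF sc])
  have chi: "0 \<le> cutoff x" "cutoff x \<le> 1" for x by (auto simp: cutoff_def)
  have s_le: "\<bar>s k x\<bar> \<le> real n" for k x
  proof -
    have "\<bar>s k x\<bar> \<le> real n * 1"
      unfolding s_def abs_mult using chi[of x] by (intro mult_mono) auto
    then show ?thesis by simp
  qed
  have s0: "x \<notin> cball 0 (R + 1) \<Longrightarrow> s k x = 0" for k x by (auto simp: s_def cutoff_def)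
  have bn0: "x \<notin> cball 0 R \<Longrightarrow> bn n x = 0" for x using supp by (simp add: bn_def)
  have ci: "integrable lborel (\<lambda>x. c * indicator (cball (0::'a) (R+1)) x)" for c :: real
    using emeasure_bounded_finite[of "cball (0::'a) (R+1)"] by (intro integrable_mult_right) simp
  have sint: "integrable lborel (\<lambda>x. (s k x)\<^sup>2)" for k
  proof (rule Bochner_Integration.integrable_bound[OF ci[of "(real n)\<^sup>2"]])
    show "AE x in lborel. norm ((s k x)\<^sup>2) \<le> norm ((real n)\<^sup>2 * indicator (cball (0::'a) (R+1)) x)"
      using s_le[of k] s0[of _ k] by (auto simp: indicator_def abs_le_square_iff[symmetric])
  qed measurable
  have AEN: "AE x in lborel. x \<notin> N"
    using N AE_not_in[of N lebesgue] by (simp add: negligible_iff_null_sets AE_completion_iff)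
  have "(\<lambda>k. \<integral>x. (bn n x - s k x)\<^sup>2 \<partial>lborel) \<longlonglongrightarrow> (\<integral>x. 0 \<partial>(lborel::'a measure))"
  proof (rule integral_dominated_convergence[where w="\<lambda>x. (2 * real n)\<^sup>2 * indicator (cball 0 (R+1)) x"])
    show "AE x in lborel. (\<lambda>k. (bn n x - s k x)\<^sup>2) \<longlonglongrightarrow> 0"
      using AEN
    proof eventually_elim
      case (elim x)
      have "(\<lambda>k. s k x) \<longlonglongrightarrow> max (- real n) (min (real n) (bn n x)) * cutoff x"
        unfolding s_def by (intro tendsto_intros gl elim)
      also have "max (- real n) (min (real n) (bn n x)) * cutoff x = bn n x"
        using bn0[of x] bn_le(2)[of n x] by (cases "norm x \<le> R") (auto simp: cutoff_def min_def max_def)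
      finally have "(\<lambda>k. (bn n x - s k x)\<^sup>2) \<longlonglongrightarrow> (bn n x - bn n x)\<^sup>2"
        by (intro tendsto_intros)
      then show ?case by simp
    qed
    have "\<bar>bn n x - s k x\<bar> \<le> 2 * real n" for x k using bn_le(2)[of n x] s_le[of k x] by auto
    then have "(bn n x - s k x)\<^sup>2 \<le> (2 * real n)\<^sup>2" for x k
      using power_mono[OF _ abs_ge_zero, of "bn n x - s k x" "2 * real n" 2] by simp
    then show "AE x in lborel. norm ((bn n x - s k x)\<^sup>2) \<le> (2 * real n)\<^sup>2 * indicator (cball 0 (R+1)) x" for k
      using s0[of _ k] bn0 by (auto simp: indicator_def)
  qed (use ci in auto)
  then have "\<forall>\<^sub>F k in sequentially. (\<integral>x. (bn n x - s k x)\<^sup>2 \<partial>lborel) < e / 4"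
    using e by (intro order_tendstoD(2)[of _ 0]) auto
  then obtain k where k: "(\<integral>x. (bn n x - s k x)\<^sup>2 \<partial>lborel) < e / 4"
    by (auto simp: eventually_sequentially)
  have "(\<integral>x. (b x - s k x)\<^sup>2 \<partial>lborel) \<le> (\<integral>x. 2 * (b x - bn n x)\<^sup>2 + 2 * (bn n x - s k x)\<^sup>2 \<partial>lborel)"
  proof (rule integral_mono)
    show "(b x - s k x)\<^sup>2 \<le> 2 * (b x - bn n x)\<^sup>2 + 2 * (bn n x - s k x)\<^sup>2" for x
      using sum_squares_bound[of "b x - bn n x" "bn n x - s k x"]
      by (simp add: power2_eq_square algebra_simps)
  qed (use b bnint sint in \<open>auto intro!: Bochner_Integration.integrable_add integrable_mult_right integrable_square_diff\<close>)
  also have "\<dots> = 2 * (\<integral>x. (b x - bn n x)\<^sup>2 \<partial>lborel) + 2 * (\<integral>x. (bn n x - s k x)\<^sup>2 \<partial>lborel)"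
    using integrable_square_diff[OF _ _ b bnint] integrable_square_diff[OF _ _ bnint sint] by simp
  also have "\<dots> < e" using n k by simp
  finally show ?thesis using that sc s_le sint by metis
qed


section \<open>Correlations\<close>

text \<open>Two statements below would usually be proved by mollification: the fundamental lemma of the
  calculus of variations, and integration by parts of \<open>\<mu>\<close> against a compactly supported Sobolev
  function. Both say that $h(0) = 0$ for a correlation $h(z) = \int a(y)\, b(y + z)\, dy$. Test functions
  $x \mapsto \rho(x - y)$ yield $\int \rho h = 0$ for all bump functions \<open>\<rho>\<close> near 0, and \<open>h\<close> is
  continuous. In this way no smoothness of a convolution has to be shown.\<close>

definition correlation :: "('a::euclidean_space \<Rightarrow> real) \<Rightarrow> ('a \<Rightarrow> real) \<Rightarrow> 'a \<Rightarrow> real" where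
  "correlation a b z = (\<integral>y. a y * b (y + z) \<partial>lborel)"

lemma lborel_translate:
  fixes f :: "'a::euclidean_space \<Rightarrow> real"
  assumes [measurable]: "f \<in> borel_measurable borel"
  shows "(\<integral>x. f (x + v) \<partial>lborel) = (\<integral>x. f x \<partial>lborel)"
    and "integrable lborel (\<lambda>x. f (x + v)) \<longleftrightarrow> integrable lborel f"
  using assms scales_integral(2,3)[OF scales_translation[of v], of UNIV f] by (simp_all add: restrict_space_UNIV)

lemma lborel_reflect:
  fixes f :: "'a::euclidean_space \<Rightarrow> real"
  assumes [measurable]: "f \<in> borel_measurable borel"
  shows "(\<integral>x. f (- x) \<partial>lborel) = (\<integral>x. f x \<partial>lborel)"
    and "integrable lborel (\<lambda>x. f (- x)) \<longleftrightarrow> integrable lborel f"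
proof -
  have "linear (uminus :: 'a \<Rightarrow> 'a)" "inj (uminus :: 'a \<Rightarrow> 'a)" by (auto intro: module_hom_uminus injI)
  then obtain c where "scales lborel c (\<lambda>x::'a. - x + 0)" using scales_affine by blast
  then have "scales lborel c (uminus :: 'a \<Rightarrow> 'a)" by simp
  moreover from scales_involution[OF this] have "c = 1" by simp
  ultimately have s: "scales lborel 1 (uminus :: 'a \<Rightarrow> 'a)" by simp
  show "(\<integral>x. f (- x) \<partial>lborel) = (\<integral>x. f x \<partial>lborel)"
    and "integrable lborel (\<lambda>x. f (- x)) \<longleftrightarrow> integrable lborel f"
    using scales_integral(2,3)[OF s, of UNIV f] by (simp_all add: restrict_space_UNIV)
qed

lemma correlation_bound:
  fixes a b :: "'a::euclidean_space \<Rightarrow> real"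
  assumes [measurable]: "a \<in> borel_measurable borel" "b \<in> borel_measurable borel"
    and a: "integrable lborel (\<lambda>x. (a x)\<^sup>2)" and b: "integrable lborel (\<lambda>x. (b x)\<^sup>2)"
  shows "(correlation a b z)\<^sup>2 \<le> (\<integral>x. (a x)\<^sup>2 \<partial>lborel) * (\<integral>x. (b x)\<^sup>2 \<partial>lborel)"
    and "integrable lborel (\<lambda>y. a y * b (y + z))"
proof -
  have b': "integrable lborel (\<lambda>x. (b (x + z))\<^sup>2)" "(\<integral>x. (b (x + z))\<^sup>2 \<partial>lborel) = (\<integral>x. (b x)\<^sup>2 \<partial>lborel)"
    using b lborel_translate[of "\<lambda>x. (b x)\<^sup>2" z] by simp_all
  show "(correlation a b z)\<^sup>2 \<le> (\<integral>x. (a x)\<^sup>2 \<partial>lborel) * (\<integral>x. (b x)\<^sup>2 \<partial>lborel)"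
    unfolding correlation_def using integral_Cauchy_Schwarz[OF _ _ a b'(1)] b'(2) by simp
  show "integrable lborel (\<lambda>y. a y * b (y + z))"
    by (rule integrable_mult_square[OF _ _ a b'(1)]) measurable
qed

text \<open>For a bounded continuous \<open>s\<close> in place of \<open>b\<close> the claim is dominated convergence. By the
  Cauchy--Schwarz inequality, \<open>correlation a b\<close> is a uniform limit of such correlations.\<close>

lemma correlation_isCont:
  fixes a b :: "'a::euclidean_space \<Rightarrow> real"
  assumes [measurable]: "a \<in> borel_measurable borel" "b \<in> borel_measurable borel"
    and a: "integrable lborel (\<lambda>x. (a x)\<^sup>2)" "integrable lborel a"
    and b: "integrable lborel (\<lambda>x. (b x)\<^sup>2)" "\<And>x. x \<notin> cball 0 R \<Longrightarrow> b x = 0"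
  shows "isCont (correlation a b) z0"
proof -
  have approx: "\<exists>k. isCont k z0 \<and> (\<forall>z. \<bar>correlation a b z - k z\<bar> < e)" if e: "e > 0" for e
  proof -
    define A where "A = (\<integral>x. (a x)\<^sup>2 \<partial>lborel)"
    have A: "A \<ge> 0" by (simp add: A_def)
    have "e\<^sup>2 / (A + 1) > 0" using A e by simp
    from L2_approx_continuous[OF assms(2) b this] obtain s :: "'a \<Rightarrow> real" and B
      where s: "continuous_on UNIV s" "\<And>x. \<bar>s x\<bar> \<le> B" "integrable lborel (\<lambda>x. (s x)\<^sup>2)"
        "(\<integral>x. (b x - s x)\<^sup>2 \<partial>lborel) < e\<^sup>2 / (A + 1)" by blast
    have [measurable]: "s \<in> borel_measurable borel" by (rule borel_measurable_continuous_onI[OF s(1)])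
    have "isCont (correlation a s) z0"
      unfolding continuous_at_sequentially
    proof (intro allI impI)
      fix u :: "nat \<Rightarrow> 'a" assume u: "u \<longlonglongrightarrow> z0"
      show "(correlation a s \<circ> u) \<longlonglongrightarrow> correlation a s z0"
        unfolding correlation_def o_def
      proof (rule integral_dominated_convergence[where w="\<lambda>y. \<bar>a y\<bar> * B"])
        show "AE y in lborel. (\<lambda>n. a y * s (y + u n)) \<longlonglongrightarrow> a y * s (y + z0)"
          by (intro AE_I2 tendsto_intros continuous_on_tendsto_compose[OF s(1)] u) auto
        show "AE y in lborel. norm (a y * s (y + u n)) \<le> \<bar>a y\<bar> * B" for n
          using s(2) by (auto simp: abs_mult intro!: mult_left_mono)
      qed (use a(2) in auto)
    qed
    moreover have "\<bar>correlation a b z - correlation a s z\<bar> < e" for z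
    proof -
      have "correlation a b z - correlation a s z = correlation a (\<lambda>x. b x - s x) z"
        using correlation_bound(2)[OF _ _ a(1) b(1), of z] correlation_bound(2)[OF _ _ a(1) s(3), of z]
        by (simp add: correlation_def right_diff_distrib)
      then have "(correlation a b z - correlation a s z)\<^sup>2 \<le> A * (\<integral>x. (b x - s x)\<^sup>2 \<partial>lborel)"
        using correlation_bound(1)[OF _ _ a(1) integrable_square_diff[OF _ _ b(1) s(3)], of z] by (simp add: A_def)
      also have "\<dots> \<le> A * (e\<^sup>2 / (A + 1))" using s(4) A by (intro mult_left_mono) auto
      also have "\<dots> < e\<^sup>2" using A e by (simp add: field_simps)
      finally have lt: "(correlation a b z - correlation a s z)\<^sup>2 < e\<^sup>2" .
      show ?thesis by (rule power2_less_imp_less) (use lt e in simp_all)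
    qed
    ultimately show ?thesis by blast
  qed
  show ?thesis
    unfolding continuous_at_eps_delta
  proof (intro allI impI)
    fix e :: real assume e: "e > 0"
    obtain k where k: "isCont k z0" "\<And>z. \<bar>correlation a b z - k z\<bar> < e / 3"
      using approx[of "e / 3"] e by auto
    obtain d where d: "d > 0" "\<And>z. dist z z0 < d \<Longrightarrow> \<bar>k z - k z0\<bar> < e / 3"
      using k(1)[unfolded continuous_at_eps_delta, rule_format, of "e / 3"] e by (auto simp: dist_real_def)
    have "dist (correlation a b z) (correlation a b z0) < e" if "dist z z0 < d" for z
      using d(2)[OF that] k(2)[of z] k(2)[of z0] unfolding dist_real_def by linarith
    then show "\<exists>d>0. \<forall>x'. dist x' z0 < d \<longrightarrow> dist (correlation a b x') (correlation a b z0) < e"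
      using d(1) by blast
  qed
qed

text \<open>Both sides are the double integral of $a(y)\, b(x)\, \rho(x - y)$. It converges absolutely
  because $|a(y)\, b(x)| \le a(y)^2 + b(x)^2$.\<close>

lemma correlation_fubini:
  fixes a b \<rho> :: "'a::euclidean_space \<Rightarrow> real"
  assumes [measurable]: "a \<in> borel_measurable borel" "b \<in> borel_measurable borel"
    and a: "integrable lborel (\<lambda>x. (a x)\<^sup>2)" and b: "integrable lborel (\<lambda>x. (b x)\<^sup>2)"
    and \<rho>: "integrable lborel \<rho>"
  shows "integrable lborel (\<lambda>z. \<rho> z * correlation a b z)"
    and "(\<integral>z. \<rho> z * correlation a b z \<partial>lborel) = (\<integral>y. a y * (\<integral>x. b x * \<rho> (x - y) \<partial>lborel) \<partial>lborel)"
    and "integrable lborel (\<lambda>y. a y * (\<integral>x. b x * \<rho> (x - y) \<partial>lborel))"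
proof -
  have [measurable]: "\<rho> \<in> borel_measurable borel" using borel_measurable_integrable[OF \<rho>] by simp
  define C where "C = (\<integral>x. (a x)\<^sup>2 \<partial>lborel) + (\<integral>x. (b x)\<^sup>2 \<partial>lborel)"
  let ?k = "\<lambda>z y. \<rho> z * (a y * b (y + z))"
  note inta = correlation_bound(2)[OF assms(1,2) a b]
  have inner: "(\<integral>y. norm (?k z y) \<partial>lborel) \<le> \<bar>\<rho> z\<bar> * C" for z
  proof -
    have "integrable lborel (\<lambda>x. (b (x + z))\<^sup>2)" "(\<integral>x. (b (x + z))\<^sup>2 \<partial>lborel) = (\<integral>x. (b x)\<^sup>2 \<partial>lborel)"
      using b lborel_translate[of "\<lambda>x. (b x)\<^sup>2" z] by simp_all
    note b' = this
    have "(\<integral>y. \<bar>a y * b (y + z)\<bar> \<partial>lborel) \<le> (\<integral>y. (a y)\<^sup>2 + (b (y + z))\<^sup>2 \<partial>lborel)"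
    proof (rule integral_mono)
      show "\<bar>a y * b (y + z)\<bar> \<le> (a y)\<^sup>2 + (b (y + z))\<^sup>2" for y
        by (rule abs_mult_le_sum_squares)
    qed (use a b' inta[of z] in auto)
    also have "\<dots> = C" using a b' by (simp add: C_def)
    finally show ?thesis by (simp add: abs_mult[of "\<rho> z"] mult_left_mono)
  qed
  have int: "integrable (lborel \<Otimes>\<^sub>M lborel) (case_prod ?k)"
  proof (rule lborel_pair.Fubini_integrable)
    show "integrable lborel (\<lambda>z. \<integral>y. norm (case_prod ?k (z, y)) \<partial>lborel)"
    proof (rule Bochner_Integration.integrable_bound[where f="\<lambda>z. \<bar>\<rho> z\<bar> * C"])
      show "AE z in lborel. norm (\<integral>y. norm (case_prod ?k (z, y)) \<partial>lborel) \<le> norm (\<bar>\<rho> z\<bar> * C)"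
        using inner by (intro AE_I2) (auto simp: C_def)
    qed (use \<rho> in auto)
    show "AE z in lborel. integrable lborel (\<lambda>y. case_prod ?k (z, y))"
      using inta by auto
  qed measurable
  have "integrable lborel (\<lambda>z. \<integral>y. ?k z y \<partial>lborel)" by (rule lborel_pair.integrable_fst[OF int])
  then show "integrable lborel (\<lambda>z. \<rho> z * correlation a b z)" by (simp add: correlation_def)
  have sub: "(\<integral>z. ?k z y \<partial>lborel) = a y * (\<integral>x. b x * \<rho> (x - y) \<partial>lborel)" for y
  proof -
    have "(\<integral>z. ?k z y \<partial>lborel) = (\<integral>z. a y * (b (z + y) * \<rho> (z + y - y)) \<partial>lborel)"
      by (rule Bochner_Integration.integral_cong) (auto simp: ac_simps)
    also have "\<dots> = a y * (\<integral>x. b x * \<rho> (x - y) \<partial>lborel)"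
      using lborel_translate(1)[of "\<lambda>x. b x * \<rho> (x - y)" y] by simp
    finally show ?thesis .
  qed
  have "(\<integral>z. \<rho> z * correlation a b z \<partial>lborel) = (\<integral>z. (\<integral>y. ?k z y \<partial>lborel) \<partial>lborel)"
    by (simp add: correlation_def)
  also have "\<dots> = (\<integral>y. (\<integral>z. ?k z y \<partial>lborel) \<partial>lborel)"
    by (rule lborel_pair.Fubini_integral[OF int, symmetric])
  finally show "(\<integral>z. \<rho> z * correlation a b z \<partial>lborel) = (\<integral>y. a y * (\<integral>x. b x * \<rho> (x - y) \<partial>lborel) \<partial>lborel)"
    unfolding sub .
  have "integrable lborel (\<lambda>y. \<integral>z. ?k z y \<partial>lborel)" by (rule lborel_pair.integrable_snd[OF int])
  then show "integrable lborel (\<lambda>y. a y * (\<integral>x. b x * \<rho> (x - y) \<partial>lborel))" unfolding sub .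
qed

lemma correlation_flip:
  fixes a b :: "'a::euclidean_space \<Rightarrow> real"
  assumes [measurable]: "a \<in> borel_measurable borel" "b \<in> borel_measurable borel"
  shows "correlation a b z = correlation b a (- z)"
proof -
  have "(\<lambda>x. b x * a (x - z)) \<in> borel_measurable borel" by measurable
  from lborel_translate(1)[OF this, of z] show ?thesis
    by (simp add: correlation_def mult.commute[of "b _"])
qed

text \<open>The other order of integration, obtained by exchanging \<open>a\<close> and \<open>b\<close> and reflecting \<open>\<rho>\<close>.\<close>

lemma correlation_fubini':
  fixes a b \<rho> :: "'a::euclidean_space \<Rightarrow> real"
  assumes [measurable]: "a \<in> borel_measurable borel" "b \<in> borel_measurable borel"
    and a: "integrable lborel (\<lambda>x. (a x)\<^sup>2)" and b: "integrable lborel (\<lambda>x. (b x)\<^sup>2)"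
    and \<rho>: "integrable lborel \<rho>"
  shows "(\<integral>z. \<rho> z * correlation a b z \<partial>lborel) = (\<integral>x. b x * (\<integral>y. a y * \<rho> (x - y) \<partial>lborel) \<partial>lborel)"
proof -
  have [measurable]: "\<rho> \<in> borel_measurable borel" using borel_measurable_integrable[OF \<rho>] by simp
  have \<rho>': "integrable lborel (\<lambda>z. \<rho> (- z))" using lborel_reflect(2)[of \<rho>] \<rho> by simp
  note F = correlation_fubini[OF assms(2,1) b a \<rho>']
  have [measurable]: "(\<lambda>z. \<rho> (- z) * correlation b a z) \<in> borel_measurable borel"
    using borel_measurable_integrable[OF F(1)] by simp
  have "(\<integral>z. \<rho> z * correlation a b z \<partial>lborel) = (\<integral>z. \<rho> (- (- z)) * correlation b a (- z) \<partial>lborel)"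
    by (simp add: correlation_flip[OF assms(1,2)])
  also have "\<dots> = (\<integral>z. \<rho> (- z) * correlation b a z \<partial>lborel)"
    using lborel_reflect(1)[of "\<lambda>z. \<rho> (- z) * correlation b a z"] by simp
  finally show ?thesis using F(2) by simp
qed

text \<open>Otherwise \<open>h 0 * h z\<close> is bounded below by a positive constant near 0, and a nonnegative bump
  function supported there has a nonzero integral against \<open>h\<close>.\<close>

lemma isCont_zero_of_bumps:
  fixes h :: "real^'n::finite \<Rightarrow> real"
  assumes h: "isCont h 0" and r: "r > 0"
    and int: "\<And>\<rho>. smooth \<rho> \<Longrightarrow> (\<And>x. norm x \<ge> r \<Longrightarrow> \<rho> x = 0) \<Longrightarrow> integrable lborel (\<lambda>z. \<rho> z * h z)"
    and zero: "\<And>\<rho>. smooth \<rho> \<Longrightarrow> (\<And>x. norm x \<ge> r \<Longrightarrow> \<rho> x = 0) \<Longrightarrow> (\<integral>z. \<rho> z * h z \<partial>lborel) = 0"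
  shows "h 0 = 0"
proof (rule ccontr)
  assume "h 0 \<noteq> 0"
  \<comment> \<open>Multiplying by \<open>c\<close> makes \<open>c * h\<close> positive at 0 whatever the sign of \<open>h 0\<close> is.\<close>
  define c where "c = h 0 / 2"
  have "isCont (\<lambda>x. c * h x) 0" using h by (intro continuous_intros)
  moreover have "c * h 0 > c * c" using \<open>h 0 \<noteq> 0\<close> by (auto simp: c_def field_simps not_less) (metis mult_pos_pos mult_neg_neg neq_iff)
  ultimately have "\<forall>\<^sub>F x in at 0. c * h x > c * c"
    unfolding isCont_def by (rule order_tendstoD(1))
  then obtain d where d: "d > 0" "\<And>x. x \<noteq> 0 \<Longrightarrow> dist x 0 < d \<Longrightarrow> c * h x > c * c"
    unfolding eventually_at by auto
  have pos: "c * h x \<ge> c * c" if "norm x < d" for x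
    using d(2)[of x] \<open>c * h 0 > c * c\<close> that by (cases "x = 0") auto
  have "min d r > 0" using d r by simp
  then obtain \<rho> :: "real^'n \<Rightarrow> real" where \<rho>: "smooth \<rho>" "\<And>x. \<rho> x \<ge> 0" "\<rho> 0 > 0" "\<And>x. norm x \<ge> min d r \<Longrightarrow> \<rho> x = 0"
    using ex_bump by metis
  have [measurable]: "\<rho> \<in> borel_measurable borel"
    by (rule smooth_borel[OF \<rho>(1)])
  have \<rho>r: "\<rho> x = 0" if "norm x \<ge> r" for x using \<rho>(4) that by simp
  have cc: "c * c > 0" using \<open>h 0 \<noteq> 0\<close> by (auto simp: c_def zero_less_mult_iff)
  have le: "(c * c) * \<rho> x \<le> c * (\<rho> x * h x)" for x
  proof (cases "norm x < d")
    case True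
    then show ?thesis using mult_right_mono[OF pos[OF True] \<rho>(2)[of x]] by (simp add: ac_simps)
  next
    case False
    then show ?thesis using \<rho>(4)[of x] by simp
  qed
  have ih: "integrable lborel (\<lambda>x. c * (\<rho> x * h x))" using int[OF \<rho>(1) \<rho>r] by simp
  have i1: "integrable lborel (\<lambda>x. (c * c) * \<rho> x)"
  proof (rule Bochner_Integration.integrable_bound[OF ih])
    show "AE x in lborel. norm (c * c * \<rho> x) \<le> norm (c * (\<rho> x * h x))"
    proof (rule AE_I2)
      fix x
      have "0 \<le> c * c * \<rho> x" using cc \<rho>(2)[of x] by simp
      then show "norm (c * c * \<rho> x) \<le> norm (c * (\<rho> x * h x))" using le[of x] by simp
    qed
  qed measurable
  have "(\<integral>x. (c * c) * \<rho> x \<partial>lborel) \<le> (\<integral>x. c * (\<rho> x * h x) \<partial>lborel)"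
    by (rule integral_mono[OF i1 ih le])
  also have "\<dots> = 0" using zero[OF \<rho>(1) \<rho>r] by simp
  finally have "(\<integral>x. (c * c) * \<rho> x \<partial>lborel) = 0"
    using cc \<rho>(2) by (intro antisym integral_nonneg) auto
  then have "AE x in lborel. (c * c) * \<rho> x = 0"
    using integral_nonneg_eq_0_iff_AE[OF i1] cc \<rho>(2) by auto
  then have ae: "AE x in lborel. \<rho> x = 0" using cc by auto
  have "continuous_on UNIV \<rho>" using \<rho> smooth_continuous by blast
  then have "open {x. \<rho> x > 0}" by (intro open_Collect_less continuous_intros) auto
  moreover have "0 \<in> {x. \<rho> x > 0}" using \<rho>(3) by simp
  moreover have "{x. \<rho> x > 0} \<in> null_sets lborel"
  proof (subst AE_iff_null_sets)
    show "AE x in lborel. x \<notin> {x. \<rho> x > 0}" using ae by (auto elim: eventually_mono)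
  qed measurable
  ultimately show False
    using open_not_negligible[of "{x. \<rho> x > 0}"] by (auto simp: negligible_iff_null_sets null_sets_completionI)
qed

section \<open>Weak derivatives\<close>

subsection \<open>Borel representatives\<close>

lemma lebesgue_eq_lborel:
  fixes f f' :: "'a::euclidean_space \<Rightarrow> real"
  assumes f': "f' \<in> borel_measurable borel" and ae: "AE x in lebesgue. f x = f' x"
  shows "(\<integral>x. f x \<partial>lebesgue) = (\<integral>x. f' x \<partial>lborel)"
    and "integrable lebesgue f \<longleftrightarrow> integrable lborel f'"
    and "f \<in> borel_measurable lebesgue"
proof -
  have m': "f' \<in> borel_measurable lebesgue" using f' by (simp add: measurable_completion)
  show m: "f \<in> borel_measurable lebesgue"
    by (rule borel_measurable_AE[OF m']) (use ae in \<open>auto elim: eventually_mono\<close>)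
  show "(\<integral>x. f x \<partial>lebesgue) = (\<integral>x. f' x \<partial>lborel)"
    using integral_cong_AE[OF m m' ae] f' by (simp add: integral_completion)
  show "integrable lebesgue f \<longleftrightarrow> integrable lborel f'"
    using integrable_cong_AE[OF m m' ae] f' by (simp add: integrable_completion)
qed

text \<open>Fubini's theorem is applied to functions of \<open>y + z\<close>. These are jointly measurable for Borel
  functions, but in general not for Lebesgue measurable ones; hence the passage to representatives.\<close>

lemma L2_borel_rep:
  fixes f :: "'a::euclidean_space \<Rightarrow> real"
  assumes K: "K \<in> sets borel" and f: "f \<in> L2 (lebesgue_on K)"
  obtains b where "b \<in> borel_measurable borel" "integrable lborel (\<lambda>x. (b x)\<^sup>2)"
    "\<And>x. x \<notin> K \<Longrightarrow> b x = 0" "AE x in lebesgue. x \<in> K \<longrightarrow> f x = b x"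
proof -
  have K' [simp]: "K \<inter> space lebesgue \<in> sets lebesgue" using K by simp
  have "(\<lambda>x. indicator K x *\<^sub>R f x) \<in> borel_measurable lebesgue"
    using f borel_measurable_restrict_space_iff[OF K', of f] by (simp add: L2_def)
  then obtain b where [measurable]: "b \<in> borel_measurable lborel" and ae: "AE x in lborel. indicator K x *\<^sub>R f x = b x"
    using completion_ex_borel_measurable_real by blast
  have ae': "AE x in lebesgue. indicator K x *\<^sub>R f x = b x" using ae by (rule AE_completion)
  have [measurable]: "b \<in> borel_measurable borel" "K \<in> sets borel" using K by auto
  have "integrable lebesgue (\<lambda>x. indicator K x *\<^sub>R (norm (f x))\<^sup>2)"
    using f integrable_restrict_space[OF K', of "\<lambda>x. (norm (f x))\<^sup>2"] by (simp add: L2_def)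
  moreover have "AE x in lebesgue. indicator K x *\<^sub>R (norm (f x))\<^sup>2 = (indicator K x * b x)\<^sup>2"
    using ae' by eventually_elim (auto simp: indicator_def)
  ultimately have "integrable lborel (\<lambda>x. (indicator K x * b x)\<^sup>2)"
    by (subst (asm) lebesgue_eq_lborel(2)) auto
  moreover have "AE x in lebesgue. x \<in> K \<longrightarrow> f x = indicator K x * b x"
    using ae' by eventually_elim auto
  ultimately show ?thesis
    by (intro that[of "\<lambda>x. indicator K x * b x"]) auto
qed

lemma L2_component:
  fixes f :: "'a \<Rightarrow> real^'n::finite"
  assumes "f \<in> L2 M" shows "(\<lambda>x. f x $ i) \<in> L2 M"
proof -
  have [measurable]: "f \<in> borel_measurable M" and i: "integrable M (\<lambda>x. (norm (f x))\<^sup>2)"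
    using assms by (auto simp: L2_def)
  have [measurable]: "(\<lambda>x. f x $ i) \<in> borel_measurable M"
    by (rule measurable_compose[where g="\<lambda>v. v $ i" and N=borel])
      (auto intro!: borel_measurable_continuous_onI continuous_intros)
  have "integrable M (\<lambda>x. (norm (f x $ i))\<^sup>2)"
  proof (rule Bochner_Integration.integrable_bound[OF i])
    have "(norm (f x $ i))\<^sup>2 \<le> (norm (f x))\<^sup>2" for x
      by (rule power_mono) (auto simp: component_le_norm_cart)
    then show "AE x in M. norm ((norm (f x $ i))\<^sup>2) \<le> norm ((norm (f x))\<^sup>2)" by simp
  qed measurable
  then show ?thesis by (simp add: L2_def)
qed

lemma L2_loc_component:
  fixes f :: "real^'n::finite \<Rightarrow> real^'m::finite"
  shows "f \<in> L2_loc \<Longrightarrow> (\<lambda>x. f x $ i) \<in> L2_loc"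
  by (auto simp: L2_loc_def intro: L2_component)

subsection \<open>Test functions\<close>

lemma partial_deriv_compose_affine:
  fixes f :: "real^'n::finite \<Rightarrow> real"
  assumes "\<And>x. f differentiable (at x)"
  shows "partial_deriv i (\<lambda>x. f (x - y)) x = partial_deriv i f (x - y)"
    and "partial_deriv i (\<lambda>y. f (x - y)) y = - partial_deriv i f (x - y)"
proof -
  note D = has_derivative_grad[OF assms, of "x - y"]
  have "((\<lambda>x. x - y) has_derivative (\<lambda>h. h)) (at x)" by (auto intro!: derivative_eq_intros)
  from partial_deriv_eq[OF has_derivative_compose[OF this D]]
  show "partial_deriv i (\<lambda>x. f (x - y)) x = partial_deriv i f (x - y)"
    by (simp add: inner_axis grad_def)
  have "((\<lambda>y. x - y) has_derivative (\<lambda>h. - h)) (at y)" by (auto intro!: derivative_eq_intros)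
  from partial_deriv_eq[OF has_derivative_compose[OF this D]]
  show "partial_deriv i (\<lambda>y. f (x - y)) y = - partial_deriv i f (x - y)"
    by (simp add: inner_axis grad_def)
qed

lemma partial_deriv_zero_outside:
  fixes f :: "real^'n::finite \<Rightarrow> real"
  assumes "closed K" "\<And>x. x \<notin> K \<Longrightarrow> f x = 0" "x \<notin> K"
  shows "partial_deriv i f x = 0"
proof -
  have "((\<lambda>x. 0) has_derivative (\<lambda>h. 0)) (at x)" by simp
  then have "(f has_derivative (\<lambda>h. 0)) (at x)"
    by (rule has_derivative_transform_within_open[of _ _ _ _ "- K"]) (use assms in auto)
  then show ?thesis using partial_deriv_eq by fastforce
qed

lemma test_function_translate:
  fixes \<rho> :: "real^'n::finite \<Rightarrow> real"
  assumes \<rho>: "smooth \<rho>" "\<And>x. norm x \<ge> r \<Longrightarrow> \<rho> x = 0"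
  shows "cball y r \<subseteq> U \<Longrightarrow> (\<lambda>x. \<rho> (x - y)) \<in> test_functions U"
    and "cball x r \<subseteq> U \<Longrightarrow> (\<lambda>y. \<rho> (x - y)) \<in> test_functions U"
proof -
  have "smooth (\<lambda>x. \<rho> (x - y))" by (rule smooth_translate[OF \<rho>(1)])
  moreover have "\<rho> (x - y) = 0" if "x \<notin> cball y r" for x
    using that by (intro \<rho>(2)) (auto simp: dist_norm norm_minus_commute)
  ultimately show "cball y r \<subseteq> U \<Longrightarrow> (\<lambda>x. \<rho> (x - y)) \<in> test_functions U"
    unfolding test_functions_def by (auto intro!: exI[of _ "cball y r"])
  have "smooth (\<lambda>y. \<rho> (- y + x))"
    by (rule smooth_affine[where a=uminus, OF _ \<rho>(1)]) (rule module_hom_uminus)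
  moreover have "\<rho> (x - y) = 0" if "y \<notin> cball x r" for y
    using that by (intro \<rho>(2)) (auto simp: dist_norm)
  ultimately show "cball x r \<subseteq> U \<Longrightarrow> (\<lambda>y. \<rho> (x - y)) \<in> test_functions U"
    unfolding test_functions_def by (auto intro!: exI[of _ "cball x r"])
qed

lemma integrable_continuous_compact_support:
  fixes f :: "'a::euclidean_space \<Rightarrow> real"
  assumes "continuous_on UNIV f" "compact K" "\<And>x. x \<notin> K \<Longrightarrow> f x = 0"
  shows "integrable lborel f" "integrable lborel (\<lambda>x. (f x)\<^sup>2)"
proof -
  have *: "integrable lborel f" if "continuous_on UNIV f" "\<And>x. x \<notin> K \<Longrightarrow> f x = 0" for f :: "'a \<Rightarrow> real"
  proof -
    have "integrable lborel (\<lambda>x. indicator K x *\<^sub>R f x)"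
      using that assms(2) by (intro borel_integrable_compact continuous_on_subset[OF that(1)]) auto
    also have "(\<lambda>x. indicator K x *\<^sub>R f x) = f"
    proof
      show "indicator K x *\<^sub>R f x = f x" for x using that(2)[of x] by (cases "x \<in> K") auto
    qed
    finally show ?thesis .
  qed
  show "integrable lborel f" by (rule *[OF assms(1,3)])
  show "integrable lborel (\<lambda>x. (f x)\<^sup>2)"
    by (rule *) (use assms in \<open>auto intro!: continuous_intros\<close>)
qed

subsection \<open>The fundamental lemma of the calculus of variations\<close>

text \<open>On a compact \<open>K\<close>, let \<open>b\<close> be \<open>f\<close> near \<open>K\<close> and \<open>a\<close> be \<open>f\<close> on \<open>K\<close>, both extended by zero. For \<open>y\<close> in \<open>K\<close>
  and a bump \<open>\<rho>\<close> of small support, $x \mapsto \rho(x - y)$ is a test function on \<open>U\<close>, so \<open>correlation a b\<close>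
  vanishes at 0. Its value there is the integral of $f^2$ over \<open>K\<close>.\<close>

lemma AE_zero_of_test_functions:
  fixes f :: "real^'n::finite \<Rightarrow> real"
  assumes U: "open U" and f: "\<And>K. compact K \<Longrightarrow> K \<subseteq> U \<Longrightarrow> f \<in> L2 (lebesgue_on K)"
    and zero: "\<And>\<eta>. \<eta> \<in> test_functions U \<Longrightarrow> (\<integral>x. f x * \<eta> x \<partial>lebesgue_on U) = 0"
  shows "AE x in lebesgue. x \<in> U \<longrightarrow> f x = 0"
proof -
  have onK: "AE x in lebesgue. x \<in> K \<longrightarrow> f x = 0" if K: "compact K" "K \<subseteq> U" for K
  proof -
    obtain r where r: "r > 0" "(\<Union>x\<in>K. cball x r) \<subseteq> U"
      using compact_subset_open_imp_cball_epsilon_subset[OF K(1) U K(2)] by blast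
    define Kr where "Kr = {x + y | x y. x \<in> K \<and> y \<in> cball 0 r}"
    have Kr: "compact Kr" unfolding Kr_def by (intro compact_sums K compact_cball)
    have in_Kr: "x \<in> Kr" if "y \<in> K" "norm (x - y) \<le> r" for x y
      unfolding Kr_def using that by (intro CollectI exI[of _ y] exI[of _ "x - y"]) auto
    have KrU: "Kr \<subseteq> U" using r(2) by (force simp: Kr_def dist_norm)
    have KKr: "K \<subseteq> Kr" using in_Kr[of _ _] r(1) by fastforce
    obtain b where b: "b \<in> borel_measurable borel" "integrable lborel (\<lambda>x. (b x)\<^sup>2)"
      "\<And>x. x \<notin> Kr \<Longrightarrow> b x = 0" "AE x in lebesgue. x \<in> Kr \<longrightarrow> f x = b x"
      by (rule L2_borel_rep[OF borel_closed[OF compact_imp_closed[OF Kr]] f[OF Kr KrU]]) blast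
    define a where "a x = indicator K x * b x" for x
    have [measurable]: "b \<in> borel_measurable borel" "K \<in> sets borel"
      using b(1) borel_compact[OF K(1)] by auto
    have [measurable]: "a \<in> borel_measurable borel" unfolding a_def by measurable
    have a2: "integrable lborel (\<lambda>x. (a x)\<^sup>2)"
      by (rule Bochner_Integration.integrable_bound[OF b(2)]) (auto simp: a_def indicator_def)
    have "integrable lborel (\<lambda>x. indicator K x * b x)"
      using emeasure_bounded_finite[OF compact_imp_bounded[OF K(1)]]
      by (intro integrable_mult_square b(2)) (auto simp: power2_eq_square indicator_inter_arith[symmetric])
    then have a1: "integrable lborel a" unfolding a_def[abs_def] .
    obtain R where R: "Kr \<subseteq> cball 0 R"
      using compact_imp_bounded[OF Kr] unfolding bounded_iff subset_eq mem_cball_0 by blast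
    have bR: "b x = 0" if "x \<notin> cball 0 R" for x using R that by (intro b(3)) blast
    have cont: "isCont (correlation a b) 0"
      by (rule correlation_isCont[OF _ _ a2 a1 b(2) bR]) auto
    have "correlation a b 0 = 0"
    proof (rule isCont_zero_of_bumps[OF cont r(1)])
      fix \<rho> :: "real^'n \<Rightarrow> real" assume \<rho>: "smooth \<rho>" "\<And>x. norm x \<ge> r \<Longrightarrow> \<rho> x = 0"
      have [measurable]: "\<rho> \<in> borel_measurable borel"
        by (rule smooth_borel[OF \<rho>(1)])
      have \<rho>i: "integrable lborel \<rho>"
        by (rule integrable_continuous_compact_support[OF smooth_continuous[OF \<rho>(1)] compact_cball[of 0 r]])
          (use \<rho>(2) in auto)
      note F = correlation_fubini[OF _ _ a2 b(2) \<rho>i]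
      show "integrable lborel (\<lambda>z. \<rho> z * correlation a b z)" by (rule F) auto
      have inner0: "a y * (\<integral>x. b x * \<rho> (x - y) \<partial>lborel) = 0" for y
      proof (cases "y \<in> K")
        case True
        let ?\<eta> = "\<lambda>x. \<rho> (x - y)"
        have "?\<eta> \<in> test_functions U"
          by (rule test_function_translate(1)[OF \<rho>]) (use r(2) True in auto)
        then have "0 = (\<integral>x. f x * ?\<eta> x \<partial>lebesgue_on U)" using zero by simp
        also have "\<dots> = (\<integral>x. indicator U x *\<^sub>R (f x * ?\<eta> x) \<partial>lebesgue)"
          using U by (intro integral_restrict_space) auto
        also have "\<dots> = (\<integral>x. b x * ?\<eta> x \<partial>lborel)"
        proof (rule lebesgue_eq_lborel(1))
          show "AE x in lebesgue. indicator U x *\<^sub>R (f x * ?\<eta> x) = b x * ?\<eta> x"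
            using b(4)
          proof eventually_elim
            case (elim x)
            show ?case
            proof (cases "norm (x - y) \<le> r")
              case in_r: True
              then have "x \<in> Kr" using in_Kr True by blast
              then show ?thesis using elim KrU by auto
            next
              case False
              then show ?thesis using \<rho>(2)[of "x - y"] by simp
            qed
          qed
        qed measurable
        finally show ?thesis by simp
      qed (simp add: a_def)
      have "(\<integral>z. \<rho> z * correlation a b z \<partial>lborel) = (\<integral>y. a y * (\<integral>x. b x * \<rho> (x - y) \<partial>lborel) \<partial>lborel)"
        by (rule F(2)) auto
      then show "(\<integral>z. \<rho> z * correlation a b z \<partial>lborel) = 0" unfolding inner0 by simp
    qed
    moreover have "correlation a b 0 = (\<integral>x. (a x)\<^sup>2 \<partial>lborel)"
      unfolding correlation_def
      by (intro Bochner_Integration.integral_cong) (auto simp: a_def indicator_def power2_eq_square)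
    ultimately have "AE x in lborel. (a x)\<^sup>2 = 0"
      using integral_nonneg_eq_0_iff_AE[OF a2] by simp
    then have "AE x in lebesgue. a x = 0" by (intro AE_completion) auto
    then show ?thesis using b(4)
      by eventually_elim (use KKr in \<open>auto simp: a_def\<close>)
  qed
  have "\<exists>D. countable D \<and> D \<subseteq> Pow U \<and> (\<forall>X\<in>D. \<exists>a b. X = cbox a b) \<and> \<Union>D = U"
  proof (rule open_countable_Union_open_cbox[OF U])
    fix D assume "countable D" "D \<subseteq> Pow U" "\<And>X. X \<in> D \<Longrightarrow> \<exists>a b. X = cbox a b" "\<Union>D = U"
    then show ?thesis by (intro exI[of _ D]) simp
  qed
  then obtain D where D: "countable D" "D \<subseteq> Pow U" "\<forall>X\<in>D. \<exists>a b. X = cbox a b" "\<Union>D = U"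
    by blast
  have "AE x in lebesgue. \<forall>X\<in>D. x \<in> X \<longrightarrow> f x = 0"
  proof (subst AE_ball_countable[OF D(1)], rule ballI)
    fix X assume "X \<in> D"
    then have "compact X" "X \<subseteq> U" using D(2,3) by (auto simp: compact_cbox)
    then show "AE x in lebesgue. x \<in> X \<longrightarrow> f x = 0" by (rule onK)
  qed
  then show ?thesis by eventually_elim (use D(4) in auto)
qed


subsection \<open>Integration by parts against a compactly supported Sobolev function\<close>

text \<open>The sum of the correlations of \<open>\<Theta>\<close> with \<open>d\<close> and of the components of \<open>G\<close> with those of \<open>\<mu>\<close> is shown to
  vanish at 0. Integrated against \<open>\<rho>\<close>, the first one is minus the double integral of
  $\Theta(y)\, \mu(x) \cdot \nabla\rho(x - y)$, by the definition of the weak divergence in \<open>x\<close>; by the definition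
  of the weak gradient in \<open>y\<close>, this cancels the others.\<close>

lemma weak_div_pairing:
  fixes \<mu> G :: "real^'n::finite \<Rightarrow> real^'n" and \<Theta> d :: "real^'n \<Rightarrow> real"
  assumes \<Theta>: "\<Theta> \<in> L2 lebesgue" and G: "G \<in> L2 lebesgue"
    and supp: "\<And>x. x \<notin> cball 0 R \<Longrightarrow> \<Theta> x = 0" "\<And>x. x \<notin> cball 0 R \<Longrightarrow> G x = 0"
    and wg: "has_weak_grad UNIV \<Theta> G"
    and \<mu>: "\<mu> \<in> L2_loc" and d: "d \<in> L2_loc" and wd: "has_weak_div UNIV \<mu> d"
  shows "(\<integral>x. d x * \<Theta> x \<partial>lebesgue) + (\<integral>x. \<mu> x \<bullet> G x \<partial>lebesgue) = 0"
proof -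
  \<comment> \<open>For \<open>y\<close> in \<open>?S\<close> and \<open>\<rho>\<close> supported in the unit ball, only the values of \<open>\<mu>\<close> and \<open>d\<close> in \<open>?K\<close> matter.\<close>
  let ?S = "cball (0::real^'n) R" and ?K = "cball (0::real^'n) (R + 1)"
  have rep: "\<exists>b. b \<in> borel_measurable borel \<and> integrable lborel (\<lambda>x. (b x)\<^sup>2) \<and>
      (\<forall>x. x \<notin> cball 0 r \<longrightarrow> b x = 0) \<and> (AE x in lebesgue. x \<in> cball 0 r \<longrightarrow> f x = b x)"
    if "f \<in> L2 (lebesgue_on (cball 0 r))" for f :: "real^'n \<Rightarrow> real" and r
    by (rule L2_borel_rep[OF _ that]) auto
  have L2_sub: "f \<in> L2 (lebesgue_on (cball 0 r))" if "f \<in> L2 lebesgue" for f :: "real^'n \<Rightarrow> real" and r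
  proof -
    have "integrable (lebesgue_on (cball 0 r)) (\<lambda>x. (norm (f x))\<^sup>2)"
      using that by (subst integrable_restrict_space)
        (auto simp: L2_def intro!: integrable_mult_indicator[where 'b=real, simplified])
    then show ?thesis using that by (auto simp: L2_def measurable_restrict_space1)
  qed
  obtain \<theta> where \<theta>: "\<theta> \<in> borel_measurable borel" "integrable lborel (\<lambda>x. (\<theta> x)\<^sup>2)"
    "\<And>x. x \<notin> ?S \<Longrightarrow> \<theta> x = 0" "AE x in lebesgue. x \<in> ?S \<longrightarrow> \<Theta> x = \<theta> x"
    using rep[OF L2_sub[OF \<Theta>]] by blast
  have "\<forall>i. \<exists>b. b \<in> borel_measurable borel \<and> integrable lborel (\<lambda>x. (b x)\<^sup>2) \<and>
      (\<forall>x. x \<notin> ?S \<longrightarrow> b x = 0) \<and> (AE x in lebesgue. x \<in> ?S \<longrightarrow> G x $ i = b x)"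
    by (intro allI rep L2_sub L2_component G)
  from choice[OF this] obtain g where g: "\<And>i. g i \<in> borel_measurable borel" "\<And>i. integrable lborel (\<lambda>x. (g i x)\<^sup>2)"
    "\<And>x i. x \<notin> ?S \<Longrightarrow> g i x = 0" "\<And>i. AE x in lebesgue. x \<in> ?S \<longrightarrow> G x $ i = g i x"
    by blast
  have "\<exists>b. b \<in> borel_measurable borel \<and> integrable lborel (\<lambda>x. (b x)\<^sup>2) \<and>
      (\<forall>x. x \<notin> ?K \<longrightarrow> b x = 0) \<and> (AE x in lebesgue. x \<in> ?K \<longrightarrow> d x = b x)"
    using d by (intro rep) (auto simp: L2_loc_def)
  then obtain \<delta> where \<delta>: "\<delta> \<in> borel_measurable borel" "integrable lborel (\<lambda>x. (\<delta> x)\<^sup>2)"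
    "\<And>x. x \<notin> ?K \<Longrightarrow> \<delta> x = 0" "AE x in lebesgue. x \<in> ?K \<longrightarrow> d x = \<delta> x"
    by blast
  have "\<forall>i. \<exists>b. b \<in> borel_measurable borel \<and> integrable lborel (\<lambda>x. (b x)\<^sup>2) \<and>
      (\<forall>x. x \<notin> ?K \<longrightarrow> b x = 0) \<and> (AE x in lebesgue. x \<in> ?K \<longrightarrow> \<mu> x $ i = b x)"
    using L2_loc_component[OF \<mu>] by (intro allI rep) (auto simp: L2_loc_def)
  from choice[OF this] obtain m where m: "\<And>i. m i \<in> borel_measurable borel" "\<And>i. integrable lborel (\<lambda>x. (m i x)\<^sup>2)"
    "\<And>x i. x \<notin> ?K \<Longrightarrow> m i x = 0" "\<And>i. AE x in lebesgue. x \<in> ?K \<longrightarrow> \<mu> x $ i = m i x"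
    by blast
  have [measurable]: "\<theta> \<in> borel_measurable borel" "\<delta> \<in> borel_measurable borel"
      "\<And>i. g i \<in> borel_measurable borel" "\<And>i. m i \<in> borel_measurable borel"
    using \<theta> \<delta> g m by auto
  have AEg: "AE x in lebesgue. \<forall>i. x \<in> ?S \<longrightarrow> G x $ i = g i x"
    using g(4) by (subst AE_finite_all[of UNIV, simplified]) auto
  have AEm: "AE x in lebesgue. \<forall>i. x \<in> ?K \<longrightarrow> \<mu> x $ i = m i x"
    using m(4) by (subst AE_finite_all[of UNIV, simplified]) auto
  have int1: "integrable lborel f"
    if [measurable]: "f \<in> borel_measurable borel" and "integrable lborel (\<lambda>x. (f x)\<^sup>2)" "\<And>x. x \<notin> ?S \<Longrightarrow> f x = 0"
    for f :: "real^'n \<Rightarrow> real"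
  proof -
    have "integrable lborel (\<lambda>x. indicator ?S x * f x)"
      using emeasure_bounded_finite[of ?S] that
      by (intro integrable_mult_square)
        (auto simp: power2_eq_square indicator_inter_arith[symmetric] intro!: borel_measurable_indicator)
    also have "(\<lambda>x. indicator ?S x * f x) = f"
    proof
      show "indicator ?S x * f x = f x" for x using that(3)[of x] by (cases "x \<in> ?S") auto
    qed
    finally show ?thesis .
  qed
  define h where "h z = correlation \<theta> \<delta> z + (\<Sum>i\<in>UNIV. correlation (g i) (m i) z)" for z
  have cont: "isCont h 0"
    unfolding h_def
  proof (intro continuous_add continuous_sum)
    show "isCont (correlation \<theta> \<delta>) 0"
      by (rule correlation_isCont[OF \<theta>(1) \<delta>(1) \<theta>(2) int1[OF \<theta>(1-3)] \<delta>(2,3)])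
    show "isCont (correlation (g i) (m i)) 0" for i
      by (rule correlation_isCont[OF g(1) m(1) g(2) int1[OF g(1-3)] m(2,3)])
  qed
  have "h 0 = 0"
  proof (rule isCont_zero_of_bumps[OF cont zero_less_one])
    fix \<rho> :: "real^'n \<Rightarrow> real" assume \<rho>: "smooth \<rho>" "\<And>x. norm x \<ge> 1 \<Longrightarrow> \<rho> x = 0"
    note diff = smooth_differentiable[OF \<rho>(1)]
    have cs: "continuous_on UNIV \<rho>" "\<And>x. x \<notin> cball 0 1 \<Longrightarrow> \<rho> x = 0"
      using smooth_continuous \<rho> by auto
    have csp: "continuous_on UNIV (partial_deriv i \<rho>)" "\<And>x. x \<notin> cball 0 1 \<Longrightarrow> partial_deriv i \<rho> x = 0" for i
    proof -
      show "continuous_on UNIV (partial_deriv i \<rho>)"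
        by (rule smooth_continuous[OF smooth_partial_deriv[OF \<rho>(1)]])
      show "partial_deriv i \<rho> x = 0" if "x \<notin> cball 0 1" for x
        by (rule partial_deriv_zero_outside[OF closed_cball cs(2) that])
    qed
    have [measurable]: "\<rho> \<in> borel_measurable borel" "\<And>i. partial_deriv i \<rho> \<in> borel_measurable borel"
      by (rule smooth_borel[OF \<rho>(1)])+
    have i\<rho>: "integrable lborel \<rho>"
      by (rule integrable_continuous_compact_support[OF cs(1) compact_cball cs(2)])
    have ip\<rho>: "integrable lborel (partial_deriv i \<rho>)" "integrable lborel (\<lambda>x. (partial_deriv i \<rho> x)\<^sup>2)" for i
      by (rule integrable_continuous_compact_support[OF csp(1) compact_cball csp(2)], assumption)+
    note F\<delta> = correlation_fubini[OF \<theta>(1) \<delta>(1) \<theta>(2) \<delta>(2) i\<rho>]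
    note F2 = correlation_fubini[OF \<theta>(1) m(1) \<theta>(2) m(2) ip\<rho>(1)]
    note Fg = correlation_fubini[OF g(1) m(1) g(2) m(2) i\<rho>]
    show "integrable lborel (\<lambda>z. \<rho> z * h z)"
      unfolding h_def distrib_left sum_distrib_left
      by (intro Bochner_Integration.integrable_add Bochner_Integration.integrable_sum F\<delta>(1) Fg(1))
    have div: "\<theta> y * (\<integral>x. \<delta> x * \<rho> (x - y) \<partial>lborel) =
        - (\<Sum>i\<in>UNIV. \<theta> y * (\<integral>x. m i x * partial_deriv i \<rho> (x - y) \<partial>lborel))" for y
    proof (cases "y \<in> ?S")
      case True
      have big: "x \<in> ?K" if "norm (x - y) \<le> 1" for x
        using True that norm_triangle_ineq[of "x - y" y] by simp
      let ?\<eta> = "\<lambda>x. \<rho> (x - y)"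
      have test: "?\<eta> \<in> test_functions UNIV" by (rule test_function_translate(1)[OF \<rho>]) auto
      have im: "integrable lborel (\<lambda>x. m i x * partial_deriv i \<rho> (x - y))" for i
        using lborel_translate(2)[of "\<lambda>x. (partial_deriv i \<rho> x)\<^sup>2" "- y"] ip\<rho>(2)[of i]
        by (intro integrable_mult_square m(2)) auto
      have "(\<integral>x. \<delta> x * ?\<eta> x \<partial>lborel) = (\<integral>x. d x * ?\<eta> x \<partial>lebesgue)"
      proof (rule lebesgue_eq_lborel(1)[symmetric])
        show "AE x in lebesgue. d x * ?\<eta> x = \<delta> x * ?\<eta> x"
          using \<delta>(4)
        proof eventually_elim
          case (elim x) then show ?case using big[of x] cs(2)[of "x - y"] by (cases "norm (x - y) \<le> 1") auto
        qed
      qed measurable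
      also have "\<dots> = - (\<integral>x. \<mu> x \<bullet> grad ?\<eta> x \<partial>lebesgue)"
        using wd test by (simp add: has_weak_div_def lebesgue_on_UNIV_eq)
      also have "(\<integral>x. \<mu> x \<bullet> grad ?\<eta> x \<partial>lebesgue) = (\<integral>x. (\<Sum>i\<in>UNIV. m i x * partial_deriv i \<rho> (x - y)) \<partial>lborel)"
      proof (rule lebesgue_eq_lborel(1))
        show "AE x in lebesgue. \<mu> x \<bullet> grad ?\<eta> x = (\<Sum>i\<in>UNIV. m i x * partial_deriv i \<rho> (x - y))"
          using AEm
        proof eventually_elim
          case (elim x)
          have comp: "\<mu> x $ i * partial_deriv i \<rho> (x - y) = m i x * partial_deriv i \<rho> (x - y)" for i
            using elim big[of x] csp(2)[of "x - y" i] by (cases "norm (x - y) \<le> 1") auto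
          have "\<mu> x \<bullet> grad ?\<eta> x = (\<Sum>i\<in>UNIV. \<mu> x $ i * partial_deriv i \<rho> (x - y))"
            by (simp add: inner_vec_def grad_def partial_deriv_compose_affine(1)[OF diff])
          then show ?case unfolding comp .
        qed
      qed measurable
      also have "\<dots> = (\<Sum>i\<in>UNIV. (\<integral>x. m i x * partial_deriv i \<rho> (x - y) \<partial>lborel))"
        using im by (intro Bochner_Integration.integral_sum) auto
      finally show ?thesis by (simp add: sum_distrib_left)
    qed (use \<theta>(3) in auto)
    have "(\<integral>z. \<rho> z * correlation \<theta> \<delta> z \<partial>lborel) =
        (\<integral>y. - (\<Sum>i\<in>UNIV. \<theta> y * (\<integral>x. m i x * partial_deriv i \<rho> (x - y) \<partial>lborel)) \<partial>lborel)"
      unfolding F\<delta>(2) div ..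
    also have "\<dots> = - (\<Sum>i\<in>UNIV. (\<integral>y. \<theta> y * (\<integral>x. m i x * partial_deriv i \<rho> (x - y) \<partial>lborel) \<partial>lborel))"
      using F2(3) by (simp add: Bochner_Integration.integral_sum)
    also have "(\<lambda>i. (\<integral>y. \<theta> y * (\<integral>x. m i x * partial_deriv i \<rho> (x - y) \<partial>lborel) \<partial>lborel))
        = (\<lambda>i. (\<integral>z. \<rho> z * correlation (g i) (m i) z \<partial>lborel))"
    proof
      fix i
      have grad: "(\<integral>y. \<theta> y * partial_deriv i \<rho> (x - y) \<partial>lborel) = (\<integral>y. g i y * \<rho> (x - y) \<partial>lborel)" for x
      proof -
        let ?\<eta> = "\<lambda>y. \<rho> (x - y)"
        have test: "?\<eta> \<in> test_functions UNIV" by (rule test_function_translate(2)[OF \<rho>]) auto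
        have pd: "partial_deriv i ?\<eta> y = - partial_deriv i \<rho> (x - y)" for y
          by (rule partial_deriv_compose_affine(2)[OF diff])
        have "(\<integral>y. \<theta> y * partial_deriv i \<rho> (x - y) \<partial>lborel) = (\<integral>y. \<Theta> y * - partial_deriv i ?\<eta> y \<partial>lebesgue)"
        proof (rule lebesgue_eq_lborel(1)[symmetric])
          show "AE y in lebesgue. \<Theta> y * - partial_deriv i ?\<eta> y = \<theta> y * partial_deriv i \<rho> (x - y)"
            using \<theta>(4)
          proof eventually_elim
            case (elim y) then show ?case using supp(1)[of y] \<theta>(3)[of y] by (cases "y \<in> ?S") (auto simp: pd)
          qed
        qed measurable
        also have "\<dots> = - (\<integral>y. \<Theta> y * partial_deriv i ?\<eta> y \<partial>lebesgue)" by simp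
        also have "\<dots> = (\<integral>y. G y $ i * ?\<eta> y \<partial>lebesgue)"
          using wg test by (simp add: has_weak_grad_def lebesgue_on_UNIV_eq)
        also have "\<dots> = (\<integral>y. g i y * \<rho> (x - y) \<partial>lborel)"
        proof (rule lebesgue_eq_lborel(1))
          show "AE y in lebesgue. G y $ i * ?\<eta> y = g i y * \<rho> (x - y)"
            using g(4)[of i]
          proof eventually_elim
            case (elim y) then show ?case using supp(2)[of y] g(3)[of y i] by (cases "y \<in> ?S") auto
          qed
        qed measurable
        finally show ?thesis .
      qed
      have "(\<integral>y. \<theta> y * (\<integral>x. m i x * partial_deriv i \<rho> (x - y) \<partial>lborel) \<partial>lborel)
          = (\<integral>x. m i x * (\<integral>y. \<theta> y * partial_deriv i \<rho> (x - y) \<partial>lborel) \<partial>lborel)"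
        unfolding F2(2)[symmetric] by (rule correlation_fubini'[OF \<theta>(1) m(1) \<theta>(2) m(2) ip\<rho>(1)])
      also have "\<dots> = (\<integral>z. \<rho> z * correlation (g i) (m i) z \<partial>lborel)"
        unfolding grad by (rule correlation_fubini'[OF g(1) m(1) g(2) m(2) i\<rho>, symmetric])
      finally show "(\<integral>y. \<theta> y * (\<integral>x. m i x * partial_deriv i \<rho> (x - y) \<partial>lborel) \<partial>lborel)
        = (\<integral>z. \<rho> z * correlation (g i) (m i) z \<partial>lborel)" .
    qed
    finally show "(\<integral>z. \<rho> z * h z \<partial>lborel) = 0"
      unfolding h_def distrib_left sum_distrib_left
      using F\<delta>(1) Fg(1) by (simp add: Bochner_Integration.integral_sum)
  qed
  moreover have "(\<integral>x. d x * \<Theta> x \<partial>lebesgue) = correlation \<theta> \<delta> 0"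
  proof -
    have "(\<integral>x. d x * \<Theta> x \<partial>lebesgue) = (\<integral>x. \<theta> x * \<delta> x \<partial>lborel)"
    proof (rule lebesgue_eq_lborel(1))
      show "AE x in lebesgue. d x * \<Theta> x = \<theta> x * \<delta> x"
        using \<theta>(4) \<delta>(4)
      proof eventually_elim
        case (elim x) then show ?case using supp(1)[of x] \<theta>(3)[of x] by (cases "x \<in> ?S") auto
      qed
    qed measurable
    then show ?thesis by (simp add: correlation_def)
  qed
  moreover have "(\<integral>x. \<mu> x \<bullet> G x \<partial>lebesgue) = (\<Sum>i\<in>UNIV. correlation (g i) (m i) 0)"
  proof -
    have "(\<integral>x. \<mu> x \<bullet> G x \<partial>lebesgue) = (\<integral>x. (\<Sum>i\<in>UNIV. g i x * m i x) \<partial>lborel)"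
    proof (rule lebesgue_eq_lborel(1))
      show "AE x in lebesgue. \<mu> x \<bullet> G x = (\<Sum>i\<in>UNIV. g i x * m i x)"
        using AEg AEm
      proof eventually_elim
        case (elim x) then show ?case using supp(2)[of x] g(3)[of x]
          by (cases "x \<in> ?S") (auto simp: inner_vec_def mult.commute)
      qed
    qed measurable
    also have "\<dots> = (\<Sum>i\<in>UNIV. (\<integral>x. g i x * m i x \<partial>lborel))"
      by (intro Bochner_Integration.integral_sum integrable_mult_square g(2) m(2)) auto
    finally show ?thesis by (simp add: correlation_def)
  qed
  ultimately show ?thesis by (simp add: h_def)
qed

section \<open>Uniqueness of weak derivatives\<close>

lemma L2_lebesgue_subset:
  fixes f :: "'a::euclidean_space \<Rightarrow> 'b::euclidean_space"
  assumes f: "f \<in> L2 (lebesgue_on V)" and V: "V \<in> sets lebesgue" and K: "K \<in> sets lebesgue" "K \<subseteq> V"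
  shows "f \<in> L2 (lebesgue_on K)"
proof -
  have r: "lebesgue_on K = restrict_space (lebesgue_on V) K"
    using K by (simp add: restrict_restrict_space V Int_absorb1)
  have KV: "K \<in> sets (lebesgue_on V)" using K V by (simp add: sets_restrict_space_iff)
  have [measurable]: "f \<in> borel_measurable (lebesgue_on V)" and i: "integrable (lebesgue_on V) (\<lambda>x. (norm (f x))\<^sup>2)"
    using f by (auto simp: L2_def)
  have "integrable (lebesgue_on V) (\<lambda>x. indicator K x *\<^sub>R (norm (f x))\<^sup>2)"
    using integrable_mult_indicator[OF KV i] .
  then have "integrable (lebesgue_on K) (\<lambda>x. (norm (f x))\<^sup>2)"
    unfolding r using KV sets.Int_space_eq2[OF KV] by (subst integrable_restrict_space) auto
  moreover have "f \<in> borel_measurable (lebesgue_on K)"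
    unfolding r by (rule measurable_restrict_space1) measurable
  ultimately show ?thesis by (simp add: L2_def)
qed

lemma L2_add:
  fixes f h :: "'a \<Rightarrow> 'b::euclidean_space"
  assumes "f \<in> L2 M" "h \<in> L2 M" shows "(\<lambda>x. f x + h x) \<in> L2 M"
proof -
  have [measurable]: "f \<in> borel_measurable M" "h \<in> borel_measurable M" using assms by (auto simp: L2_def)
  have sq: "(norm (x + y))\<^sup>2 \<le> 2 * (norm x)\<^sup>2 + 2 * (norm y)\<^sup>2" for x y :: 'b
  proof -
    have "(norm (x + y))\<^sup>2 \<le> (norm x + norm y)\<^sup>2" by (intro power_mono norm_triangle_ineq) auto
    also have "\<dots> \<le> 2 * (norm x)\<^sup>2 + 2 * (norm y)\<^sup>2"
      using zero_le_power2[of "norm x - norm y"] by (simp add: power2_sum power2_diff)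
    finally show ?thesis .
  qed
  have "integrable M (\<lambda>x. (norm (f x + h x))\<^sup>2)"
  proof (rule Bochner_Integration.integrable_bound)
    show "integrable M (\<lambda>x. 2 * (norm (f x))\<^sup>2 + 2 * (norm (h x))\<^sup>2)" using assms by (auto simp: L2_def)
  qed (use sq in auto)
  then show ?thesis by (simp add: L2_def)
qed

lemma L2_diff:
  fixes f h :: "'a \<Rightarrow> 'b::euclidean_space"
  assumes "f \<in> L2 M" "h \<in> L2 M" shows "(\<lambda>x. f x - h x) \<in> L2 M"
  using L2_add[OF assms(1), of "\<lambda>x. - h x"] assms(2) by (auto simp: L2_def)

definition L2_local :: "(real^'n::finite) set \<Rightarrow> (real^'n \<Rightarrow> real) \<Rightarrow> bool" where
  "L2_local V f \<longleftrightarrow> (\<forall>K. compact K \<longrightarrow> K \<subseteq> V \<longrightarrow> f \<in> L2 (lebesgue_on K))"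

lemma L2_local_of_L2:
  assumes "f \<in> L2 (lebesgue_on V)" "V \<in> sets lebesgue" shows "L2_local V f"
  unfolding L2_local_def
proof (intro allI impI)
  fix K :: "(real^'a) set" assume K: "compact K" "K \<subseteq> V"
  then have "K \<in> sets lebesgue" using borel_compact[OF K(1)] by simp
  then show "f \<in> L2 (lebesgue_on K)" using L2_lebesgue_subset[OF assms] K(2) by blast
qed

lemma L2_local_of_L2_loc: "f \<in> L2_loc \<Longrightarrow> L2_local V f"
  by (simp add: L2_local_def L2_loc_def)

lemma integrable_mult_test_function:
  assumes f: "L2_local V f" and V: "V \<in> sets lebesgue" and \<eta>: "\<eta> \<in> test_functions V"
  shows "integrable (lebesgue_on V) (\<lambda>x. f x * \<eta> x)"
proof -
  obtain K where K: "compact K" "K \<subseteq> V" "\<And>x. x \<notin> K \<Longrightarrow> \<eta> x = 0" and s: "smooth \<eta>"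
    using \<eta> by (auto simp: test_functions_def)
  have KV: "K \<inter> space lebesgue \<in> sets lebesgue" "V \<inter> space lebesgue \<in> sets lebesgue"
    using borel_compact[OF K(1)] V by auto
  have fK: "f \<in> L2 (lebesgue_on K)" using f K by (simp add: L2_local_def)
  have e: "integrable lborel (\<lambda>x. (\<eta> x)\<^sup>2)"
    by (rule integrable_continuous_compact_support[OF smooth_continuous[OF s] K(1,3)])
  note em = smooth_borel(1)[OF s]
  have ie: "(\<lambda>x. indicator K x *\<^sub>R (\<eta> x)\<^sup>2) = (\<lambda>x. (\<eta> x)\<^sup>2)"
  proof
    show "indicator K x *\<^sub>R (\<eta> x)\<^sup>2 = (\<eta> x)\<^sup>2" for x using K(3)[of x] by (cases "x \<in> K") auto
  qed
  have "(\<lambda>x. (\<eta> x)\<^sup>2) \<in> borel_measurable lborel" using em by simp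
  then have "integrable lebesgue (\<lambda>x. indicator K x *\<^sub>R (\<eta> x)\<^sup>2)"
    unfolding ie using e by (subst integrable_completion) auto
  then have "integrable (lebesgue_on K) (\<lambda>x. (\<eta> x)\<^sup>2)" by (subst integrable_restrict_space[OF KV(1)])
  then have "integrable (lebesgue_on K) (\<lambda>x. f x * \<eta> x)"
    using fK em by (intro integrable_mult_square) (auto simp: L2_def intro!: measurable_restrict_space1 measurable_completion)
  then have iK: "integrable lebesgue (\<lambda>x. indicator K x *\<^sub>R (f x * \<eta> x))" by (subst (asm) integrable_restrict_space[OF KV(1)])
  have ind: "indicator K x *\<^sub>R (f x * \<eta> x) = indicator V x *\<^sub>R (f x * \<eta> x)" for x
    using K(2) K(3)[of x] by (cases "x \<in> K") (auto simp: indicator_def)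
  show ?thesis unfolding integrable_restrict_space[OF KV(2)] using iK unfolding ind .
qed

lemma AE_eq_of_test_functions:
  assumes V: "open V" and f: "L2_local V f" and h: "L2_local V h"
    and eq: "\<And>\<eta>. \<eta> \<in> test_functions V \<Longrightarrow>
      (\<integral>x. f x * \<eta> x \<partial>lebesgue_on V) = (\<integral>x. h x * \<eta> x \<partial>lebesgue_on V)"
  shows "AE x in lebesgue. x \<in> V \<longrightarrow> f x = h x"
proof -
  have Vm: "V \<in> sets lebesgue" using V by simp
  have "AE x in lebesgue. x \<in> V \<longrightarrow> f x - h x = 0"
  proof (rule AE_zero_of_test_functions[OF V])
    show "(\<lambda>x. f x - h x) \<in> L2 (lebesgue_on K)" if "compact K" "K \<subseteq> V" for K
      using f h that by (intro L2_diff) (auto simp: L2_local_def)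
    show "(\<integral>x. (f x - h x) * \<eta> x \<partial>lebesgue_on V) = 0" if "\<eta> \<in> test_functions V" for \<eta>
      using eq[OF that] integrable_mult_test_function[OF f Vm that] integrable_mult_test_function[OF h Vm that]
      by (simp add: left_diff_distrib)
  qed
  then show ?thesis by eventually_elim auto
qed

lemma weak_div_unique:
  assumes "open V" "L2_local V d" "L2_local V d'" "has_weak_div V \<mu> d" "has_weak_div V \<mu> d'"
  shows "AE x in lebesgue. x \<in> V \<longrightarrow> d x = d' x"
  by (rule AE_eq_of_test_functions[OF assms(1-3)]) (use assms(4,5) in \<open>auto simp: has_weak_div_def\<close>)

lemma weak_grad_unique:
  fixes G :: "real^'n::finite \<Rightarrow> real^'n"
  assumes "open V" "G \<in> L2 (lebesgue_on V)" "G' \<in> L2 (lebesgue_on V)"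
    "has_weak_grad V \<Phi> G" "has_weak_grad V \<Phi> G'"
  shows "AE x in lebesgue. x \<in> V \<longrightarrow> G x = G' x"
proof -
  have Vm: "V \<in> sets lebesgue" using assms(1) by simp
  have "AE x in lebesgue. x \<in> V \<longrightarrow> G x $ i = G' x $ i" for i
  proof (rule AE_eq_of_test_functions[OF assms(1)])
    show "L2_local V (\<lambda>x. G x $ i)" "L2_local V (\<lambda>x. G' x $ i)"
      by (intro L2_local_of_L2[OF _ Vm] L2_component assms(2,3))+
    fix \<eta> assume "\<eta> \<in> test_functions V"
    then have "- (\<integral>x. G x $ i * \<eta> x \<partial>lebesgue_on V) = - (\<integral>x. G' x $ i * \<eta> x \<partial>lebesgue_on V)"
      using bspec[OF assms(4)[unfolded has_weak_grad_def], of \<eta>] bspec[OF assms(5)[unfolded has_weak_grad_def], of \<eta>]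
      by simp
    then show "(\<integral>x. G x $ i * \<eta> x \<partial>lebesgue_on V) = (\<integral>x. G' x $ i * \<eta> x \<partial>lebesgue_on V)"
      by simp
  qed
  then have "AE x in lebesgue. \<forall>i. x \<in> V \<longrightarrow> G x $ i = G' x $ i"
    by (subst AE_finite_all[of UNIV, simplified]) auto
  then show ?thesis by eventually_elim (auto simp: vec_eq_iff)
qed

lemma L2_loc_measurable:
  fixes f :: "real^'n::finite \<Rightarrow> 'b::euclidean_space"
  assumes "f \<in> L2_loc" shows "f \<in> borel_measurable lebesgue"
proof (rule borel_measurable_LIMSEQ_metric)
  fix n :: nat
  have "f \<in> borel_measurable (lebesgue_on (cball 0 (real n)))"
    using assms by (simp add: L2_loc_def L2_def)
  then show "(\<lambda>x. indicator (cball 0 (real n)) x *\<^sub>R f x) \<in> borel_measurable lebesgue"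
    by (subst (asm) borel_measurable_restrict_space_iff) auto
next
  fix x :: "real^'n"
  obtain N :: nat where "norm x \<le> real N" using real_arch_simple by blast
  then have "\<forall>\<^sub>F n in sequentially. indicator (cball 0 (real n)) x *\<^sub>R f x = f x"
    unfolding eventually_sequentially by (intro exI[of _ N]) (auto simp: indicator_def)
  then show "(\<lambda>n. indicator (cball 0 (real n)) x *\<^sub>R f x) \<longlonglongrightarrow> f x" by (rule tendsto_eventually)
qed

lemma lebesgue_translate:
  fixes f :: "'a::euclidean_space \<Rightarrow> 'b::euclidean_space"
  assumes "f \<in> borel_measurable lebesgue"
  shows "(\<lambda>x. f (x + v)) \<in> borel_measurable lebesgue"
    and "(\<integral>x. f (x + v) \<partial>lebesgue) = (\<integral>x. f x \<partial>lebesgue)"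
    and "integrable lebesgue (\<lambda>x. f (x + v)) \<longleftrightarrow> integrable lebesgue f"
  using scales_integral[OF scales_lebesgue[OF scales_translation[of v]], of UNIV f] assms
  by (simp_all add: lebesgue_on_UNIV_eq)

text \<open>By translation invariance, \<open>d\<close> shifted by \<open>v\<close> is a weak divergence of the shifted field, that is,
  of \<open>\<mu>\<close> itself.\<close>

lemma weak_div_periodic:
  fixes \<mu> :: "real^'n::finite \<Rightarrow> real^'n"
  assumes \<mu>: "\<mu> \<in> L2_loc" and d: "d \<in> L2_loc" "has_weak_div UNIV \<mu> d"
    and per: "AE x in lebesgue. \<mu> (x + v) = \<mu> x"
  shows "AE x in lebesgue. d (x + v) = d x"
proof -
  note \<mu>m [measurable] = L2_loc_measurable[OF \<mu>] note dm [measurable] = L2_loc_measurable[OF d(1)]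
  have dv: "L2_local UNIV (\<lambda>x. d (x + v))"
    unfolding L2_local_def
  proof (intro allI impI)
    fix K :: "(real^'n) set" assume K: "compact K"
    have "(\<lambda>x. x + v) ` K = (+) v ` K" by (simp add: add.commute)
    then have Kv: "compact ((\<lambda>x. x + v) ` K)" using compact_translation[OF K, of v] by (simp only:)
    have im: "(\<lambda>x. x + v) -` ((\<lambda>x. x + v) ` K) = K" by (auto simp: image_def)
    have "d \<in> L2 (lebesgue_on ((\<lambda>x. x + v) ` K))" using d(1) Kv by (simp add: L2_loc_def)
    then have dK: "d \<in> borel_measurable (lebesgue_on ((\<lambda>x. x + v) ` K))"
      "integrable (lebesgue_on ((\<lambda>x. x + v) ` K)) (\<lambda>x. (norm (d x))\<^sup>2)" by (auto simp: L2_def)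
    have sp: "space (lebesgue :: (real^'n) measure) = UNIV" by simp
    have Ks: "(\<lambda>x. x + v) ` K \<in> sets lebesgue" using borel_compact[OF Kv] by simp
    note S = scales_integral[OF scales_lebesgue[OF scales_translation[of v]] sp Ks, unfolded im]
    show "(\<lambda>x. d (x + v)) \<in> L2 (lebesgue_on K)"
      unfolding L2_def using S(1)[OF dK(1)] S(3)[of "\<lambda>x. (norm (d x))\<^sup>2"] dK by auto
  qed
  have "has_weak_div UNIV \<mu> (\<lambda>x. d (x + v))"
    unfolding has_weak_div_def lebesgue_on_UNIV_eq
  proof
    fix \<eta> :: "real^'n \<Rightarrow> real" assume \<eta>: "\<eta> \<in> test_functions UNIV"
    then have s: "smooth \<eta>" by (simp add: test_functions_def)
    obtain K where K: "compact K" "\<And>x. x \<notin> K \<Longrightarrow> \<eta> x = 0" using \<eta> by (auto simp: test_functions_def)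
    let ?\<eta> = "\<lambda>x. \<eta> (x - v)"
    have "smooth ?\<eta>" by (rule smooth_translate[OF s])
    moreover have "?\<eta> x = 0" if "x \<notin> (+) v ` K" for x
      using that by (intro K(2)) (auto simp: image_iff dest: bspec[where x="x - v"])
    ultimately have test: "?\<eta> \<in> test_functions UNIV"
      unfolding test_functions_def using compact_translation[OF K(1), of v] by auto
    have gv: "grad ?\<eta> x = grad \<eta> (x - v)" for x
      unfolding grad_def partial_deriv_compose_affine(1)[OF smooth_differentiable[OF s]] ..
    note em = smooth_borel(1)[OF s] note gm = smooth_borel(3)[OF s]
    have gm' [measurable]: "grad \<eta> \<in> borel_measurable lebesgue" "(\<lambda>x. grad \<eta> (x - v)) \<in> borel_measurable lebesgue"
      using gm by (auto intro!: measurable_completion measurable_compose[OF _ gm])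
    have em' [measurable]: "(\<lambda>x. \<eta> (x - v)) \<in> borel_measurable lebesgue"
      by (auto intro!: measurable_completion measurable_compose[OF _ em])
    have "(\<integral>x. \<mu> x \<bullet> grad \<eta> x \<partial>lebesgue) = (\<integral>x. \<mu> (x + v) \<bullet> grad \<eta> x \<partial>lebesgue)"
      by (rule integral_cong_AE) (use per lebesgue_translate(1)[OF \<mu>m, of v] in \<open>auto elim: eventually_mono\<close>)
    also have "\<dots> = (\<integral>x. \<mu> x \<bullet> grad ?\<eta> x \<partial>lebesgue)"
      unfolding gv using lebesgue_translate(2)[of "\<lambda>x. \<mu> x \<bullet> grad \<eta> (x - v)" v] by simp
    also have "\<dots> = - (\<integral>x. d x * ?\<eta> x \<partial>lebesgue)"
      using d(2) test by (simp add: has_weak_div_def lebesgue_on_UNIV_eq)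
    also have "(\<integral>x. d x * ?\<eta> x \<partial>lebesgue) = (\<integral>x. d (x + v) * \<eta> x \<partial>lebesgue)"
      using lebesgue_translate(2)[of "\<lambda>x. d x * ?\<eta> x" v] by simp
    finally show "(\<integral>x. \<mu> x \<bullet> grad \<eta> x \<partial>lebesgue) = - (\<integral>x. d (x + v) * \<eta> x \<partial>lebesgue)" .
  qed
  from weak_div_unique[OF open_UNIV dv L2_local_of_L2_loc[OF d(1)] this d(2)]
  show ?thesis by simp
qed

section \<open>Geometry of the periodicity cell\<close>

text \<open>The vectors \<open>w j\<close> are the rows of the inverse of the matrix with columns \<open>g j\<close>. Thus \<open>w j \<bullet> y\<close> is
  the coordinate $s_j$ of \<open>y\<close>, and all sets and maps attached to the cell are described by these
  coordinates.\<close>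

locale dual_basis =
  fixes g w :: "'n::finite \<Rightarrow> real^'n"
  assumes dual: "w j \<bullet> g k = (if j = k then 1 else 0)"
    and expand: "y = (\<Sum>j\<in>UNIV. (w j \<bullet> y) *\<^sub>R g j)"

lemma ex_dual_basis:
  fixes g :: "'n::finite \<Rightarrow> real^'n"
  assumes "inj g" "independent (range g)"
  obtains w where "dual_basis g w"
proof -
  obtain f :: "real^'n \<Rightarrow> real^'n" where f: "linear f" "\<And>x. x \<in> range g \<Longrightarrow> f x = axis (inv g x) 1"
    using linear_independent_extend[OF assms(2), of "\<lambda>x. axis (inv g x) 1"] by blast
  define w where "w j = adjoint f (axis j 1)" for j
  have w: "w j \<bullet> y = f y $ j" for j y
    using adjoint_works[OF f(1), of y "axis j 1"] by (simp add: w_def inner_axis inner_commute)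
  have dual: "w j \<bullet> g k = (if j = k then 1 else 0)" for j k
    using assms(1) by (simp add: w f(2) axis_def)
  have "UNIV \<subseteq> span (range g)"
    by (rule card_ge_dim_independent) (use assms in \<open>auto simp: card_image\<close>)
  have "y = (\<Sum>j\<in>UNIV. (w j \<bullet> y) *\<^sub>R g j)" for y
  proof -
    have "y \<in> span (range g)" using \<open>UNIV \<subseteq> span (range g)\<close> by auto
    then obtain u where "y = (\<Sum>v\<in>range g. u v *\<^sub>R v)"
      by (auto simp: span_finite)
    then have y: "y = (\<Sum>j\<in>UNIV. u (g j) *\<^sub>R g j)"
      using assms(1) by (simp add: sum.reindex)
    have "w i \<bullet> y = u (g i)" for i
      proof -
      have "w i \<bullet> y = (\<Sum>j\<in>UNIV. if j = i then u (g j) else 0)"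
        by (subst y, unfold inner_sum_right, rule sum.cong) (auto simp: dual)
      then show ?thesis by simp
    qed
    then show ?thesis using y by simp
  qed
  with dual have "dual_basis g w" by unfold_locales auto
  with that show ?thesis by blast
qed

context dual_basis
begin

lemma coord: "w j \<bullet> (\<Sum>i\<in>UNIV. s i *\<^sub>R g i) = s j"
proof -
  have "w j \<bullet> (\<Sum>i\<in>UNIV. s i *\<^sub>R g i) = (\<Sum>i\<in>UNIV. if i = j then s i else 0)"
    unfolding inner_sum_right by (rule sum.cong) (auto simp: dual)
  then show ?thesis by simp
qed

lemma coord_add [simp]: "w j \<bullet> (y + t *\<^sub>R g k) = w j \<bullet> y + (if j = k then t else 0)"
  unfolding inner_add_right inner_scaleR_right dual by simp

lemma cell_eq: "cell g = {y. \<forall>j. 0 \<le> w j \<bullet> y \<and> w j \<bullet> y \<le> 1}"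
proof (intro set_eqI iffI)
  fix y assume "y \<in> {y. \<forall>j. 0 \<le> w j \<bullet> y \<and> w j \<bullet> y \<le> 1}"
  then show "y \<in> cell g"
    unfolding cell_def by (intro CollectI exI[of _ "\<lambda>j. w j \<bullet> y"] conjI expand) auto
next
  fix y assume "y \<in> cell g"
  then obtain s where s: "y = (\<Sum>j\<in>UNIV. s j *\<^sub>R g j)" "\<forall>j. 0 \<le> s j \<and> s j \<le> 1"
    unfolding cell_def by blast
  then show "y \<in> {y. \<forall>j. 0 \<le> w j \<bullet> y \<and> w j \<bullet> y \<le> 1}"
    unfolding s(1) mem_Collect_eq coord by simp
qed

lemma face_eq: "face g k c = {y \<in> cell g. w k \<bullet> y = c}"
proof (intro set_eqI iffI)
  fix y assume "y \<in> {y \<in> cell g. w k \<bullet> y = c}"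
  then show "y \<in> face g k c"
    unfolding face_def cell_eq by (intro CollectI exI[of _ "\<lambda>j. w j \<bullet> y"] conjI expand) auto
next
  fix y assume "y \<in> face g k c"
  then obtain s where s: "y = (\<Sum>j\<in>UNIV. s j *\<^sub>R g j)" "\<forall>j. 0 \<le> s j \<and> s j \<le> 1" "s k = c"
    unfolding face_def by blast
  then show "y \<in> {y \<in> cell g. w k \<bullet> y = c}"
    unfolding s(1) cell_eq mem_Collect_eq coord by simp
qed

definition U :: "(real^'n) set" where "U = {y. \<forall>j. 0 < w j \<bullet> y \<and> w j \<bullet> y < 1}"

lemma open_U: "open U"
proof -
  have "U = (\<Inter>j. {y. 0 < w j \<bullet> y} \<inter> {y. w j \<bullet> y < 1})" by (auto simp: U_def)
  then show ?thesis by (auto intro!: open_INT open_Collect_less continuous_intros)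
qed

lemma U_borel [measurable]: "U \<in> sets borel" using open_U by simp

text \<open>From an interior point one can move a little along each \<open>g j\<close> in both directions.\<close>

lemma interior_cell: "interior (cell g) = U"
proof
  show "U \<subseteq> interior (cell g)"
    by (rule interior_maximal[OF _ open_U]) (auto simp: U_def cell_eq less_imp_le)
  show "interior (cell g) \<subseteq> U"
  proof
    fix y assume "y \<in> interior (cell g)"
    then obtain e where e: "e > 0" "ball y e \<subseteq> cell g" by (auto simp: mem_interior)
    have "0 < w j \<bullet> y \<and> w j \<bullet> y < 1" for j
    proof -
      define t where "t = e / (2 * (norm (g j) + 1))"
      have t: "t > 0" using e(1) by (simp add: t_def add_nonneg_pos)
      have "t * norm (g j) < e"
      proof -
        have n: "0 < norm (g j) + 1" by (rule add_nonneg_pos) auto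
        have "t * norm (g j) < t * (2 * (norm (g j) + 1))"
          using t n by (intro mult_strict_left_mono) auto
        also have "\<dots> = e" using n by (simp add: t_def)
        finally show ?thesis .
      qed
      then have "y + t *\<^sub>R g j \<in> cell g" "y + (- t) *\<^sub>R g j \<in> cell g"
        using e(2) t by (auto simp: subset_eq dist_norm)
      then have "w j \<bullet> (y + t *\<^sub>R g j) \<le> 1" "w j \<bullet> (y + (- t) *\<^sub>R g j) \<ge> 0" unfolding cell_eq by blast+
      then show ?thesis using t unfolding coord_add by simp
    qed
    then show "y \<in> U" by (simp add: U_def)
  qed
qed

lemma norm_cell: "y \<in> cell g \<Longrightarrow> norm y \<le> (\<Sum>j\<in>UNIV. norm (g j))"
proof -
  assume "y \<in> cell g"
  then have "norm ((w j \<bullet> y) *\<^sub>R g j) \<le> norm (g j)" for j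
    by (auto simp: cell_eq intro!: mult_left_le_one_le)
  then have "norm (\<Sum>j\<in>UNIV. (w j \<bullet> y) *\<^sub>R g j) \<le> (\<Sum>j\<in>UNIV. norm (g j))"
    by (intro sum_norm_le) auto
  then show ?thesis unfolding expand[of y, symmetric] .
qed

lemma compact_cell: "compact (cell g)"
proof -
  have "cell g = (\<Inter>j. {y. 0 \<le> w j \<bullet> y} \<inter> {y. w j \<bullet> y \<le> 1})" by (auto simp: cell_eq)
  then have "closed (cell g)" by (auto intro!: closed_INT closed_Collect_le continuous_intros)
  moreover have "bounded (cell g)" unfolding bounded_iff using norm_cell by blast
  ultimately show ?thesis by (simp add: compact_eq_bounded_closed)
qed

lemma U_subset_cell: "U \<subseteq> cell g" by (auto simp: U_def cell_eq less_imp_le)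

lemma w_nonzero: "w k \<noteq> 0" using dual[of k k] by auto

lemma cell_diff_U: "cell g - U \<in> null_sets lborel"
proof -
  have "cell g - U \<subseteq> (\<Union>j. {y. w j \<bullet> y = 0} \<union> {y. w j \<bullet> y = 1})"
    unfolding U_def cell_eq by (auto simp: less_le)
  moreover have "negligible (\<Union>j. {y. w j \<bullet> y = 0} \<union> {y. w j \<bullet> y = 1})"
    by (intro negligible_Union[of "range _"] finite_imageI finite) (auto simp: negligible_hyperplane w_nonzero)
  ultimately have "negligible (cell g - U)" using negligible_subset by blast
  moreover have "cell g - U \<in> sets lborel" using borel_compact[OF compact_cell] by simp
  ultimately show ?thesis by (simp add: negligible_iff_null_sets null_sets_completion_iff)
qed

lemma finite_measure_U: "finite_measure (lebesgue_on U)"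
proof
  have "emeasure lborel U < \<infinity>"
    by (rule emeasure_bounded_finite, rule bounded_subset[OF compact_imp_bounded[OF compact_cell] U_subset_cell])
  then show "emeasure (lebesgue_on U) (space (lebesgue_on U)) \<noteq> \<infinity>"
    by (simp add: emeasure_restrict_space)
qed

text \<open>The vector \<open>w k\<close> is orthogonal to all generators but \<open>g k\<close>, and any other such vector is a
  multiple of it.\<close>

lemma face_normal_eq: "face_normal g k = w k /\<^sub>R norm (w k)"
  unfolding face_normal_def
proof (rule the_equality)
  show "norm (w k /\<^sub>R norm (w k)) = 1 \<and> (\<forall>j. j \<noteq> k \<longrightarrow> (w k /\<^sub>R norm (w k)) \<bullet> g j = 0) \<and> (w k /\<^sub>R norm (w k)) \<bullet> g k > 0"
    using w_nonzero[of k] by (auto simp: dual)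
next
  fix n assume n: "norm n = 1 \<and> (\<forall>j. j \<noteq> k \<longrightarrow> n \<bullet> g j = 0) \<and> n \<bullet> g k > 0"
  define c where "c = n \<bullet> g k"
  have "(n - c *\<^sub>R w k) \<bullet> y = 0" for y
  proof -
    have "(n - c *\<^sub>R w k) \<bullet> g j = 0" for j using n by (cases "j = k") (auto simp: inner_diff_left dual c_def)
    then have "(n - c *\<^sub>R w k) \<bullet> (\<Sum>j\<in>UNIV. (w j \<bullet> y) *\<^sub>R g j) = 0"
      by (simp only: inner_sum_right inner_scaleR_right) simp
    then show ?thesis unfolding expand[of y, symmetric] .
  qed
  then have eq: "n = c *\<^sub>R w k" using inner_eq_zero_iff[of "n - c *\<^sub>R w k"] by simp
  have "c > 0" using n by (simp add: c_def)
  have "c * norm (w k) = 1" using n eq \<open>c > 0\<close> by (metis abs_of_pos norm_scaleR)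
  then have "c = inverse (norm (w k))" by (metis inverse_unique mult.commute)
  then show "n = w k /\<^sub>R norm (w k)" using eq by simp
qed

subsection \<open>Projections onto the faces and reflections of the cell\<close>

text \<open>The oblique projection along \<open>g k\<close> onto the hyperplane $s_k = c$, and the affine involution of
  the cell that replaces $s_k$ by $1 - s_k$ and so exchanges $F_k^-$ with $F_k^+$.\<close>

definition proj :: "'n \<Rightarrow> real \<Rightarrow> real^'n \<Rightarrow> real^'n" where
  "proj k c y = y + (c - w k \<bullet> y) *\<^sub>R g k"

definition flip :: "'n \<Rightarrow> real^'n \<Rightarrow> real^'n" where
  "flip k y = y + (1 - 2 * (w k \<bullet> y)) *\<^sub>R g k"

lemma coord_proj [simp]: "w j \<bullet> proj k c y = (if j = k then c else w j \<bullet> y)"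
  unfolding proj_def coord_add by simp

lemma coord_flip [simp]: "w j \<bullet> flip k y = (if j = k then 1 - w k \<bullet> y else w j \<bullet> y)"
  unfolding flip_def coord_add by simp

lemma coord_eqI: "(\<And>j. w j \<bullet> x = w j \<bullet> y) \<Longrightarrow> x = y"
proof -
  assume eq: "\<And>j. w j \<bullet> x = w j \<bullet> y"
  have "x = (\<Sum>j\<in>UNIV. (w j \<bullet> x) *\<^sub>R g j)" by (rule expand)
  also have "\<dots> = y" unfolding eq by (rule expand[symmetric])
  finally show ?thesis .
qed

lemma flip_flip [simp]: "flip k (flip k y) = y" by (rule coord_eqI) simp

lemma flip_proj: "flip k (proj j c y) = proj j (if j = k then 1 - c else c) (flip k y)"
  by (rule coord_eqI) auto

lemma flip_proj_same: "flip k (proj k c y) = proj k (1 - c) y"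
  by (rule coord_eqI) auto

lemma proj_shift: "proj k (c + t) y = proj k c y + t *\<^sub>R g k"
  by (rule coord_eqI) auto

lemma flip_in_cell: "flip k y \<in> cell g \<longleftrightarrow> y \<in> cell g"
proof -
  have "y \<in> cell g \<Longrightarrow> flip k y \<in> cell g" for y by (auto simp: cell_eq)
  from this[of y] this[of "flip k y"] show ?thesis by auto
qed

lemma flip_vimage_U: "flip k -` U = U"
proof -
  have "y \<in> U \<Longrightarrow> flip k y \<in> U" for y by (auto simp: U_def)
  from this this[of "flip k _"] show ?thesis by (auto simp del: coord_flip)
qed

lemma proj_in_cell: "c \<in> {0, 1} \<Longrightarrow> y \<in> U \<Longrightarrow> proj k c y \<in> cell g"
  by (auto simp: cell_eq U_def less_imp_le)

lemma continuous_proj: "continuous_on S (proj k c)"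
  unfolding proj_def by (intro continuous_intros)

lemma continuous_flip: "continuous_on S (flip k)"
  unfolding flip_def by (intro continuous_intros)

lemma proj_borel [measurable]: "proj k c \<in> borel_measurable borel"
  by (intro borel_measurable_continuous_onI continuous_proj)

lemma flip_borel [measurable]: "flip k \<in> borel_measurable borel"
  by (intro borel_measurable_continuous_onI continuous_flip)

lemma linear_flip_part: "linear (\<lambda>y. y - (2 * (w k \<bullet> y)) *\<^sub>R g k)"
  by (rule linearI) (auto simp: inner_add_right scaleR_left_distrib scaleR_right_diff_distrib distrib_left)

lemma flip_eq: "flip k = (\<lambda>y. (y - (2 * (w k \<bullet> y)) *\<^sub>R g k) + g k)"
  by (auto simp: flip_def algebra_simps)

lemma scales_flip: "scales lborel 1 (flip k)"
proof -
  have "inj (\<lambda>y. y - (2 * (w k \<bullet> y)) *\<^sub>R g k)"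
  proof (rule injI)
    fix x y assume "x - (2 * (w k \<bullet> x)) *\<^sub>R g k = y - (2 * (w k \<bullet> y)) *\<^sub>R g k"
    then have "flip k x = flip k y" by (simp add: flip_eq)
    then show "x = y" by (metis flip_flip)
  qed
  from scales_affine[OF linear_flip_part this] obtain c where
    "\<And>b. scales lborel c (\<lambda>y. (y - (2 * (w k \<bullet> y)) *\<^sub>R g k) + b)" by blast
  then have "scales lborel c (flip k)" by (simp add: flip_eq)
  with scales_involution[OF this] show ?thesis by simp
qed

end

section \<open>The surface measure\<close>

context dual_basis
begin

text \<open>Surface measure on a face is, up to a factor, the image of the volume of the cell under the
  oblique projection. Unlike the right prism over the face, the cell is mapped to itself by \<open>flip\<close>.\<close>

definition slice :: "'n \<Rightarrow> real \<Rightarrow> (real^'n) measure" where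
  "slice k c = distr (restrict_space lborel U) borel (proj k c)"

lemma proj_measurable_restrict: "proj k c \<in> restrict_space lborel S \<rightarrow>\<^sub>M borel"
  by (rule measurable_restrict_space1) simp

lemma slice_eq_cell: "distr (restrict_space lborel (cell g)) borel (proj k c) = slice k c"
proof (rule measure_eqI)
  fix A assume "A \<in> sets (distr (restrict_space lborel (cell g)) borel (proj k c))"
  then have [measurable]: "A \<in> sets borel" by simp
  have [measurable]: "cell g \<in> sets borel" using borel_compact[OF compact_cell] .
  let ?B = "proj k c -` A"
  have B [measurable]: "?B \<in> sets borel" using measurable_sets_borel[OF proj_borel] by simp
  have e: "emeasure (distr (restrict_space lborel S) borel (proj k c)) A = emeasure lborel (?B \<inter> S)"
    if [measurable]: "S \<in> sets borel" for S
    by (subst emeasure_distr[OF proj_measurable_restrict])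
      (auto simp: emeasure_restrict_space space_restrict_space)
  have "emeasure lborel (?B \<inter> cell g) = emeasure lborel ((?B \<inter> U) \<union> (?B \<inter> (cell g - U)))"
    using U_subset_cell by (intro arg_cong2[where f=emeasure]) auto
  also have "\<dots> = emeasure lborel (?B \<inter> U)"
  proof (rule emeasure_Un_null_set)
    show "?B \<inter> (cell g - U) \<in> null_sets lborel"
      by (rule null_sets_subset[OF cell_diff_U]) auto
  qed auto
  finally show "emeasure (distr (restrict_space lborel (cell g)) borel (proj k c)) A = emeasure (slice k c) A"
    unfolding slice_def by (simp add: e)
qed (simp add: slice_def)

text \<open>The shear \<open>T\<close> fixes the hyperplane $s_k = 0$ and sends the unit normal \<open>n\<close> to \<open>g k\<close>. It maps the right
  prism of height 1 over $F_k^-$ to the cell and intertwines the orthogonal with the oblique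
  projection. For $F_k^+$ one translates by \<open>g k\<close> first, so the factor is the same on both faces.\<close>

lemma face_measure_eq_slice:
  obtains C where "C > 0" "\<And>c. c \<in> {0, 1} \<Longrightarrow>
    face_measure g k c = completion (density (slice k c) (\<lambda>_. ennreal C))"
proof -
  define n where "n = w k /\<^sub>R norm (w k)"
  have nw: "norm (w k) > 0" using w_nonzero by simp
  have n1: "n \<bullet> n = 1" unfolding n_def using nw by (simp add: power2_norm_eq_inner[symmetric] power2_eq_square)
  have wn: "w k \<bullet> y = norm (w k) * (n \<bullet> y)" for y using nw by (simp add: n_def)
  have ng: "n \<bullet> g k = inverse (norm (w k))" using dual[of k k] by (simp add: n_def)
  define T where "T x = x + (n \<bullet> x) *\<^sub>R (g k - n)" for x
  have lin: "linear T" unfolding T_def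
    by (rule linearI) (auto simp: inner_add_right scaleR_left_distrib scaleR_right_distrib)
  have nT: "n \<bullet> T x = (n \<bullet> x) * (n \<bullet> g k)" for x
    by (simp add: T_def inner_add_right inner_diff_right n1 right_diff_distrib)
  have inj: "inj T"
  proof (subst linear_injective_0[OF lin], intro allI impI)
    fix x assume "T x = 0"
    then have "(n \<bullet> x) * (n \<bullet> g k) = 0" using nT[of x] by simp
    then have "n \<bullet> x = 0" using ng nw by auto
    then show "x = 0" using \<open>T x = 0\<close> by (simp add: T_def)
  qed
  have wT: "w k \<bullet> T x = n \<bullet> x" for x
    unfolding wn nT ng using nw by simp
  obtain C where C: "\<And>b. scales lborel C (\<lambda>x. T x + b)" using scales_affine[OF lin inj] by blast
  have Cpos: "C > 0" using C by (auto simp: scales_def)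
  have "face_measure g k c = completion (density (slice k c) (\<lambda>_. ennreal C))" if c: "c \<in> {0, 1}" for c
  proof -
    define H where "H x = T x + (- T (c *\<^sub>R g k))" for x
    have H: "H x = T (x - c *\<^sub>R g k)" for x by (simp add: H_def linear_diff[OF lin])
    have sH: "scales lborel C H" unfolding H_def[abs_def] by (rule C)
    have prism: "{y + t *\<^sub>R face_normal g k | y t. y \<in> face g k c \<and> 0 \<le> t \<and> t \<le> 1} = H -` cell g"
      unfolding face_normal_eq n_def[symmetric]
    proof (intro set_eqI iffI)
      fix x assume "x \<in> {y + t *\<^sub>R n | y t. y \<in> face g k c \<and> 0 \<le> t \<and> t \<le> 1}"
      then obtain y t where x: "x = y + t *\<^sub>R n" "y \<in> face g k c" "0 \<le> t" "t \<le> 1" by blast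
      have y: "y \<in> cell g" "w k \<bullet> y = c" using x(2) by (auto simp: face_eq)
      have "w k \<bullet> (y - c *\<^sub>R g k) = 0" using y dual[of k k] by (simp add: inner_diff_right)
      then have "norm (w k) * (n \<bullet> (y - c *\<^sub>R g k)) = 0" unfolding wn .
      then have "n \<bullet> (y - c *\<^sub>R g k) = 0" using nw by simp
      moreover have "n \<bullet> (x - c *\<^sub>R g k) = n \<bullet> (y - c *\<^sub>R g k) + t * (n \<bullet> n)"
        unfolding x(1) by (simp add: inner_add_right inner_diff_right)
      ultimately have "n \<bullet> (x - c *\<^sub>R g k) = t" by (simp add: n1)
      then have "H x = y + (t - c) *\<^sub>R g k"
        unfolding H T_def by (simp add: x(1) algebra_simps)
      then have "w j \<bullet> H x = (if j = k then t else w j \<bullet> y)" for j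
        using y by simp
      then show "x \<in> H -` cell g" using x(3,4) y(1) by (auto simp: cell_eq)
    next
      fix x assume "x \<in> H -` cell g"
      then have z: "H x \<in> cell g" by simp
      define t where "t = n \<bullet> (x - c *\<^sub>R g k)"
      define y where "y = H x + (c - t) *\<^sub>R g k"
      have t: "w k \<bullet> H x = t" unfolding H t_def by (rule wT)
      then have "0 \<le> t" "t \<le> 1" using z by (auto simp: cell_eq)
      moreover have "y \<in> face g k c" using z t c unfolding face_eq y_def by (auto simp: cell_eq)
      moreover have "x = y + t *\<^sub>R n"
        unfolding y_def H T_def t_def[symmetric] by (simp add: algebra_simps)
      ultimately show "x \<in> {y + t *\<^sub>R n | y t. y \<in> face g k c \<and> 0 \<le> t \<and> t \<le> 1}" by blast
    qed
    have pr: "(\<lambda>x. x - ((x - c *\<^sub>R g k) \<bullet> face_normal g k) *\<^sub>R face_normal g k) = proj k c \<circ> H"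
    proof
      fix x
      define t where "t = n \<bullet> (x - c *\<^sub>R g k)"
      have e: "(x - c *\<^sub>R g k) \<bullet> n = t" by (simp add: t_def inner_commute)
      have wH: "w k \<bullet> H x = t" unfolding H t_def by (rule wT)
      have Hx: "H x = x - c *\<^sub>R g k + t *\<^sub>R (g k - n)" unfolding H T_def t_def ..
      show "x - ((x - c *\<^sub>R g k) \<bullet> face_normal g k) *\<^sub>R face_normal g k = (proj k c \<circ> H) x"
        unfolding face_normal_eq n_def[symmetric] o_def proj_def e wH unfolding Hx
        by (simp add: algebra_simps)
    qed
    have cellm: "cell g \<in> sets lborel" using borel_compact[OF compact_cell] by simp
    have sp: "space (lborel :: (real^'n) measure) = UNIV" by simp
    note r = scales_restrict[OF sH sp cellm]
    have "distr (restrict_space lborel (H -` cell g)) borel (proj k c \<circ> H)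
        = distr (distr (restrict_space lborel (H -` cell g)) (restrict_space lborel (cell g)) H) borel (proj k c)"
      by (rule distr_distr[symmetric, OF proj_measurable_restrict r(1)])
    also have "\<dots> = distr (density (restrict_space lborel (cell g)) (\<lambda>_. ennreal C)) borel (proj k c)"
      unfolding r(2) ..
    also have "\<dots> = density (distr (restrict_space lborel (cell g)) borel (proj k c)) (\<lambda>_. ennreal C)"
    proof (rule measure_eqI)
      fix A assume "A \<in> sets (distr (density (restrict_space lborel (cell g)) (\<lambda>_. ennreal C)) borel (proj k c))"
      then have A: "A \<in> sets borel" by simp
      note m = proj_measurable_restrict[of k c "cell g"]
      have m': "proj k c \<in> density (restrict_space lborel (cell g)) (\<lambda>_. ennreal C) \<rightarrow>\<^sub>M borel"
        using m by simp
      show "emeasure (distr (density (restrict_space lborel (cell g)) (\<lambda>_. ennreal C)) borel (proj k c)) A =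
        emeasure (density (distr (restrict_space lborel (cell g)) borel (proj k c)) (\<lambda>_. ennreal C)) A"
        using A measurable_sets[OF m A]
        by (simp add: emeasure_distr[OF m'] emeasure_distr[OF m] emeasure_density nn_integral_cmult_indicator)
    qed simp
    finally show ?thesis
      unfolding face_measure_def prism pr slice_eq_cell by simp
  qed
  with Cpos that show ?thesis by blast
qed

lemma borel_imp_face_measurable:
  "f \<in> borel_measurable borel \<Longrightarrow> f \<in> borel_measurable (face_measure g k c)"
  unfolding face_measure_def by (rule measurable_completion) simp

lemma lebesgue_on_U_borel:
  fixes f :: "real^'n \<Rightarrow> real"
  assumes f [measurable]: "f \<in> borel_measurable borel"
  shows "(\<integral>x. f x \<partial>lebesgue_on U) = (\<integral>x. f x \<partial>restrict_space lborel U)"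
    and "integrable (lebesgue_on U) f \<longleftrightarrow> integrable (restrict_space lborel U) f"
    and "f \<in> borel_measurable (lebesgue_on U)"
proof -
  have "(\<lambda>x. indicator U x *\<^sub>R f x) \<in> borel_measurable lborel" by measurable
  then show "(\<integral>x. f x \<partial>lebesgue_on U) = (\<integral>x. f x \<partial>restrict_space lborel U)"
    and "integrable (lebesgue_on U) f \<longleftrightarrow> integrable (restrict_space lborel U) f"
    by (simp_all add: integral_restrict_space integrable_restrict_space integral_completion integrable_completion)
  show "f \<in> borel_measurable (lebesgue_on U)"
    by (intro measurable_restrict_space1 measurable_completion) simp
qed

lemma integrable_bounded_U:
  fixes f :: "real^'n \<Rightarrow> real"
  assumes f: "f \<in> borel_measurable (lebesgue_on U)" and "\<And>x. x \<in> U \<Longrightarrow> \<bar>f x\<bar> \<le> B"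
  shows "integrable (lebesgue_on U) f"
proof -
  interpret finite_measure "lebesgue_on U" by (rule finite_measure_U)
  show ?thesis
    by (rule integrable_const_bound[OF _ f]) (use assms(2) in \<open>auto intro!: AE_I2\<close>)
qed

lemma bounded_on_cell:
  fixes f :: "real^'n \<Rightarrow> real"
  assumes "continuous_on UNIV f"
  obtains B where "\<And>x. x \<in> cell g \<Longrightarrow> \<bar>f x\<bar> \<le> B"
proof -
  have "compact (f ` cell g)"
    by (rule compact_continuous_image[OF continuous_on_subset[OF assms] compact_cell]) auto
  then obtain B where "\<forall>x\<in>f ` cell g. norm x \<le> B" using compact_imp_bounded bounded_iff by metis
  with that show ?thesis by auto
qed

lemma face_integral:
  fixes k :: 'n
  obtains C where "C > 0" "\<And>c f. c \<in> {0, 1} \<Longrightarrow> f \<in> borel_measurable borel \<Longrightarrow>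
      (\<integral>x. (f x :: real) \<partial>face_measure g k c) = C * (\<integral>y. f (proj k c y) \<partial>lebesgue_on U)"
    "\<And>c f. c \<in> {0, 1} \<Longrightarrow> continuous_on UNIV f \<Longrightarrow> integrable (face_measure g k c) (f :: _ \<Rightarrow> real)"
proof -
  obtain C where C: "C > 0" "\<And>c. c \<in> {0, 1} \<Longrightarrow>
    face_measure g k c = completion (density (slice k c) (\<lambda>_. ennreal C))"
    using face_measure_eq_slice by blast
  have I: "(\<integral>x. f x \<partial>face_measure g k c) = C * (\<integral>y. f (proj k c y) \<partial>lebesgue_on U)"
    "integrable (face_measure g k c) f \<longleftrightarrow> integrable (lebesgue_on U) (\<lambda>y. f (proj k c y))"
    if c: "c \<in> {0, 1}" and f [measurable]: "f \<in> borel_measurable borel" for c and f :: "real^'n \<Rightarrow> real"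
  proof -
    have f': "f \<in> borel_measurable (slice k c)" "f \<in> borel_measurable (density (slice k c) (\<lambda>_. ennreal C))"
      by (simp_all add: slice_def)
    note m = proj_measurable_restrict[of k c U]
    have "(\<integral>x. f x \<partial>face_measure g k c) = C * (\<integral>x. f x \<partial>slice k c)"
      using C(1) f' by (simp add: C(2)[OF c] integral_completion integral_density)
    also have "(\<integral>x. f x \<partial>slice k c) = (\<integral>y. f (proj k c y) \<partial>restrict_space lborel U)"
      unfolding slice_def by (rule integral_distr[OF m]) simp
    also have "\<dots> = (\<integral>y. f (proj k c y) \<partial>lebesgue_on U)"
      by (rule lebesgue_on_U_borel(1)[symmetric]) measurable
    finally show "(\<integral>x. f x \<partial>face_measure g k c) = C * (\<integral>y. f (proj k c y) \<partial>lebesgue_on U)" .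
    have "integrable (face_measure g k c) f \<longleftrightarrow> integrable (slice k c) (\<lambda>x. C * f x)"
      using C(1) f' by (simp add: C(2)[OF c] integrable_completion integrable_density)
    also have "\<dots> \<longleftrightarrow> integrable (slice k c) f" using C(1) by simp
    also have "\<dots> \<longleftrightarrow> integrable (restrict_space lborel U) (\<lambda>y. f (proj k c y))"
      unfolding slice_def by (rule integrable_distr_eq[OF m]) simp
    also have "\<dots> \<longleftrightarrow> integrable (lebesgue_on U) (\<lambda>y. f (proj k c y))"
      by (rule lebesgue_on_U_borel(2)[symmetric]) measurable
    finally show "integrable (face_measure g k c) f \<longleftrightarrow> integrable (lebesgue_on U) (\<lambda>y. f (proj k c y))" .
  qed
  have "integrable (face_measure g k c) f" if c: "c \<in> {0, 1}" and f: "continuous_on UNIV f" for c and f :: "real^'n \<Rightarrow> real"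
  proof -
    have [measurable]: "f \<in> borel_measurable borel" using f by (rule borel_measurable_continuous_onI)
    obtain B where B: "\<And>x. x \<in> cell g \<Longrightarrow> \<bar>f x\<bar> \<le> B" using bounded_on_cell[OF f] by blast
    have "integrable (lebesgue_on U) (\<lambda>y. f (proj k c y))"
      by (rule integrable_bounded_U[where B=B])
        (use B proj_in_cell[OF c] in \<open>auto intro!: lebesgue_on_U_borel(3)\<close>)
    then show ?thesis by (subst I(2)[OF c]) auto
  qed
  with C(1) I(1) show ?thesis by (intro that[of C]) auto
qed

text \<open>On coordinates, \<open>flip k\<close> commutes with projections up to renaming \<open>c\<close>, and it preserves the volume
  of the cell.\<close>

lemma face_measure_flip:
  fixes j k :: 'n and c c' :: real
  assumes c: "c \<in> {0, 1}" and c'_def: "c' = (if j = k then 1 - c else c)"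
  shows "flip k \<in> face_measure g j c \<rightarrow>\<^sub>M face_measure g j c'"
    and "distr (face_measure g j c) (face_measure g j c') (flip k) = face_measure g j c'"
proof -
  obtain C where C: "C > 0" "\<And>c. c \<in> {0, 1} \<Longrightarrow>
    face_measure g j c = completion (density (slice j c) (\<lambda>_. ennreal C))"
    using face_measure_eq_slice by blast
  have c': "c' \<in> {0, 1}" using c by (auto simp: c'_def)
  define \<nu> where "\<nu> = density (slice j c) (\<lambda>_. ennreal C)"
  define \<nu>' where "\<nu>' = density (slice j c') (\<lambda>_. ennreal C)"
  have f1: "face_measure g j c = completion \<nu>" "face_measure g j c' = completion \<nu>'"
    using C(2)[OF c] C(2)[OF c'] by (simp_all add: \<nu>_def \<nu>'_def)
  have sp: "space (lborel :: (real^'n) measure) = UNIV" "U \<in> sets lborel" by simp_all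
  note r = scales_restrict[OF scales_flip[of k] sp, unfolded flip_vimage_U]
  have "distr (slice j c) borel (flip k) = distr (restrict_space lborel U) borel (flip k \<circ> proj j c)"
    unfolding slice_def by (rule distr_distr[OF flip_borel proj_measurable_restrict])
  also have "flip k \<circ> proj j c = proj j c' \<circ> flip k"
    by (auto simp: flip_proj c'_def)
  also have "distr (restrict_space lborel U) borel (proj j c' \<circ> flip k)
      = distr (distr (restrict_space lborel U) (restrict_space lborel U) (flip k)) borel (proj j c')"
    by (rule distr_distr[symmetric, OF proj_measurable_restrict r(1)])
  also have "\<dots> = slice j c'"
    unfolding r(2) by (simp add: density_1 slice_def)
  finally have sl: "distr (slice j c) borel (flip k) = slice j c'" .
  have fm: "flip k \<in> slice j c \<rightarrow>\<^sub>M borel" by (simp add: slice_def)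
  have fm': "flip k \<in> \<nu> \<rightarrow>\<^sub>M \<nu>'" by (simp add: \<nu>_def \<nu>'_def slice_def)
  have d: "distr \<nu> \<nu>' (flip k) = \<nu>'"
  proof (rule measure_eqI)
    fix A assume "A \<in> sets (distr \<nu> \<nu>' (flip k))"
    then have A: "A \<in> sets borel" by (simp add: \<nu>'_def slice_def)
    have sB: "flip k -` A \<in> sets borel" using measurable_sets_borel[OF flip_borel A] .
    have "emeasure (distr \<nu> \<nu>' (flip k)) A = emeasure \<nu> (flip k -` A)"
      using A by (subst emeasure_distr[OF fm']) (auto simp: \<nu>_def \<nu>'_def slice_def)
    also have "\<dots> = ennreal C * emeasure (slice j c) (flip k -` A)"
      using sB by (simp add: \<nu>_def emeasure_density slice_def nn_integral_cmult_indicator)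
    also have "\<dots> = ennreal C * emeasure (distr (slice j c) borel (flip k)) A"
      using A by (subst emeasure_distr[OF fm]) (auto simp: slice_def)
    also have "\<dots> = emeasure \<nu>' A"
      unfolding sl using A by (simp add: \<nu>'_def emeasure_density slice_def nn_integral_cmult_indicator)
    finally show "emeasure (distr \<nu> \<nu>' (flip k)) A = emeasure \<nu>' A" .
  qed simp
  have dc: "distr (completion \<nu>) \<nu>' (flip k) = \<nu>'" using distr_completion[OF fm'] d by simp
  have m: "flip k \<in> completion \<nu> \<rightarrow>\<^sub>M \<nu>'" using fm' by (rule measurable_completion)
  show "flip k \<in> face_measure g j c \<rightarrow>\<^sub>M face_measure g j c'"
    unfolding f1 by (rule completion.measurable_completion2[OF m]) (simp add: dc)
  show "distr (face_measure g j c) (face_measure g j c') (flip k) = face_measure g j c'"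
    unfolding f1 using completion.completion_distr_eq[OF m] by (simp add: dc)
qed

text \<open>Projecting the open cell to a face other than $F_k^-$ never hits the closed set $F_k^-$, so that set is
  null for the surface measure there.\<close>

lemma zero_ext_AE:
  assumes c: "c \<in> {0, 1}" and "(j, c) \<noteq> (k, 0)"
  shows "AE x in face_measure g j c. zero_ext (face g k 0) \<phi> x = 0"
proof -
  obtain C where C: "C > 0" "\<And>c. c \<in> {0, 1} \<Longrightarrow>
    face_measure g j c = completion (density (slice j c) (\<lambda>_. ennreal C))"
    using face_measure_eq_slice by blast
  have "face g k 0 = cell g \<inter> {y. w k \<bullet> y = 0}" by (auto simp: face_eq)
  then have F [measurable]: "face g k 0 \<in> sets borel"
    using borel_compact[OF compact_cell] by (auto intro!: borel_closed closed_Collect_eq continuous_intros)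
  have ne: "proj j c y \<notin> face g k 0" if "y \<in> U" for y
    using that assms by (auto simp: face_eq U_def less_le)
  have "AE y in restrict_space lborel U. proj j c y \<notin> face g k 0"
    using ne by (intro AE_I2) (auto simp: space_restrict_space)
  then have "AE x in slice j c. x \<notin> face g k 0"
    unfolding slice_def by (subst AE_distr_iff[OF proj_measurable_restrict]) auto
  then have "AE x in density (slice j c) (\<lambda>_. ennreal C). x \<notin> face g k 0"
    by (subst AE_density) auto
  then have "AE x in face_measure g j c. x \<notin> face g k 0"
    unfolding C(2)[OF c] by (rule AE_completion)
  then show ?thesis by eventually_elim (simp add: zero_ext_def)
qed

end

section \<open>Green's formula on the cell\<close>

lemma integrable_indicator_bounded:
  fixes f :: "'a::euclidean_space \<Rightarrow> real"
  assumes [measurable]: "f \<in> borel_measurable borel" "S \<in> sets borel"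
    and "bounded S" and le: "\<And>x. x \<in> S \<Longrightarrow> \<bar>f x\<bar> \<le> B"
  shows "integrable lborel (\<lambda>x. indicator S x * f x)"
proof (rule Bochner_Integration.integrable_bound)
  show "integrable lborel (\<lambda>x. B * indicator S x)"
    using emeasure_bounded_finite[OF \<open>bounded S\<close>] by (intro integrable_mult_right) simp
  show "AE x in lborel. norm (indicator S x * f x) \<le> norm (B * indicator S x)"
    using le by (intro AE_I2) (force simp: indicator_def)
qed measurable

lemma continuous_bounded_cball:
  fixes f :: "'a::euclidean_space \<Rightarrow> real"
  assumes "continuous_on UNIV f"
  obtains B where "\<And>x. norm x \<le> r \<Longrightarrow> \<bar>f x\<bar> \<le> B"
proof -
  have "compact (f ` cball 0 r)"
    by (rule compact_continuous_image[OF continuous_on_subset[OF assms] compact_cball]) auto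
  then obtain B where "\<forall>x\<in>f ` cball 0 r. norm x \<le> B" using compact_imp_bounded bounded_iff by metis
  then show ?thesis by (intro that[of B]) auto
qed

context dual_basis
begin

lemma integral_U_lborel:
  fixes f :: "real^'n \<Rightarrow> real"
  assumes [measurable]: "f \<in> borel_measurable borel"
  shows "(\<integral>x. f x \<partial>lebesgue_on U) = (\<integral>x. indicator U x * f x \<partial>lborel)"
  by (simp add: integral_restrict_space integral_completion)

definition diam_bound :: real where "diam_bound = (\<Sum>j\<in>UNIV. norm (g j))"

lemma norm_g_le: "norm (g k) \<le> diam_bound"
  unfolding diam_bound_def by (rule member_le_sum) auto

text \<open>Half-open in $s_k$, so that adjacent slabs tile.\<close>

definition slab :: "'n \<Rightarrow> real \<Rightarrow> real \<Rightarrow> (real^'n) set" where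
  "slab k a b = {y. (\<forall>j\<in>UNIV - {k}. 0 < w j \<bullet> y \<and> w j \<bullet> y < 1) \<and> a < w k \<bullet> y \<and> w k \<bullet> y \<le> b}"

lemma slab_borel [measurable]: "slab k a b \<in> sets borel"
proof -
  have "slab k a b = {y \<in> space borel. (\<forall>j\<in>UNIV - {k}. 0 < w j \<bullet> y \<and> w j \<bullet> y < 1) \<and> a < w k \<bullet> y \<and> w k \<bullet> y \<le> b}"
    by (simp add: slab_def)
  also have "\<dots> \<in> sets borel" by measurable
  finally show ?thesis .
qed

lemma slab_norm:
  assumes "y \<in> slab k a b" "0 \<le> a" "b \<le> 2"
  shows "norm y \<le> 2 * diam_bound"
proof -
  have w2: "\<bar>w j \<bullet> y\<bar> \<le> 2" for j
  proof (cases "j = k")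
    case True
    then show ?thesis using assms by (auto simp: slab_def)
  next
    case False
    then have "0 < w j \<bullet> y \<and> w j \<bullet> y < 1" using assms(1) by (auto simp: slab_def)
    then show ?thesis by auto
  qed
  have "norm (\<Sum>j\<in>UNIV. (w j \<bullet> y) *\<^sub>R g j) \<le> (\<Sum>j\<in>UNIV. 2 * norm (g j))"
    using w2 by (intro sum_norm_le) (auto intro: mult_right_mono)
  also have "\<dots> = 2 * diam_bound" by (simp add: diam_bound_def sum_distrib_left)
  finally show ?thesis unfolding expand[of y, symmetric] .
qed

lemma slab_01_AE: "AE y in lborel. indicator (slab k 0 1) y = (indicator U y :: real)"
proof -
  have "{y. w k \<bullet> y = 1} \<in> null_sets lebesgue"
    using negligible_hyperplane[of "w k" 1] w_nonzero[of k] by (simp add: negligible_iff_null_sets)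
  then have "AE y in lebesgue. y \<notin> {y. w k \<bullet> y = 1}" by (rule AE_not_in)
  then have "AE y in lborel. y \<notin> {y. w k \<bullet> y = 1}" by (simp add: AE_completion_iff)
  then show ?thesis
  proof eventually_elim
    case (elim y)
    then have "y \<in> slab k 0 1 \<longleftrightarrow> y \<in> U" by (force simp: slab_def U_def less_le)
    then show ?case by (simp add: indicator_def)
  qed
qed

lemma U_measure_pos: "(\<integral>x. indicator U x \<partial>lborel) > (0::real)"
proof -
  have "(\<Sum>j\<in>UNIV. (1/2) *\<^sub>R g j) \<in> U" by (simp add: U_def coord)
  then have "\<not> negligible U" using open_U open_not_negligible by blast
  then have "emeasure lborel U \<noteq> 0" 
    by (auto simp: negligible_iff_null_sets null_sets_def)
  moreover have "emeasure lborel U < \<infinity>"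
    by (rule emeasure_bounded_finite, rule bounded_subset[OF compact_imp_bounded[OF compact_cell] U_subset_cell])
  ultimately have "measure lborel U > 0"
    by (simp add: measure_def enn2real_positive_iff zero_less_iff_neq_zero)
  then show ?thesis by simp
qed

text \<open>Translating the cell by \<open>h *\<^sub>R g k\<close> adds a slab of thickness \<open>h\<close> beyond $F_k^+$ and removes one at
  $F_k^-$. Both are images of the cell under the linear map \<open>L\<close> that multiplies $s_k$ by \<open>h\<close>, followed
  for the upper one by the translation by \<open>g k\<close>. The factor \<open>\<kappa>\<close> does not depend on \<open>F\<close>.\<close>

lemma difference_quotient_slabs:
  assumes h: "0 < h" "h \<le> 1"
  obtains \<kappa> where "\<And>F :: real^'n \<Rightarrow> real. continuous_on UNIV F \<Longrightarrow>
    (\<integral>y. indicator U y * (F (y + h *\<^sub>R g k) - F y) \<partial>lborel) =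
      \<kappa> * (\<integral>y. indicator U y * (F (proj k 1 y + (h * (w k \<bullet> y)) *\<^sub>R g k) - F (proj k 0 y + (h * (w k \<bullet> y)) *\<^sub>R g k)) \<partial>lborel)"
proof -
  define L where "L y = y + ((h - 1) * (w k \<bullet> y)) *\<^sub>R g k" for y
  have wL: "w j \<bullet> L y = (if j = k then h * (w k \<bullet> y) else w j \<bullet> y)" for j y
    unfolding L_def coord_add by (simp add: algebra_simps)
  have L: "linear L" unfolding L_def
    by (rule linearI) (auto simp: inner_add_right distrib_left scaleR_left_distrib scaleR_right_distrib)
  have injL: "inj L"
  proof (rule injI)
    fix x y assume "L x = L y"
    then have "w j \<bullet> L x = w j \<bullet> L y" for j by simp
    then have "w j \<bullet> x = w j \<bullet> y" for j using wL[of j x] wL[of j y] h by (auto split: if_splits)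
    then show "x = y" by (rule coord_eqI)
  qed
  obtain c where "\<And>b. scales lborel c (\<lambda>x. L x + b)" using scales_affine[OF L injL] by blast
  from this[of 0] have sL: "scales lborel c L" by simp
  then have c: "c > 0" by (simp add: scales_def)
  have [measurable]: "L \<in> borel_measurable borel" using sL by (simp add: scales_def)
  have subst: "(\<integral>x. f x \<partial>lborel) = (1 / c) * (\<integral>x. f (L x) \<partial>lborel)"
    if "f \<in> borel_measurable borel" for f :: "real^'n \<Rightarrow> real"
    using scales_integral(2)[OF sL, of UNIV f] that c by (simp add: restrict_space_UNIV)
  have indL: "indicator (slab k 0 h) (L y) = (indicator (slab k 0 1) y :: real)" for y
  proof -
    have "L y \<in> slab k 0 h \<longleftrightarrow> y \<in> slab k 0 1"
      using h by (auto simp: slab_def wL zero_less_mult_iff)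
    then show ?thesis by (simp add: indicator_def)
  qed
  have L0: "L y = proj k 0 y + (h * (w k \<bullet> y)) *\<^sub>R g k" for y
    by (rule coord_eqI) (auto simp: wL)
  have L1: "L y + g k = proj k 1 y + (h * (w k \<bullet> y)) *\<^sub>R g k" for y
    unfolding L0 using proj_shift[of k 0 1 y] by simp
  show ?thesis
  proof (rule that[of "1 / c"])
    fix F :: "real^'n \<Rightarrow> real" assume F: "continuous_on UNIV F"
    have [measurable]: "F \<in> borel_measurable borel" using F by (rule borel_measurable_continuous_onI)
    obtain B where B: "\<And>x. norm x \<le> 3 * diam_bound \<Longrightarrow> \<bar>F x\<bar> \<le> B" using continuous_bounded_cball[OF F] by blast
    have int: "integrable lborel (\<lambda>x. indicator (slab k a b) x * F (x + t *\<^sub>R g k))"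
      if "0 \<le> a" "b \<le> 2" "0 \<le> t" "t \<le> 1" for a b t
    proof (rule integrable_indicator_bounded[where B=B])
      show "bounded (slab k a b)" unfolding bounded_iff using slab_norm that by blast
      show "\<bar>F (x + t *\<^sub>R g k)\<bar> \<le> B" if x: "x \<in> slab k a b" for x
      proof (rule B)
        have "norm (t *\<^sub>R g k) \<le> diam_bound" 
          using mult_mono[OF \<open>t \<le> 1\<close> norm_g_le[of k]] \<open>0 \<le> t\<close> by simp
        then show "norm (x + t *\<^sub>R g k) \<le> 3 * diam_bound"
          using slab_norm[OF x \<open>0 \<le> a\<close> \<open>b \<le> 2\<close>] norm_triangle_ineq[of x "t *\<^sub>R g k"] by linarith
      qed
    qed measurable
    have int0: "integrable lborel (\<lambda>x. indicator (slab k a b) x * F x)" if "0 \<le> a" "b \<le> 2" for a b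
      using int[OF that, of 0] by simp
    have shift: "(\<integral>x. indicator (slab k a b) x * F (x + t *\<^sub>R g k) \<partial>lborel)
      = (\<integral>x. indicator (slab k (a + t) (b + t)) x * F x \<partial>lborel)" for a b t
    proof -
      have "indicator (slab k (a + t) (b + t)) (x + t *\<^sub>R g k) = (indicator (slab k a b) x :: real)" for x
        unfolding indicator_def slab_def by (auto simp: dual)
      then show ?thesis
        using lborel_translate(1)[of "\<lambda>x. indicator (slab k (a + t) (b + t)) x * F x" "t *\<^sub>R g k"] by simp
    qed
    have "(\<integral>y. indicator U y * (F (y + h *\<^sub>R g k) - F y) \<partial>lborel)
      = (\<integral>y. indicator (slab k 0 1) y * (F (y + h *\<^sub>R g k) - F y) \<partial>lborel)"
      using slab_01_AE[of k] by (intro integral_cong_AE) (auto elim: eventually_mono)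
    also have "\<dots> = (\<integral>y. indicator (slab k 0 1) y * F (y + h *\<^sub>R g k) \<partial>lborel)
        - (\<integral>y. indicator (slab k 0 1) y * F y \<partial>lborel)"
      using int[of 0 1 h] int0[of 0 1] h by (simp add: right_diff_distrib)
    also have "\<dots> = (\<integral>y. indicator (slab k h (1 + h)) y * F y \<partial>lborel)
        - (\<integral>y. indicator (slab k 0 1) y * F y \<partial>lborel)"
      using shift[of 0 1 h] by simp
    also have "\<dots> = (\<integral>y. indicator (slab k h (1 + h)) y * F y - indicator (slab k 0 1) y * F y \<partial>lborel)"
      using int0[of h "1 + h"] int0[of 0 1] h by simp
    also have "\<dots> = (\<integral>y. indicator (slab k 1 (1 + h)) y * F y - indicator (slab k 0 h) y * F y \<partial>lborel)"
    proof (rule Bochner_Integration.integral_cong[OF refl])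
      fix y
      have "indicator (slab k h (1 + h)) y - indicator (slab k 0 1) y
        = (indicator (slab k 1 (1 + h)) y - indicator (slab k 0 h) y :: real)"
        using h by (auto simp: indicator_def slab_def)
      then show "indicator (slab k h (1 + h)) y * F y - indicator (slab k 0 1) y * F y
        = indicator (slab k 1 (1 + h)) y * F y - indicator (slab k 0 h) y * F y"
        by (simp only: left_diff_distrib[symmetric])
    qed
    also have "\<dots> = (\<integral>y. indicator (slab k 1 (1 + h)) y * F y \<partial>lborel) - (\<integral>y. indicator (slab k 0 h) y * F y \<partial>lborel)"
      using int0[of 1 "1 + h"] int0[of 0 h] h by simp
    also have "\<dots> = (\<integral>y. indicator (slab k 0 h) y * F (y + 1 *\<^sub>R g k) \<partial>lborel) - (\<integral>y. indicator (slab k 0 h) y * F y \<partial>lborel)"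
      using shift[of 0 h 1] by (simp add: add.commute)
    also have "\<dots> = (\<integral>y. indicator (slab k 0 h) y * (F (y + g k) - F y) \<partial>lborel)"
      using int[of 0 h 1] int0[of 0 h] h by (simp add: right_diff_distrib)
    also have "\<dots> = (1 / c) * (\<integral>y. indicator (slab k 0 1) y * (F (L y + g k) - F (L y)) \<partial>lborel)"
      by (subst subst) (simp_all add: indL)
    also have "(\<integral>y. indicator (slab k 0 1) y * (F (L y + g k) - F (L y)) \<partial>lborel)
      = (\<integral>y. indicator U y * (F (L y + g k) - F (L y)) \<partial>lborel)"
      using slab_01_AE[of k] by (intro integral_cong_AE) (auto elim: eventually_mono)
    finally show "(\<integral>y. indicator U y * (F (y + h *\<^sub>R g k) - F y) \<partial>lborel) =
      (1 / c) * (\<integral>y. indicator U y * (F (proj k 1 y + (h * (w k \<bullet> y)) *\<^sub>R g k) - F (proj k 0 y + (h * (w k \<bullet> y)) *\<^sub>R g k)) \<partial>lborel)"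
      unfolding L1 unfolding L0 .
  qed
qed

text \<open>The linear function \<open>F y = w k \<bullet> y\<close> reveals that \<open>\<kappa> = h\<close>.\<close>

lemma difference_quotient_cell:
  fixes F :: "real^'n \<Rightarrow> real"
  assumes h: "0 < h" "h \<le> 1" and F: "continuous_on UNIV F"
  shows "(\<integral>y. indicator U y * ((F (y + h *\<^sub>R g k) - F y) / h) \<partial>lborel) =
      (\<integral>y. indicator U y * (F (proj k 1 y + (h * (w k \<bullet> y)) *\<^sub>R g k) - F (proj k 0 y + (h * (w k \<bullet> y)) *\<^sub>R g k)) \<partial>lborel)"
proof -
  obtain \<kappa> where \<kappa>: "\<And>F :: real^'n \<Rightarrow> real. continuous_on UNIV F \<Longrightarrow>
    (\<integral>y. indicator U y * (F (y + h *\<^sub>R g k) - F y) \<partial>lborel) =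
      \<kappa> * (\<integral>y. indicator U y * (F (proj k 1 y + (h * (w k \<bullet> y)) *\<^sub>R g k) - F (proj k 0 y + (h * (w k \<bullet> y)) *\<^sub>R g k)) \<partial>lborel)"
    using difference_quotient_slabs[OF h, of k] by blast
  have "continuous_on UNIV (\<lambda>y. w k \<bullet> y)" by (intro continuous_intros)
  from \<kappa>[OF this] have "(\<integral>y. indicator U y * h \<partial>lborel) = \<kappa> * (\<integral>y. indicator U y \<partial>lborel)"
    by simp
  then have "h = \<kappa>" using U_measure_pos by simp
  then show ?thesis using \<kappa>[OF F] h by simp
qed

text \<open>The limit \<open>h \<rightarrow> 0\<close> of the preceding identity.\<close>

lemma green_direction:
  fixes F :: "real^'n \<Rightarrow> real"
  assumes d: "\<And>x. F differentiable (at x)" and pc: "\<And>i. continuous_on UNIV (partial_deriv i F)"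
  shows "(\<integral>y. grad F y \<bullet> g k \<partial>lebesgue_on U) = (\<integral>y. F (proj k 1 y) - F (proj k 0 y) \<partial>lebesgue_on U)"
proof -
  have Fc: "continuous_on UNIV F"
    using d by (auto simp: continuous_on_eq_continuous_at intro!: differentiable_imp_continuous_within)
  have Dc: "continuous_on UNIV (\<lambda>y. grad F y \<bullet> g k)"
    unfolding grad_def inner_vec_def by (auto intro!: continuous_intros pc)
  have [measurable]: "F \<in> borel_measurable borel" "(\<lambda>y. grad F y \<bullet> g k) \<in> borel_measurable borel"
    using Fc Dc by (auto intro: borel_measurable_continuous_onI)
  have bU: "bounded U" by (rule bounded_subset[OF compact_imp_bounded[OF compact_cell] U_subset_cell])
  obtain B where B: "\<And>x. norm x \<le> 2 * diam_bound \<Longrightarrow> \<bar>F x\<bar> \<le> B" using continuous_bounded_cball[OF Fc] by blast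
  obtain B' where B': "\<And>x. norm x \<le> 2 * diam_bound \<Longrightarrow> \<bar>grad F x \<bullet> g k\<bar> \<le> B'" using continuous_bounded_cball[OF Dc] by blast
  have nt: "norm (x + t *\<^sub>R g k) \<le> 2 * diam_bound" if "x \<in> cell g" "0 \<le> t" "t \<le> 1" for x t
  proof -
    have "norm (t *\<^sub>R g k) \<le> diam_bound" using mult_mono[OF that(3) norm_g_le[of k]] that(2) by simp
    then show ?thesis
      using norm_cell[OF that(1)] norm_triangle_ineq[of x "t *\<^sub>R g k"] by (simp add: diam_bound_def)
  qed
  define h where "h n = 1 / real (Suc n)" for n
  have h: "0 < h n" "h n \<le> 1" for n by (auto simp: h_def)
  have h0: "h \<longlonglongrightarrow> 0" unfolding h_def[abs_def] by (rule LIMSEQ_Suc[OF lim_1_over_n])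
  have hs: "0 \<le> h n * (w k \<bullet> y)" "h n * (w k \<bullet> y) \<le> 1" if "y \<in> U" for n y
  proof -
    have "0 < w k \<bullet> y" "w k \<bullet> y < 1" using that by (auto simp: U_def)
    then show "0 \<le> h n * (w k \<bullet> y)" "h n * (w k \<bullet> y) \<le> 1"
      using h[of n] by (auto intro: mult_le_one)
  qed
  have D: "((\<lambda>t. F (y + t *\<^sub>R g k)) has_real_derivative grad F (y + t *\<^sub>R g k) \<bullet> g k) (at t)" for y t
  proof -
    have "((\<lambda>t. y + t *\<^sub>R g k) has_derivative (\<lambda>s. s *\<^sub>R g k)) (at t)"
      by (auto intro!: derivative_eq_intros)
    from has_derivative_compose[OF this has_derivative_grad[OF d]]
    show ?thesis by (simp add: has_field_derivative_def mult_commute_abs)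
  qed
  have quot: "\<exists>t. 0 < t \<and> t < h n \<and> (F (y + h n *\<^sub>R g k) - F y) / h n = grad F (y + t *\<^sub>R g k) \<bullet> g k" for n y
  proof -
    have "\<exists>t>0. t < h n \<and> F (y + h n *\<^sub>R g k) - F (y + 0 *\<^sub>R g k) = (h n - 0) * (grad F (y + t *\<^sub>R g k) \<bullet> g k)"
      by (rule MVT2[OF h(1)]) (rule D)
    then show ?thesis using h(1)[of n] by (auto simp: field_simps)
  qed
  let ?q = "\<lambda>n y. indicator U y * ((F (y + h n *\<^sub>R g k) - F y) / h n)"
  let ?r = "\<lambda>n y. indicator U y * (F (proj k 1 y + (h n * (w k \<bullet> y)) *\<^sub>R g k) - F (proj k 0 y + (h n * (w k \<bullet> y)) *\<^sub>R g k))"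
  have ind: "integrable lborel (\<lambda>x. indicator U x * (c::real))" for c
    by (rule integrable_indicator_bounded[where B="\<bar>c\<bar>", OF _ U_borel bU]) auto
  have q: "(\<lambda>n. \<integral>y. ?q n y \<partial>lborel) \<longlonglongrightarrow> (\<integral>y. indicator U y * (grad F y \<bullet> g k) \<partial>lborel)"
  proof (rule integral_dominated_convergence[where w="\<lambda>y. indicator U y * B'"])
    show "AE y in lborel. (\<lambda>n. ?q n y) \<longlonglongrightarrow> indicator U y * (grad F y \<bullet> g k)"
    proof (rule AE_I2, rule tendsto_mult_left)
      fix y
      have "(\<lambda>s. (F (y + (0 + s) *\<^sub>R g k) - F (y + 0 *\<^sub>R g k)) / s) \<midarrow>0\<rightarrow> grad F (y + 0 *\<^sub>R g k) \<bullet> g k"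
        using D[of y 0] unfolding DERIV_def .
      then have "(\<lambda>s. (F (y + s *\<^sub>R g k) - F y) / s) \<midarrow>0\<rightarrow> grad F y \<bullet> g k" by simp
      moreover have "filterlim h (at 0) sequentially"
        using h0 h(1) by (auto simp: filterlim_at less_imp_neq[symmetric] intro!: always_eventually)
      ultimately show "(\<lambda>n. (F (y + h n *\<^sub>R g k) - F y) / h n) \<longlonglongrightarrow> grad F y \<bullet> g k"
        by (rule filterlim_compose)
    qed
    show "AE y in lborel. norm (?q n y) \<le> indicator U y * B'" for n
    proof (rule AE_I2)
      fix y show "norm (?q n y) \<le> indicator U y * B'"
      proof (cases "y \<in> U")
        case True
        obtain t where t: "0 < t" "t < h n" "(F (y + h n *\<^sub>R g k) - F y) / h n = grad F (y + t *\<^sub>R g k) \<bullet> g k"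
          using quot by blast
        have "\<bar>grad F (y + t *\<^sub>R g k) \<bullet> g k\<bar> \<le> B'"
          by (rule B'[OF nt]) (use t True U_subset_cell h(2)[of n] in auto)
        then show ?thesis using True unfolding t(3) by simp
      qed simp
    qed
  qed (use ind in measurable)
  have r: "(\<lambda>n. \<integral>y. ?r n y \<partial>lborel) \<longlonglongrightarrow> (\<integral>y. indicator U y * (F (proj k 1 y) - F (proj k 0 y)) \<partial>lborel)"
  proof (rule integral_dominated_convergence[where w="\<lambda>y. indicator U y * (B + B)"])
    show "AE y in lborel. (\<lambda>n. ?r n y) \<longlonglongrightarrow> indicator U y * (F (proj k 1 y) - F (proj k 0 y))"
    proof (rule AE_I2, rule tendsto_mult_left)
      fix y
      have "(\<lambda>n. F (proj k c y + (h n * (w k \<bullet> y)) *\<^sub>R g k)) \<longlonglongrightarrow> F (proj k c y + (0 * (w k \<bullet> y)) *\<^sub>R g k)" for c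
        by (intro continuous_on_tendsto_compose[OF Fc] tendsto_intros h0) auto
      from tendsto_diff[OF this this]
      show "(\<lambda>n. F (proj k 1 y + (h n * (w k \<bullet> y)) *\<^sub>R g k) - F (proj k 0 y + (h n * (w k \<bullet> y)) *\<^sub>R g k))
        \<longlonglongrightarrow> F (proj k 1 y) - F (proj k 0 y)" by simp
    qed
    show "AE y in lborel. norm (?r n y) \<le> indicator U y * (B + B)" for n
    proof (rule AE_I2)
      fix y show "norm (?r n y) \<le> indicator U y * (B + B)"
      proof (cases "y \<in> U")
        case True
        have "\<bar>F (proj k c y + (h n * (w k \<bullet> y)) *\<^sub>R g k)\<bar> \<le> B" if "c \<in> {0, 1}" for c
          by (rule B[OF nt[OF proj_in_cell[OF that True] hs[OF True]]])
        from this[of 0] this[of 1] show ?thesis using True by simp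
      qed simp
    qed
  qed (use ind in measurable)
  have eq: "(\<lambda>n. \<integral>y. ?q n y \<partial>lborel) = (\<lambda>n. \<integral>y. ?r n y \<partial>lborel)"
    using difference_quotient_cell[OF h Fc] by auto
  have "(\<integral>y. indicator U y * (grad F y \<bullet> g k) \<partial>lborel) = (\<integral>y. indicator U y * (F (proj k 1 y) - F (proj k 0 y)) \<partial>lborel)"
    using LIMSEQ_unique[OF q[unfolded eq] r] .
  then show ?thesis by (simp add: integral_U_lborel)
qed

text \<open>Up to a factor depending on \<open>k\<close> only, this is the integral of \<open>F\<close> over $F_k^+$ minus that over $F_k^-$.\<close>

definition jump :: "'n \<Rightarrow> (real^'n \<Rightarrow> real) \<Rightarrow> real" where
  "jump k F = (\<integral>y. F (proj k 1 y) - F (proj k 0 y) \<partial>lebesgue_on U)"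

lemma continuous_integrable_U:
  fixes f :: "real^'n \<Rightarrow> real"
  assumes "continuous_on UNIV f"
  shows "f \<in> borel_measurable (lebesgue_on U)" "integrable (lebesgue_on U) f"
    "integrable (lebesgue_on U) (\<lambda>x. (f x)\<^sup>2)"
proof -
  have *: "integrable (lebesgue_on U) f \<and> f \<in> borel_measurable (lebesgue_on U)"
    if f: "continuous_on UNIV f" for f :: "real^'n \<Rightarrow> real"
  proof -
    have m: "f \<in> borel_measurable (lebesgue_on U)"
      by (intro lebesgue_on_U_borel(3) borel_measurable_continuous_onI f)
    obtain B where "\<And>x. x \<in> cell g \<Longrightarrow> \<bar>f x\<bar> \<le> B" using bounded_on_cell[OF f] by blast
    then have "integrable (lebesgue_on U) f"
      using U_subset_cell by (intro integrable_bounded_U[OF m]) blast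
    with m show ?thesis by simp
  qed
  show "f \<in> borel_measurable (lebesgue_on U)" "integrable (lebesgue_on U) f"
    "integrable (lebesgue_on U) (\<lambda>x. (f x)\<^sup>2)"
    using *[OF assms] *[of "\<lambda>x. (f x)\<^sup>2"] assms by (auto intro!: continuous_intros)
qed

lemma continuous_integrable_proj:
  fixes f :: "real^'n \<Rightarrow> real"
  assumes f: "continuous_on UNIV f"
  shows "(\<lambda>y. f (proj k c y)) \<in> borel_measurable (lebesgue_on U)"
    "integrable (lebesgue_on U) (\<lambda>y. f (proj k c y))"
    "integrable (lebesgue_on U) (\<lambda>x. (f (proj k c x))\<^sup>2)"
proof -
  have "continuous_on UNIV (\<lambda>y. f (proj k c y))"
    by (rule continuous_on_compose2[OF f continuous_proj]) auto
  from continuous_integrable_U[OF this] show "(\<lambda>y. f (proj k c y)) \<in> borel_measurable (lebesgue_on U)"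
    "integrable (lebesgue_on U) (\<lambda>y. f (proj k c y))"
    "integrable (lebesgue_on U) (\<lambda>x. (f (proj k c x))\<^sup>2)" .
qed

text \<open>The \<open>i\<close>-th unit vector has coordinates \<open>w k $ i\<close> with respect to \<open>g\<close>.\<close>

lemma green_partial:
  fixes F :: "real^'n \<Rightarrow> real"
  assumes d: "\<And>x. F differentiable (at x)" and pc: "\<And>i. continuous_on UNIV (partial_deriv i F)"
  shows "(\<integral>y. partial_deriv i F y \<partial>lebesgue_on U) = (\<Sum>k\<in>UNIV. (w k $ i) * jump k F)"
proof -
  have axis: "axis i 1 = (\<Sum>k\<in>UNIV. (w k $ i) *\<^sub>R g k)"
    using expand[of "axis i 1"] by (simp add: inner_axis)
  have pd: "partial_deriv i F y = (\<Sum>k\<in>UNIV. (w k $ i) * (grad F y \<bullet> g k))" for y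
  proof -
    have "partial_deriv i F y = grad F y \<bullet> axis i 1" by (simp add: inner_axis grad_def)
    then show ?thesis unfolding axis by (simp add: inner_sum_right)
  qed
  have "continuous_on UNIV (\<lambda>y. grad F y \<bullet> g k)" for k
    unfolding grad_def inner_vec_def by (auto intro!: continuous_intros pc)
  note int = continuous_integrable_U(2)[OF this]
  have "(\<integral>y. partial_deriv i F y \<partial>lebesgue_on U) = (\<Sum>k\<in>UNIV. (w k $ i) * (\<integral>y. grad F y \<bullet> g k \<partial>lebesgue_on U))"
    unfolding pd using int by (subst Bochner_Integration.integral_sum) auto
  then show ?thesis unfolding jump_def green_direction[OF d pc] .
qed

text \<open>Green's formula for a function that is only approximated by smooth ones: the boundary terms of
  the approximations converge because the volume terms do. It gives access to boundary values
  without a trace theorem.\<close>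

lemma green_limit:
  fixes \<Phi> :: "real^'n \<Rightarrow> real" and G :: "real^'n \<Rightarrow> real^'n"
  assumes f: "\<And>m::nat. smooth (f m)" and \<Phi>: "\<Phi> \<in> L2 (lebesgue_on U)" and G: "G \<in> L2 (lebesgue_on U)"
    and lim: "(\<lambda>m. \<integral>x. (f m x - \<Phi> x)\<^sup>2 \<partial>lebesgue_on U) \<longlonglongrightarrow> 0"
    and glim: "(\<lambda>m. \<integral>x. (norm (grad (f m) x - G x))\<^sup>2 \<partial>lebesgue_on U) \<longlonglongrightarrow> 0"
    and \<eta>: "smooth \<eta>"
  shows "(\<lambda>m. \<Sum>k\<in>UNIV. (w k $ i) * jump k (\<lambda>x. f m x * \<eta> x)) \<longlonglongrightarrow>
    (\<integral>x. \<Phi> x * partial_deriv i \<eta> x \<partial>lebesgue_on U) + (\<integral>x. G x $ i * \<eta> x \<partial>lebesgue_on U)"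
proof -
  let ?M = "lebesgue_on U"
  note fc = smooth_continuous[OF f] note fpc = smooth_continuous[OF smooth_partial_deriv[OF f]]
  note ec = smooth_continuous[OF \<eta>] note epc = smooth_continuous[OF smooth_partial_deriv[OF \<eta>]]
  have \<Phi>': "\<Phi> \<in> borel_measurable ?M" "integrable ?M (\<lambda>x. (\<Phi> x)\<^sup>2)" using \<Phi> by (auto simp: L2_def)
  have G': "(\<lambda>x. G x $ j) \<in> borel_measurable ?M" "integrable ?M (\<lambda>x. (G x $ j)\<^sup>2)" for j
    using L2_component[OF G, of j] by (auto simp: L2_def)
  have gd: "integrable ?M (\<lambda>x. (partial_deriv j (f m) x - G x $ j)\<^sup>2)" for j m
    by (rule integrable_square_diff[OF continuous_integrable_U(1)[OF fpc] G'(1) continuous_integrable_U(3)[OF fpc] G'(2)])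
  have nsq: "(norm (grad (f m) x - G x))\<^sup>2 = (\<Sum>j\<in>UNIV. (partial_deriv j (f m) x - G x $ j)\<^sup>2)" for m x
    unfolding power2_norm_eq_inner inner_vec_def by (simp add: grad_def power2_eq_square)
  have glim_i: "(\<lambda>m. \<integral>x. (partial_deriv i (f m) x - G x $ i)\<^sup>2 \<partial>?M) \<longlonglongrightarrow> 0"
  proof (rule tendsto_sandwich[OF _ _ tendsto_const glim])
    show "\<forall>\<^sub>F m in sequentially. (\<integral>x. (partial_deriv i (f m) x - G x $ i)\<^sup>2 \<partial>?M)
        \<le> (\<integral>x. (norm (grad (f m) x - G x))\<^sup>2 \<partial>?M)"
    proof (rule always_eventually, rule allI, rule integral_mono)
      fix m x
      show "(partial_deriv i (f m) x - G x $ i)\<^sup>2 \<le> (norm (grad (f m) x - G x))\<^sup>2"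
        unfolding nsq by (rule member_le_sum) auto
    qed (auto simp: nsq gd)
  qed auto
  have A: "(\<lambda>m. \<integral>x. f m x * partial_deriv i \<eta> x \<partial>?M) \<longlonglongrightarrow> (\<integral>x. \<Phi> x * partial_deriv i \<eta> x \<partial>?M)"
    by (rule L2_tendsto_integral_mult[OF continuous_integrable_U(1)[OF fc] \<Phi>'(1) continuous_integrable_U(1)[OF epc]
      continuous_integrable_U(3)[OF fc] \<Phi>'(2) continuous_integrable_U(3)[OF epc] lim])
  have B: "(\<lambda>m. \<integral>x. partial_deriv i (f m) x * \<eta> x \<partial>?M) \<longlonglongrightarrow> (\<integral>x. G x $ i * \<eta> x \<partial>?M)"
    by (rule L2_tendsto_integral_mult[OF continuous_integrable_U(1)[OF fpc] G'(1) continuous_integrable_U(1)[OF ec]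
      continuous_integrable_U(3)[OF fpc] G'(2) continuous_integrable_U(3)[OF ec] glim_i])
  have "(\<Sum>k\<in>UNIV. (w k $ i) * jump k (\<lambda>x. f m x * \<eta> x))
      = (\<integral>x. f m x * partial_deriv i \<eta> x \<partial>?M) + (\<integral>x. partial_deriv i (f m) x * \<eta> x \<partial>?M)" for m
  proof -
    have s: "smooth (\<lambda>x. f m x * \<eta> x)" by (rule smooth_mult[OF f \<eta>])
    have "(\<Sum>k\<in>UNIV. (w k $ i) * jump k (\<lambda>x. f m x * \<eta> x)) = (\<integral>x. partial_deriv i (\<lambda>x. f m x * \<eta> x) x \<partial>?M)"
      by (rule green_partial[symmetric, OF smooth_differentiable[OF s] smooth_continuous[OF smooth_partial_deriv[OF s]]])
    also have "\<dots> = (\<integral>x. f m x * partial_deriv i \<eta> x + partial_deriv i (f m) x * \<eta> x \<partial>?M)"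
      by (simp only: partial_deriv_mult[OF smooth_differentiable[OF f] smooth_differentiable[OF \<eta>]])
    also have "\<dots> = (\<integral>x. f m x * partial_deriv i \<eta> x \<partial>?M) + (\<integral>x. partial_deriv i (f m) x * \<eta> x \<partial>?M)"
      using continuous_integrable_U(2)[OF continuous_on_mult[OF fc epc]] continuous_integrable_U(2)[OF continuous_on_mult[OF fpc ec]]
      by (rule Bochner_Integration.integral_add)
    finally show ?thesis .
  qed
  then show ?thesis using tendsto_add[OF A B] by simp
qed

text \<open>Boundary terms disappear when the approximations tend to 0 in $L^2$ of both faces.\<close>

lemma jump_tendsto_0:
  fixes \<eta> :: "real^'n \<Rightarrow> real"
  assumes f: "\<And>m::nat. continuous_on UNIV (f m)" and \<eta>: "continuous_on UNIV \<eta>"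
    and lim: "\<And>c. c \<in> {0, 1} \<Longrightarrow> (\<lambda>m. \<integral>y. (f m (proj k c y))\<^sup>2 \<partial>lebesgue_on U) \<longlonglongrightarrow> 0"
  shows "(\<lambda>m. jump k (\<lambda>x. f m x * \<eta> x)) \<longlonglongrightarrow> 0"
proof -
  let ?M = "lebesgue_on U"
  have "(\<lambda>m. \<integral>y. f m (proj k c y) * \<eta> (proj k c y) \<partial>?M) \<longlonglongrightarrow> (\<integral>y. 0 * \<eta> (proj k c y) \<partial>?M)"
    if "c \<in> {0, 1}" for c
    by (rule L2_tendsto_integral_mult[where f="\<lambda>y. 0"])
      (use lim[OF that] continuous_integrable_proj[OF f] continuous_integrable_proj[OF \<eta>] in auto)
  from tendsto_diff[OF this[of 1] this[of 0]]
  have "(\<lambda>m. (\<integral>y. f m (proj k 1 y) * \<eta> (proj k 1 y) \<partial>?M) - (\<integral>y. f m (proj k 0 y) * \<eta> (proj k 0 y) \<partial>?M)) \<longlonglongrightarrow> 0"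
    by simp
  moreover have "jump k (\<lambda>x. f m x * \<eta> x) =
      (\<integral>y. f m (proj k 1 y) * \<eta> (proj k 1 y) \<partial>?M) - (\<integral>y. f m (proj k 0 y) * \<eta> (proj k 0 y) \<partial>?M)" for m
    unfolding jump_def
    by (rule Bochner_Integration.integral_diff) (rule continuous_integrable_proj(2)[OF continuous_on_mult[OF f \<eta>]])+
  ultimately show ?thesis by simp
qed

end

section \<open>Glueing functions across a face\<close>

context dual_basis
begin

text \<open>The part of \<open>is_trace\<close> that concerns the inside of the cell, with an arbitrary field \<open>G\<close> instead of
  the chosen weak gradient.\<close>

definition smooth_approx :: "(nat \<Rightarrow> real^'n \<Rightarrow> real) \<Rightarrow> (real^'n \<Rightarrow> real) \<Rightarrow> (real^'n \<Rightarrow> real^'n) \<Rightarrow> bool" where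
  "smooth_approx f \<Phi> G \<longleftrightarrow> (\<forall>m. smooth (f m)) \<and> \<Phi> \<in> L2 (lebesgue_on U) \<and> G \<in> L2 (lebesgue_on U) \<and>
     (\<lambda>m. \<integral>x. (f m x - \<Phi> x)\<^sup>2 \<partial>lebesgue_on U) \<longlonglongrightarrow> 0 \<and>
     (\<lambda>m. \<integral>x. (norm (grad (f m) x - G x))\<^sup>2 \<partial>lebesgue_on U) \<longlonglongrightarrow> 0"

text \<open>This is \<open>a\<close> on the open cell, \<open>b\<close> shifted by \<open>v\<close> on the cell translated by \<open>- v\<close>, and 0 elsewhere. Two
  shifts occur: with \<open>v = g k\<close> the two cells share the face $F_k^-$; with \<open>v = 0\<close> they coincide, and
  \<open>a + b\<close> is extended by zero.\<close>

definition glue :: "real^'n \<Rightarrow> (real^'n \<Rightarrow> 'b::euclidean_space) \<Rightarrow> (real^'n \<Rightarrow> 'b) \<Rightarrow> real^'n \<Rightarrow> 'b" where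
  "glue v a b x = indicator U x *\<^sub>R a x + indicator U (x + v) *\<^sub>R b (x + v)"

lemma U_lebesgue: "U \<inter> space lebesgue \<in> sets lebesgue" by simp

lemma indicator_U_measurable:
  fixes a :: "real^'n \<Rightarrow> 'b::euclidean_space"
  assumes "a \<in> borel_measurable (lebesgue_on U)"
  shows "(\<lambda>x. indicator U x *\<^sub>R a x) \<in> borel_measurable lebesgue"
  using assms by (subst (asm) borel_measurable_restrict_space_iff[OF U_lebesgue])

lemma glue_measurable:
  assumes "a \<in> borel_measurable (lebesgue_on U)" "b \<in> borel_measurable (lebesgue_on U)"
  shows "glue v a b \<in> borel_measurable lebesgue"
  unfolding glue_def[abs_def]
  by (intro borel_measurable_add indicator_U_measurable assms lebesgue_translate(1)[OF indicator_U_measurable])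

lemma glue_integral:
  fixes a b :: "real^'n \<Rightarrow> real"
  assumes a: "integrable (lebesgue_on U) a" and b: "integrable (lebesgue_on U) b"
  shows "integrable lebesgue (glue v a b)"
    and "(\<integral>x. glue v a b x \<partial>lebesgue) = (\<integral>x. a x \<partial>lebesgue_on U) + (\<integral>x. b x \<partial>lebesgue_on U)"
proof -
  have ia: "integrable lebesgue (\<lambda>x. indicator U x *\<^sub>R a x)" and ib: "integrable lebesgue (\<lambda>x. indicator U x *\<^sub>R b x)"
    using a b by (simp_all only: integrable_restrict_space[OF U_lebesgue])
  have ib': "integrable lebesgue (\<lambda>x. indicator U (x + v) *\<^sub>R b (x + v))"
    "(\<integral>x. indicator U (x + v) *\<^sub>R b (x + v) \<partial>lebesgue) = (\<integral>x. indicator U x *\<^sub>R b x \<partial>lebesgue)"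
    using lebesgue_translate(2,3)[OF borel_measurable_integrable[OF ib], of v] ib by simp_all
  show "integrable lebesgue (glue v a b)"
    unfolding glue_def[abs_def] by (rule Bochner_Integration.integrable_add[OF ia ib'(1)])
  show "(\<integral>x. glue v a b x \<partial>lebesgue) = (\<integral>x. a x \<partial>lebesgue_on U) + (\<integral>x. b x \<partial>lebesgue_on U)"
    unfolding glue_def integral_restrict_space[OF U_lebesgue] Bochner_Integration.integral_add[OF ia ib'(1)] ib'(2) ..
qed

lemma glue_L2:
  fixes a b :: "real^'n \<Rightarrow> 'b::euclidean_space"
  assumes a: "a \<in> L2 (lebesgue_on U)" and b: "b \<in> L2 (lebesgue_on U)"
  shows "glue v a b \<in> L2 lebesgue"
proof -
  have ext: "(\<lambda>x. indicator U x *\<^sub>R f x) \<in> L2 lebesgue" if "f \<in> L2 (lebesgue_on U)" for f :: "real^'n \<Rightarrow> 'b"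
  proof -
    have "integrable lebesgue (\<lambda>x. indicator U x *\<^sub>R (norm (f x))\<^sup>2)"
      using that unfolding L2_def integrable_restrict_space[OF U_lebesgue] by simp
    moreover have "(\<lambda>x. indicator U x *\<^sub>R (norm (f x))\<^sup>2) = (\<lambda>x. (norm (indicator U x *\<^sub>R f x))\<^sup>2)"
      by (auto simp: indicator_def)
    ultimately show ?thesis using that indicator_U_measurable[of f] by (simp add: L2_def)
  qed
  have "(\<lambda>x. f (x + v)) \<in> L2 lebesgue" if "f \<in> L2 lebesgue" for f :: "real^'n \<Rightarrow> 'b"
    using that lebesgue_translate(1)[of f v] lebesgue_translate(3)[of "\<lambda>x. (norm (f x))\<^sup>2" v] by (auto simp: L2_def)
  from L2_add[OF ext[OF a] this[OF ext[OF b]]] show ?thesis unfolding glue_def[abs_def] .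
qed

text \<open>Green's formula on each of the two cells. The assumption says that the boundary terms cancel in
  the limit, which is the matching of traces on the common face and their vanishing on the rest.\<close>

lemma glue_weak_grad:
  assumes a: "smooth_approx fa \<Phi>a Ga" and b: "smooth_approx fb \<Phi>b Gb"
    and jump0: "\<And>\<eta> k. smooth \<eta> \<Longrightarrow>
      (\<lambda>m. jump k (\<lambda>x. fa m x * \<eta> x) + jump k (\<lambda>x. fb m x * \<eta> (x - v))) \<longlonglongrightarrow> 0"
  shows "has_weak_grad UNIV (glue v \<Phi>a \<Phi>b) (glue v Ga Gb)"
  unfolding has_weak_grad_def lebesgue_on_UNIV_eq
proof (intro ballI allI)
  fix \<eta> :: "real^'n \<Rightarrow> real" and i assume "\<eta> \<in> test_functions UNIV"
  then have \<eta>: "smooth \<eta>" by (simp add: test_functions_def)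
  let ?\<eta> = "\<lambda>x. \<eta> (x - v)" let ?M = "lebesgue_on U"
  have \<eta>v: "smooth ?\<eta>" by (rule smooth_translate[OF \<eta>])
  note A = a[unfolded smooth_approx_def] note B = b[unfolded smooth_approx_def]
  let ?Ia = "(\<integral>x. \<Phi>a x * partial_deriv i \<eta> x \<partial>?M)" let ?Ja = "(\<integral>x. Ga x $ i * \<eta> x \<partial>?M)"
  let ?Ib = "(\<integral>x. \<Phi>b x * partial_deriv i ?\<eta> x \<partial>?M)" let ?Jb = "(\<integral>x. Gb x $ i * ?\<eta> x \<partial>?M)"
  have "(\<lambda>m. \<Sum>k\<in>UNIV. (w k $ i) * jump k (\<lambda>x. fa m x * \<eta> x)) \<longlonglongrightarrow> ?Ia + ?Ja"
    by (rule green_limit) (use A \<eta> in auto)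
  moreover have "(\<lambda>m. \<Sum>k\<in>UNIV. (w k $ i) * jump k (\<lambda>x. fb m x * ?\<eta> x)) \<longlonglongrightarrow> ?Ib + ?Jb"
    by (rule green_limit) (use B \<eta>v in auto)
  ultimately have "(\<lambda>m. (\<Sum>k\<in>UNIV. (w k $ i) * jump k (\<lambda>x. fa m x * \<eta> x)) + (\<Sum>k\<in>UNIV. (w k $ i) * jump k (\<lambda>x. fb m x * ?\<eta> x)))
      \<longlonglongrightarrow> (?Ia + ?Ja) + (?Ib + ?Jb)" by (rule tendsto_add)
  moreover have "(\<lambda>m. (\<Sum>k\<in>UNIV. (w k $ i) * jump k (\<lambda>x. fa m x * \<eta> x)) + (\<Sum>k\<in>UNIV. (w k $ i) * jump k (\<lambda>x. fb m x * ?\<eta> x)))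
      = (\<lambda>m. \<Sum>k\<in>UNIV. (w k $ i) * (jump k (\<lambda>x. fa m x * \<eta> x) + jump k (\<lambda>x. fb m x * ?\<eta> x)))"
    by (simp add: sum.distrib distrib_left)
  moreover have "(\<lambda>m. \<Sum>k\<in>UNIV. (w k $ i) * (jump k (\<lambda>x. fa m x * \<eta> x) + jump k (\<lambda>x. fb m x * ?\<eta> x))) \<longlonglongrightarrow> (\<Sum>k\<in>UNIV. (w k $ i) * 0)"
    by (intro tendsto_sum tendsto_mult_left jump0 \<eta>)
  ultimately have zero: "(?Ia + ?Ja) + (?Ib + ?Jb) = 0" using LIMSEQ_unique by fastforce
  have int: "integrable ?M (\<lambda>x. \<Phi> x * p x)" if "\<Phi> \<in> L2 ?M" "smooth p" for \<Phi> p :: "real^'n \<Rightarrow> real"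
    using that continuous_integrable_U[OF smooth_continuous[OF that(2)]]
    by (intro integrable_mult_square) (auto simp: L2_def)
  have pd: "partial_deriv i ?\<eta> x = partial_deriv i \<eta> (x - v)" for x
    by (rule partial_deriv_compose_affine(1)[OF smooth_differentiable[OF \<eta>]])
  have "(\<integral>x. glue v \<Phi>a \<Phi>b x * partial_deriv i \<eta> x \<partial>lebesgue)
    = (\<integral>x. glue v (\<lambda>x. \<Phi>a x * partial_deriv i \<eta> x) (\<lambda>x. \<Phi>b x * partial_deriv i ?\<eta> x) x \<partial>lebesgue)"
    by (rule Bochner_Integration.integral_cong) (auto simp: glue_def pd algebra_simps)
  also have "\<dots> = ?Ia + ?Ib"
    by (rule glue_integral(2)) (use A B \<eta> \<eta>v in \<open>auto intro!: int smooth_partial_deriv\<close>)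
  finally have 1: "(\<integral>x. glue v \<Phi>a \<Phi>b x * partial_deriv i \<eta> x \<partial>lebesgue) = ?Ia + ?Ib" .
  have "(\<integral>x. glue v Ga Gb x $ i * \<eta> x \<partial>lebesgue)
    = (\<integral>x. glue v (\<lambda>x. Ga x $ i * \<eta> x) (\<lambda>x. Gb x $ i * ?\<eta> x) x \<partial>lebesgue)"
    by (rule Bochner_Integration.integral_cong) (auto simp: glue_def algebra_simps)
  also have "\<dots> = ?Ja + ?Jb"
    by (rule glue_integral(2)) (use A B \<eta> \<eta>v in \<open>auto intro!: int L2_component\<close>)
  finally have 2: "(\<integral>x. glue v Ga Gb x $ i * \<eta> x \<partial>lebesgue) = ?Ja + ?Jb" .
  show "(\<integral>x. glue v \<Phi>a \<Phi>b x * partial_deriv i \<eta> x \<partial>lebesgue) = - (\<integral>x. glue v Ga Gb x $ i * \<eta> x \<partial>lebesgue)"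
    unfolding 1 2 using zero by simp
qed

text \<open>The right-hand side in the definition of the normal trace, with \<open>d\<close> for the divergence and \<open>G\<close> for
  the gradient of \<open>\<Phi>\<close>.\<close>

definition pairing :: "(real^'n \<Rightarrow> real^'n) \<Rightarrow> (real^'n \<Rightarrow> real) \<Rightarrow> (real^'n \<Rightarrow> real) \<Rightarrow> (real^'n \<Rightarrow> real^'n) \<Rightarrow> real" where
  "pairing \<mu> d \<Phi> G = (\<integral>x. d x * \<Phi> x \<partial>lebesgue_on U) + (\<integral>x. \<mu> x \<bullet> G x \<partial>lebesgue_on U)"

lemma L2_loc_U: "f \<in> L2_loc \<Longrightarrow> f \<in> L2 (lebesgue_on U)"
  for f :: "real^'n \<Rightarrow> 'b::euclidean_space"
  using L2_lebesgue_subset[of f "cell g" U] borel_compact[OF compact_cell] compact_cell U_subset_cell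
  by (auto simp: L2_loc_def)

lemma integrable_inner_L2:
  fixes a b :: "real^'n \<Rightarrow> real^'n"
  assumes "a \<in> L2 M" "b \<in> L2 M" shows "integrable M (\<lambda>x. a x \<bullet> b x)"
  unfolding inner_vec_def inner_real_def
  by (intro Bochner_Integration.integrable_sum integrable_mult_square)
    (use L2_component[OF assms(1)] L2_component[OF assms(2)] in \<open>auto simp: L2_def\<close>)

text \<open>The glued function is a compactly supported Sobolev function, so \<open>weak_div_pairing\<close> applies. Since
  \<open>\<mu>\<close> and \<open>d\<close> are invariant under the shift, the part on the translated cell can be moved back to the
  cell.\<close>

lemma glue_pairing:
  assumes a: "smooth_approx fa \<Phi>a Ga" and b: "smooth_approx fb \<Phi>b Gb"
    and jump0: "\<And>\<eta> k. smooth \<eta> \<Longrightarrow>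
      (\<lambda>m. jump k (\<lambda>x. fa m x * \<eta> x) + jump k (\<lambda>x. fb m x * \<eta> (x - v))) \<longlonglongrightarrow> 0"
    and \<mu>: "\<mu> \<in> L2_loc" and d: "d \<in> L2_loc" and wd: "has_weak_div UNIV \<mu> d"
    and per: "AE x in lebesgue. \<mu> (x + v) = \<mu> x"
  shows "pairing \<mu> d \<Phi>a Ga + pairing \<mu> d \<Phi>b Gb = 0"
proof -
  let ?M = "lebesgue_on U"
  note A = a[unfolded smooth_approx_def] note B = b[unfolded smooth_approx_def]
  have perd: "AE x in lebesgue. d (x + v) = d x" by (rule weak_div_periodic[OF \<mu> d wd per])
  note dU = L2_loc_U[OF d] note \<mu>U = L2_loc_U[OF \<mu>]
  have iD: "integrable ?M (\<lambda>x. d x * \<Phi>a x)" "integrable ?M (\<lambda>x. d x * \<Phi>b x)"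
    using A B dU by (auto simp: L2_def intro!: integrable_mult_square)
  have iM: "integrable ?M (\<lambda>x. \<mu> x \<bullet> Ga x)" "integrable ?M (\<lambda>x. \<mu> x \<bullet> Gb x)"
    using A B \<mu>U by (auto intro!: integrable_inner_L2)
  have "(\<integral>x. d x * glue v \<Phi>a \<Phi>b x \<partial>lebesgue) + (\<integral>x. \<mu> x \<bullet> glue v Ga Gb x \<partial>lebesgue) = 0"
  proof (rule weak_div_pairing[where R="diam_bound + norm v"])
    show "glue v \<Phi>a \<Phi>b \<in> L2 lebesgue" "glue v Ga Gb \<in> L2 lebesgue" using A B by (auto intro!: glue_L2)
    show "has_weak_grad UNIV (glue v \<Phi>a \<Phi>b) (glue v Ga Gb)" by (rule glue_weak_grad[OF a b jump0])
    have nU: "x \<notin> U \<and> x + v \<notin> U" if "x \<notin> cball 0 (diam_bound + norm v)" for x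
    proof -
      have "norm y \<le> diam_bound" if "y \<in> U" for y
        using norm_cell U_subset_cell that unfolding diam_bound_def by blast
      moreover have "norm x \<le> norm (x + v) + norm v" using norm_triangle_ineq4[of "x + v" v] by simp
      ultimately show ?thesis using that norm_ge_zero[of v] by fastforce
    qed
    show "glue v \<Phi>a \<Phi>b x = 0" "glue v Ga Gb x = 0" if "x \<notin> cball 0 (diam_bound + norm v)" for x
      using nU[OF that] by (simp_all add: glue_def)
  qed (use \<mu> d wd in auto)
  moreover have "(\<integral>x. d x * glue v \<Phi>a \<Phi>b x \<partial>lebesgue) = (\<integral>x. d x * \<Phi>a x \<partial>?M) + (\<integral>x. d x * \<Phi>b x \<partial>?M)"
  proof -
    have "(\<integral>x. d x * glue v \<Phi>a \<Phi>b x \<partial>lebesgue) = (\<integral>x. glue v (\<lambda>x. d x * \<Phi>a x) (\<lambda>x. d x * \<Phi>b x) x \<partial>lebesgue)"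
    proof (rule integral_cong_AE)
      show "AE x in lebesgue. d x * glue v \<Phi>a \<Phi>b x = glue v (\<lambda>x. d x * \<Phi>a x) (\<lambda>x. d x * \<Phi>b x) x"
        using perd by eventually_elim (simp add: glue_def algebra_simps)
      show "(\<lambda>x. d x * glue v \<Phi>a \<Phi>b x) \<in> borel_measurable lebesgue"
        using A B by (intro borel_measurable_times L2_loc_measurable[OF d] glue_measurable) (auto simp: L2_def)
      show "glue v (\<lambda>x. d x * \<Phi>a x) (\<lambda>x. d x * \<Phi>b x) \<in> borel_measurable lebesgue"
        by (rule glue_measurable[OF borel_measurable_integrable[OF iD(1)] borel_measurable_integrable[OF iD(2)]])
    qed
    also have "\<dots> = (\<integral>x. d x * \<Phi>a x \<partial>?M) + (\<integral>x. d x * \<Phi>b x \<partial>?M)" by (rule glue_integral(2)[OF iD])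
    finally show ?thesis .
  qed
  moreover have "(\<integral>x. \<mu> x \<bullet> glue v Ga Gb x \<partial>lebesgue) = (\<integral>x. \<mu> x \<bullet> Ga x \<partial>?M) + (\<integral>x. \<mu> x \<bullet> Gb x \<partial>?M)"
  proof -
    have "(\<integral>x. \<mu> x \<bullet> glue v Ga Gb x \<partial>lebesgue) = (\<integral>x. glue v (\<lambda>x. \<mu> x \<bullet> Ga x) (\<lambda>x. \<mu> x \<bullet> Gb x) x \<partial>lebesgue)"
    proof (rule integral_cong_AE)
      show "AE x in lebesgue. \<mu> x \<bullet> glue v Ga Gb x = glue v (\<lambda>x. \<mu> x \<bullet> Ga x) (\<lambda>x. \<mu> x \<bullet> Gb x) x"
        using per by eventually_elim (simp add: glue_def inner_add_right)
      show "(\<lambda>x. \<mu> x \<bullet> glue v Ga Gb x) \<in> borel_measurable lebesgue"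
        using A B by (intro borel_measurable_inner L2_loc_measurable[OF \<mu>] glue_measurable) (auto simp: L2_def)
      show "glue v (\<lambda>x. \<mu> x \<bullet> Ga x) (\<lambda>x. \<mu> x \<bullet> Gb x) \<in> borel_measurable lebesgue"
        by (rule glue_measurable[OF borel_measurable_integrable[OF iM(1)] borel_measurable_integrable[OF iM(2)]])
    qed
    also have "\<dots> = (\<integral>x. \<mu> x \<bullet> Ga x \<partial>?M) + (\<integral>x. \<mu> x \<bullet> Gb x \<partial>?M)" by (rule glue_integral(2)[OF iM])
    finally show ?thesis .
  qed
  ultimately show ?thesis by (simp add: pairing_def)
qed

end

section \<open>Traces\<close>

context dual_basis
begin

text \<open>Test functions on the open cell vanish on all faces, and with them the boundary terms.\<close>

lemma smooth_approx_has_weak_grad: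
  assumes "smooth_approx f \<Phi> G" shows "has_weak_grad U \<Phi> G"
  unfolding has_weak_grad_def
proof (intro ballI allI)
  fix \<eta> :: "real^'n \<Rightarrow> real" and i assume "\<eta> \<in> test_functions U"
  then have \<eta>: "smooth \<eta>" "\<And>x. x \<notin> U \<Longrightarrow> \<eta> x = 0" by (auto simp: test_functions_def)
  have nU: "proj k c y \<notin> U" if "c \<in> {0, 1}" for k c y using that by (auto simp: U_def)
  have "\<eta> (proj k 1 y) = 0" "\<eta> (proj k 0 y) = 0" for k y using nU by (auto intro!: \<eta>(2))
  then have j0: "jump k (\<lambda>x. f m x * \<eta> x) = 0" for k m by (simp add: jump_def)
  have "(\<lambda>m. \<Sum>k\<in>UNIV. (w k $ i) * jump k (\<lambda>x. f m x * \<eta> x)) \<longlonglongrightarrow>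
    (\<integral>x. \<Phi> x * partial_deriv i \<eta> x \<partial>lebesgue_on U) + (\<integral>x. G x $ i * \<eta> x \<partial>lebesgue_on U)"
    by (rule green_limit) (use assms \<eta> in \<open>auto simp: smooth_approx_def\<close>)
  then have "(\<integral>x. \<Phi> x * partial_deriv i \<eta> x \<partial>lebesgue_on U) + (\<integral>x. G x $ i * \<eta> x \<partial>lebesgue_on U) = 0"
    unfolding j0 by (simp add: LIMSEQ_const_iff)
  then show "(\<integral>x. \<Phi> x * partial_deriv i \<eta> x \<partial>lebesgue_on U) = - (\<integral>x. G x $ i * \<eta> x \<partial>lebesgue_on U)" by simp
qed

lemma weak_grad_works:
  assumes "\<Phi> \<in> H1 U"
  shows "weak_grad U \<Phi> \<in> L2 (lebesgue_on U)" "has_weak_grad U \<Phi> (weak_grad U \<Phi>)"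
proof -
  have "\<exists>G. G \<in> L2 (lebesgue_on U) \<and> has_weak_grad U \<Phi> G" using assms by (simp add: H1_def)
  from someI_ex[OF this] show "weak_grad U \<Phi> \<in> L2 (lebesgue_on U)" "has_weak_grad U \<Phi> (weak_grad U \<Phi>)"
    unfolding weak_grad_def by auto
qed

lemma AE_lebesgue_on_U: "(AE x in lebesgue. x \<in> U \<longrightarrow> P x) \<Longrightarrow> AE x in lebesgue_on U. P x"
  by (simp add: AE_restrict_space_iff)

lemma smooth_grad_L2:
  assumes "smooth f" shows "grad f \<in> L2 (lebesgue_on U)"
proof -
  have "integrable (lebesgue_on U) (\<lambda>x. \<Sum>i\<in>UNIV. (partial_deriv i f x)\<^sup>2)"
    using continuous_integrable_U(3)[OF smooth_continuous[OF smooth_partial_deriv[OF assms]]] by auto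
  moreover have "(\<Sum>i\<in>UNIV. (partial_deriv i f x)\<^sup>2) = (norm (grad f x))\<^sup>2" for x
    unfolding power2_norm_eq_inner inner_vec_def by (simp add: grad_def power2_eq_square)
  moreover have "grad f \<in> borel_measurable (lebesgue_on U)"
    using smooth_borel(3)[OF assms] by (intro measurable_restrict_space1 measurable_completion) simp
  ultimately show ?thesis by (simp add: L2_def)
qed

text \<open>The limit field and the chosen weak gradient agree almost everywhere, so they may be exchanged.\<close>

lemma smooth_approx_weak_grad:
  assumes a: "smooth_approx f \<Phi> G"
  shows "\<Phi> \<in> H1 U" "smooth_approx f \<Phi> (weak_grad U \<Phi>)"
proof -
  note A = a[unfolded smooth_approx_def]
  have f: "\<And>m. smooth (f m)" and G: "G \<in> L2 (lebesgue_on U)" using A by auto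
  note wg = smooth_approx_has_weak_grad[OF a]
  show H: "\<Phi> \<in> H1 U" using A wg by (auto simp: H1_def)
  note W = weak_grad_works[OF H]
  have "AE x in lebesgue. x \<in> U \<longrightarrow> weak_grad U \<Phi> x = G x"
    by (rule weak_grad_unique[OF open_U W(1) G W(2) wg])
  then have ae: "AE x in lebesgue_on U. weak_grad U \<Phi> x = G x" by (rule AE_lebesgue_on_U)
  have gm: "grad (f m) \<in> borel_measurable (lebesgue_on U)" for m
    using smooth_grad_L2[OF f] by (simp add: L2_def)
  have "(\<integral>x. (norm (grad (f m) x - weak_grad U \<Phi> x))\<^sup>2 \<partial>lebesgue_on U) = (\<integral>x. (norm (grad (f m) x - G x))\<^sup>2 \<partial>lebesgue_on U)" for m
  proof (rule integral_cong_AE)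
    show "AE x in lebesgue_on U. (norm (grad (f m) x - weak_grad U \<Phi> x))\<^sup>2 = (norm (grad (f m) x - G x))\<^sup>2"
      using ae by eventually_elim simp
  qed (use gm[of m] W(1) G in \<open>auto simp: L2_def\<close>)
  then show "smooth_approx f \<Phi> (weak_grad U \<Phi>)" using A W(1) unfolding smooth_approx_def by simp
qed

lemma is_trace_iff:
  "is_trace g \<Phi> \<psi> \<longleftrightarrow> (\<forall>k. \<forall>c\<in>{0, 1}. \<psi> \<in> L2 (face_measure g k c)) \<and>
    (\<exists>f. smooth_approx f \<Phi> (weak_grad U \<Phi>) \<and>
      (\<forall>k. \<forall>c\<in>{0, 1}. (\<lambda>m. \<integral>x. (f m x - \<psi> x)\<^sup>2 \<partial>face_measure g k c) \<longlonglongrightarrow> 0))"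
proof
  assume t: "is_trace g \<Phi> \<psi>"
  then have H: "\<Phi> \<in> H1 U" by (simp add: is_trace_def interior_cell)
  then have "\<Phi> \<in> L2 (lebesgue_on U)" by (simp add: H1_def)
  with t weak_grad_works(1)[OF H] show "(\<forall>k. \<forall>c\<in>{0, 1}. \<psi> \<in> L2 (face_measure g k c)) \<and>
    (\<exists>f. smooth_approx f \<Phi> (weak_grad U \<Phi>) \<and>
      (\<forall>k. \<forall>c\<in>{0, 1}. (\<lambda>m. \<integral>x. (f m x - \<psi> x)\<^sup>2 \<partial>face_measure g k c) \<longlonglongrightarrow> 0))"
    unfolding is_trace_def interior_cell smooth_approx_def by blast
next
  assume a: "(\<forall>k. \<forall>c\<in>{0, 1}. \<psi> \<in> L2 (face_measure g k c)) \<and>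
    (\<exists>f. smooth_approx f \<Phi> (weak_grad U \<Phi>) \<and>
      (\<forall>k. \<forall>c\<in>{0, 1}. (\<lambda>m. \<integral>x. (f m x - \<psi> x)\<^sup>2 \<partial>face_measure g k c) \<longlonglongrightarrow> 0))"
  then have "\<Phi> \<in> H1 U" using smooth_approx_weak_grad(1) by blast
  with a show "is_trace g \<Phi> \<psi>"
    unfolding is_trace_def interior_cell smooth_approx_def by blast
qed

lemma continuous_face:
  fixes f :: "real^'n \<Rightarrow> real"
  assumes f: "continuous_on UNIV f" and c: "c \<in> {0, 1}"
  shows "f \<in> borel_measurable (face_measure g k c)" "integrable (face_measure g k c) (\<lambda>x. (f x)\<^sup>2)"
proof -
  show "f \<in> borel_measurable (face_measure g k c)"
    by (intro borel_imp_face_measurable borel_measurable_continuous_onI f)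
  have "continuous_on UNIV (\<lambda>x. (f x)\<^sup>2)" using f by (intro continuous_intros)
  then show "integrable (face_measure g k c) (\<lambda>x. (f x)\<^sup>2)"
    using face_integral[of k] c by metis
qed

lemma face_limit_proj:
  fixes h :: "nat \<Rightarrow> real^'n \<Rightarrow> real"
  assumes h: "\<And>m. continuous_on UNIV (h m)" and c: "c \<in> {0, 1}"
    and lim: "(\<lambda>m. \<integral>x. (h m x)\<^sup>2 \<partial>face_measure g k c) \<longlonglongrightarrow> 0"
  shows "(\<lambda>m. \<integral>y. (h m (proj k c y))\<^sup>2 \<partial>lebesgue_on U) \<longlonglongrightarrow> 0"
proof -
  obtain C where C: "C > 0" "\<And>c f. c \<in> {0, 1} \<Longrightarrow> f \<in> borel_measurable borel \<Longrightarrow>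
      (\<integral>x. (f x :: real) \<partial>face_measure g k c) = C * (\<integral>y. f (proj k c y) \<partial>lebesgue_on U)"
    using face_integral[of k] by metis
  have "(\<integral>y. (h m (proj k c y))\<^sup>2 \<partial>lebesgue_on U) = (\<integral>x. (h m x)\<^sup>2 \<partial>face_measure g k c) / C" for m
  proof -
    have "(\<lambda>x. (h m x)\<^sup>2) \<in> borel_measurable borel"
      by (intro borel_measurable_continuous_onI continuous_intros h)
    from C(2)[OF c this] C(1) show ?thesis by simp
  qed
  then show ?thesis using tendsto_divide[OF lim tendsto_const[of C]] C(1) by simp
qed

lemma trace_difference_limit:
  fixes fa fb :: "nat \<Rightarrow> real^'n \<Rightarrow> real"
  assumes fa: "\<And>m. continuous_on UNIV (fa m)" and fb: "\<And>m. continuous_on UNIV (fb m)" and c: "c \<in> {0, 1}"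
    and \<psi>: "\<psi> \<in> L2 (face_measure g k c)"
    and la: "(\<lambda>m. \<integral>x. (fa m x - \<psi> x)\<^sup>2 \<partial>face_measure g k c) \<longlonglongrightarrow> 0"
    and lb: "(\<lambda>m. \<integral>x. (fb m x - \<psi> x)\<^sup>2 \<partial>face_measure g k c) \<longlonglongrightarrow> 0"
  shows "(\<lambda>m. \<integral>x. (fa m x - fb m x)\<^sup>2 \<partial>face_measure g k c) \<longlonglongrightarrow> 0"
proof -
  let ?F = "face_measure g k c"
  have \<psi>': "\<psi> \<in> borel_measurable ?F" "integrable ?F (\<lambda>x. (\<psi> x)\<^sup>2)" using \<psi> by (auto simp: L2_def)
  note ia = integrable_square_diff[OF continuous_face(1)[OF fa c] \<psi>'(1) continuous_face(2)[OF fa c] \<psi>'(2)]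
  note ib = integrable_square_diff[OF continuous_face(1)[OF fb c] \<psi>'(1) continuous_face(2)[OF fb c] \<psi>'(2)]
  note iab = integrable_square_diff[OF continuous_face(1)[OF fa c] continuous_face(1)[OF fb c]
    continuous_face(2)[OF fa c] continuous_face(2)[OF fb c]]
  have "(\<lambda>m. 2 * (\<integral>x. (fa m x - \<psi> x)\<^sup>2 \<partial>?F) + 2 * (\<integral>x. (fb m x - \<psi> x)\<^sup>2 \<partial>?F)) \<longlonglongrightarrow> 2 * 0 + 2 * 0"
    by (intro tendsto_intros la lb)
  then have lim: "(\<lambda>m. 2 * (\<integral>x. (fa m x - \<psi> x)\<^sup>2 \<partial>?F) + 2 * (\<integral>x. (fb m x - \<psi> x)\<^sup>2 \<partial>?F)) \<longlonglongrightarrow> 0" by simp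
  show ?thesis
  proof (rule tendsto_sandwich[OF _ _ tendsto_const lim])
    show "\<forall>\<^sub>F m in sequentially. (\<integral>x. (fa m x - fb m x)\<^sup>2 \<partial>?F)
        \<le> 2 * (\<integral>x. (fa m x - \<psi> x)\<^sup>2 \<partial>?F) + 2 * (\<integral>x. (fb m x - \<psi> x)\<^sup>2 \<partial>?F)"
    proof (rule always_eventually, rule allI)
      fix m
      have "(\<integral>x. (fa m x - fb m x)\<^sup>2 \<partial>?F) \<le> (\<integral>x. 2 * (fa m x - \<psi> x)\<^sup>2 + 2 * (fb m x - \<psi> x)\<^sup>2 \<partial>?F)"
      proof (rule integral_mono[OF iab])
        show "(fa m x - fb m x)\<^sup>2 \<le> 2 * (fa m x - \<psi> x)\<^sup>2 + 2 * (fb m x - \<psi> x)\<^sup>2" for x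
        proof -
          have "0 \<le> ((fa m x - \<psi> x) + (fb m x - \<psi> x))\<^sup>2" by simp
          then show ?thesis by (simp add: power2_eq_square algebra_simps)
        qed
      qed (use ia[of m] ib[of m] in auto)
      also have "\<dots> = 2 * (\<integral>x. (fa m x - \<psi> x)\<^sup>2 \<partial>?F) + 2 * (\<integral>x. (fb m x - \<psi> x)\<^sup>2 \<partial>?F)"
        using ia[of m] ib[of m] by simp
      finally show "(\<integral>x. (fa m x - fb m x)\<^sup>2 \<partial>?F)
        \<le> 2 * (\<integral>x. (fa m x - \<psi> x)\<^sup>2 \<partial>?F) + 2 * (\<integral>x. (fb m x - \<psi> x)\<^sup>2 \<partial>?F)" .
    qed
  qed auto
qed

lemma face_limit_zero_trace:
  fixes f :: "nat \<Rightarrow> real^'n \<Rightarrow> real"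
  assumes f: "\<And>m. continuous_on UNIV (f m)" and c: "c \<in> {0, 1}" and \<psi>: "\<psi> \<in> L2 (face_measure g k c)"
    and z: "AE x in face_measure g k c. \<psi> x = 0"
    and l: "(\<lambda>m. \<integral>x. (f m x - \<psi> x)\<^sup>2 \<partial>face_measure g k c) \<longlonglongrightarrow> 0"
  shows "(\<lambda>m. \<integral>y. (f m (proj k c y))\<^sup>2 \<partial>lebesgue_on U) \<longlonglongrightarrow> 0"
proof (rule face_limit_proj[OF f c])
  have m: "\<psi> \<in> borel_measurable (face_measure g k c)" using \<psi> by (simp add: L2_def)
  have "(\<integral>x. (f m x - \<psi> x)\<^sup>2 \<partial>face_measure g k c) = (\<integral>x. (f m x)\<^sup>2 \<partial>face_measure g k c)" for m
  proof (rule integral_cong_AE)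
    show "AE x in face_measure g k c. (f m x - \<psi> x)\<^sup>2 = (f m x)\<^sup>2" using z by eventually_elim simp
  qed (use m continuous_face(1)[OF f c] in auto)
  with l show "(\<lambda>m. \<integral>x. (f m x)\<^sup>2 \<partial>face_measure g k c) \<longlonglongrightarrow> 0" by simp
qed

subsection \<open>Well-definedness of the normal trace\<close>

text \<open>The difference of two functions with the same trace, extended by zero, is a Sobolev function on the
  whole space: this is the glueing with shift 0, where \<open>\<Phi>a\<close> and \<open>- \<Phi>b\<close> are put on the same cell.\<close>

lemma pairing_unique:
  assumes ta: "is_trace g \<Phi>a \<psi>" and tb: "is_trace g \<Phi>b \<psi>"
    and \<mu>: "\<mu> \<in> L2_loc" and d: "d \<in> L2_loc" and wd: "has_weak_div UNIV \<mu> d"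
  shows "pairing \<mu> d \<Phi>a (weak_grad U \<Phi>a) = pairing \<mu> d \<Phi>b (weak_grad U \<Phi>b)"
proof -
  have \<psi>: "\<And>k c. c \<in> {0, 1} \<Longrightarrow> \<psi> \<in> L2 (face_measure g k c)" using ta by (auto simp: is_trace_iff)
  obtain fa where fa: "smooth_approx fa \<Phi>a (weak_grad U \<Phi>a)"
    "\<And>k c. c \<in> {0, 1} \<Longrightarrow> (\<lambda>m. \<integral>x. (fa m x - \<psi> x)\<^sup>2 \<partial>face_measure g k c) \<longlonglongrightarrow> 0"
    using ta unfolding is_trace_iff by blast
  obtain fb where fb: "smooth_approx fb \<Phi>b (weak_grad U \<Phi>b)"
    "\<And>k c. c \<in> {0, 1} \<Longrightarrow> (\<lambda>m. \<integral>x. (fb m x - \<psi> x)\<^sup>2 \<partial>face_measure g k c) \<longlonglongrightarrow> 0"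
    using tb unfolding is_trace_iff by blast
  have sa: "\<And>m. smooth (fa m)" and sb: "\<And>m. smooth (fb m)" using fa(1) fb(1) by (auto simp: smooth_approx_def)
  note ca = smooth_continuous[OF sa] note cb = smooth_continuous[OF sb]
  have gneg: "grad (\<lambda>x. - fb m x) x = - grad (fb m) x" for m x
  proof -
    have "((\<lambda>x. - fb m x) has_derivative (\<lambda>h. - (grad (fb m) x \<bullet> h))) (at x)"
      by (intro has_derivative_minus has_derivative_grad smooth_differentiable sb)
    from partial_deriv_eq[OF this] show ?thesis by (simp add: vec_eq_iff grad_def inner_axis)
  qed
  have smn: "smooth (\<lambda>x. - fb m x)" for m
  proof -
    have "smooth (\<lambda>x::real^'n. 0 :: real)" unfolding smooth_def using C_k_const by blast
    from smooth_diff[OF this sb[of m]] show ?thesis by simp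
  qed
  have fbn: "smooth_approx (\<lambda>m x. - fb m x) (\<lambda>x. - \<Phi>b x) (\<lambda>x. - weak_grad U \<Phi>b x)"
  proof -
    have e1: "(- fb m x - - \<Phi>b x)\<^sup>2 = (fb m x - \<Phi>b x)\<^sup>2" for m x by (simp add: power2_eq_square algebra_simps)
    have e2: "norm (- grad (fb m) x - - weak_grad U \<Phi>b x) = norm (grad (fb m) x - weak_grad U \<Phi>b x)" for m x
      by (metis minus_diff_commute norm_minus_commute diff_minus_eq_add add.commute uminus_add_conv_diff)
    show ?thesis
      using fb(1) smn unfolding smooth_approx_def e1 gneg e2 by (auto simp: L2_def)
  qed
  have "pairing \<mu> d \<Phi>a (weak_grad U \<Phi>a) + pairing \<mu> d (\<lambda>x. - \<Phi>b x) (\<lambda>x. - weak_grad U \<Phi>b x) = 0"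
  proof (rule glue_pairing[where v=0, OF fa(1) fbn _ \<mu> d wd])
    fix \<eta> :: "real^'n \<Rightarrow> real" and k assume \<eta>: "smooth \<eta>"
    note ce = smooth_continuous[OF \<eta>]
    have "(\<lambda>m. jump k (\<lambda>x. (fa m x - fb m x) * \<eta> x)) \<longlonglongrightarrow> 0"
    proof (rule jump_tendsto_0[OF _ ce])
      show cab: "continuous_on UNIV (\<lambda>x. fa m x - fb m x)" for m by (intro continuous_intros ca cb)
      show "(\<lambda>m. \<integral>y. (fa m (proj k c y) - fb m (proj k c y))\<^sup>2 \<partial>lebesgue_on U) \<longlonglongrightarrow> 0" if c: "c \<in> {0, 1}" for c
        by (rule face_limit_proj[OF cab c trace_difference_limit[OF ca cb c \<psi>[OF c] fa(2)[OF c] fb(2)[OF c]]])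
    qed
    moreover have "jump k (\<lambda>x. fa m x * \<eta> x) + jump k (\<lambda>x. - fb m x * \<eta> (x - 0)) = jump k (\<lambda>x. (fa m x - fb m x) * \<eta> x)" for m
    proof -
      note ia = continuous_integrable_proj(2)[OF continuous_on_mult[OF ca[of m] ce], of k]
      note ib = continuous_integrable_proj(2)[OF continuous_on_mult[OF cb[of m] ce], of k]
      show ?thesis
        unfolding jump_def left_diff_distrib using ia[of 0] ia[of 1] ib[of 0] ib[of 1]
        by simp
    qed
    ultimately show "(\<lambda>m. jump k (\<lambda>x. fa m x * \<eta> x) + jump k (\<lambda>x. - fb m x * \<eta> (x - 0))) \<longlonglongrightarrow> 0" by simp
  qed simp
  then show ?thesis by (simp add: pairing_def)
qed

text \<open>The chosen weak divergence on the cell is almost everywhere the restriction of the global one.\<close>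

lemma normal_trace_eq_pairing:
  assumes t: "is_trace g \<Phi> \<psi>"
    and \<mu>: "\<mu> \<in> L2_loc" and d: "d \<in> L2_loc" and wd: "has_weak_div UNIV \<mu> d"
  shows "normal_trace g \<mu> \<psi> = pairing \<mu> d \<Phi> (weak_grad U \<Phi>)"
proof -
  let ?M = "lebesgue_on U"
  note dU = L2_loc_U[OF d] 
  have wdU: "has_weak_div U \<mu> d"
    unfolding has_weak_div_def
  proof
    fix \<eta> assume \<eta>: "\<eta> \<in> test_functions U"
    then obtain K where K: "compact K" "K \<subseteq> U" "\<And>x. x \<notin> K \<Longrightarrow> \<eta> x = 0" by (auto simp: test_functions_def)
    have e: "indicator U x *\<^sub>R (\<mu> x \<bullet> grad \<eta> x) = \<mu> x \<bullet> grad \<eta> x" "indicator U x *\<^sub>R (d x * \<eta> x) = d x * \<eta> x" for x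
    proof -
      have "grad \<eta> x = 0" if "x \<notin> K"
        using partial_deriv_zero_outside[OF compact_imp_closed[OF K(1)] K(3) that] by (simp add: grad_def vec_eq_iff)
      then show "indicator U x *\<^sub>R (\<mu> x \<bullet> grad \<eta> x) = \<mu> x \<bullet> grad \<eta> x"
        using K(2) by (cases "x \<in> K") (auto simp: indicator_def)
      show "indicator U x *\<^sub>R (d x * \<eta> x) = d x * \<eta> x"
        using K(2) K(3)[of x] by (cases "x \<in> K") (auto simp: indicator_def)
    qed
    have "\<eta> \<in> test_functions UNIV" using \<eta> by (auto simp: test_functions_def)
    then show "(\<integral>x. \<mu> x \<bullet> grad \<eta> x \<partial>?M) = - (\<integral>x. d x * \<eta> x \<partial>?M)"
      using wd unfolding integral_restrict_space[OF U_lebesgue] e by (simp add: has_weak_div_def lebesgue_on_UNIV_eq)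
  qed
  have "\<exists>d. d \<in> L2 ?M \<and> has_weak_div U \<mu> d" using dU wdU by blast
  from someI_ex[OF this] have W: "weak_div U \<mu> \<in> L2 ?M" "has_weak_div U \<mu> (weak_div U \<mu>)"
    unfolding weak_div_def by auto
  have Um: "U \<in> sets lebesgue" by simp
  have "AE x in lebesgue. x \<in> U \<longrightarrow> weak_div U \<mu> x = d x"
    by (rule weak_div_unique[OF open_U L2_local_of_L2[OF W(1) Um] L2_local_of_L2[OF dU Um] W(2) wdU])
  then have ae: "AE x in ?M. weak_div U \<mu> x = d x" by (rule AE_lebesgue_on_U)
  have int: "(\<integral>x. weak_div U \<mu> x * \<Phi>' x \<partial>?M) + (\<integral>x. \<mu> x \<bullet> weak_grad U \<Phi>' x \<partial>?M) = pairing \<mu> d \<Phi>' (weak_grad U \<Phi>')"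
    if "is_trace g \<Phi>' \<psi>" for \<Phi>'
  proof -
    have \<Phi>': "\<Phi>' \<in> L2 ?M" using that by (auto simp: is_trace_iff smooth_approx_def)
    have "(\<integral>x. weak_div U \<mu> x * \<Phi>' x \<partial>?M) = (\<integral>x. d x * \<Phi>' x \<partial>?M)"
    proof (rule integral_cong_AE)
      show "AE x in ?M. weak_div U \<mu> x * \<Phi>' x = d x * \<Phi>' x" using ae by eventually_elim simp
    qed (use \<Phi>' W(1) dU in \<open>auto simp: L2_def\<close>)
    then show ?thesis by (simp add: pairing_def)
  qed
  show ?thesis
    unfolding normal_trace_def interior_cell
  proof (rule the_equality)
    show "\<exists>\<Phi>'. is_trace g \<Phi>' \<psi> \<and> pairing \<mu> d \<Phi> (weak_grad U \<Phi>) =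
      (\<integral>x. weak_div U \<mu> x * \<Phi>' x \<partial>?M) + (\<integral>x. \<mu> x \<bullet> weak_grad U \<Phi>' x \<partial>?M)"
      using t int[OF t] by (intro exI[of _ \<Phi>]) simp
    fix r assume "\<exists>\<Phi>'. is_trace g \<Phi>' \<psi> \<and> r =
      (\<integral>x. weak_div U \<mu> x * \<Phi>' x \<partial>?M) + (\<integral>x. \<mu> x \<bullet> weak_grad U \<Phi>' x \<partial>?M)"
    then obtain \<Phi>' where \<Phi>': "is_trace g \<Phi>' \<psi>" "r =
      (\<integral>x. weak_div U \<mu> x * \<Phi>' x \<partial>?M) + (\<integral>x. \<mu> x \<bullet> weak_grad U \<Phi>' x \<partial>?M)" by blast
    then show "r = pairing \<mu> d \<Phi> (weak_grad U \<Phi>)"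
      using int[OF \<Phi>'(1)] pairing_unique[OF \<Phi>'(1) t \<mu> d wd] by simp
  qed
qed

subsection \<open>Reflection of the cell\<close>

text \<open>The chain rule turns gradients by the adjoint of the linear part of \<open>flip k\<close>. This is a bounded map,
  and \<open>flip k\<close> preserves volume, so convergence is preserved.\<close>

lemma smooth_approx_flip:
  assumes a: "smooth_approx f \<Phi> G"
  shows "smooth_approx (\<lambda>m x. f m (flip k x)) (\<lambda>x. \<Phi> (flip k x))
    (\<lambda>x. adjoint (\<lambda>y. y - (2 * (w k \<bullet> y)) *\<^sub>R g k) (G (flip k x)))"
proof -
  let ?M = "lebesgue_on U"
  define a where "a y = y - (2 * (w k \<bullet> y)) *\<^sub>R g k" for y
  have lin: "linear a" unfolding a_def by (rule linear_flip_part)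
  have fe: "flip k x = a x + g k" for x by (simp add: flip_eq a_def)
  note A = assms[unfolded smooth_approx_def]
  have s: "\<And>m. smooth (f m)" and \<Phi>: "\<Phi> \<in> L2 ?M" and G: "G \<in> L2 ?M" using A by auto
  have sp: "space (lebesgue :: (real^'n) measure) = UNIV" "U \<in> sets lebesgue" by simp_all
  note S = scales_integral[OF scales_lebesgue[OF scales_flip[of k]] sp, unfolded flip_vimage_U]
  have adj: "linear (adjoint a)" by (rule adjoint_linear[OF lin])
  then have bl: "bounded_linear (adjoint a)" by (simp add: linear_conv_bounded_linear)
  obtain K where K: "\<And>x. norm (adjoint a x) \<le> norm x * K" using bounded_linear.bounded[OF bl] by blast
  have K2: "(norm (adjoint a x))\<^sup>2 \<le> K\<^sup>2 * (norm x)\<^sup>2" for x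
    using power_mono[OF K[of x] norm_ge_zero, of 2] by (simp add: power_mult_distrib mult.commute)
  have am: "adjoint a \<in> borel_measurable borel"
    by (intro borel_measurable_continuous_onI linear_continuous_on bl)
  have \<Phi>m [measurable]: "\<Phi> \<in> borel_measurable ?M" and \<Phi>i: "integrable ?M (\<lambda>x. (norm (\<Phi> x))\<^sup>2)"
    using \<Phi> by (auto simp: L2_def)
  have Gm [measurable]: "G \<in> borel_measurable ?M" and Gi: "integrable ?M (\<lambda>x. (norm (G x))\<^sup>2)"
    using G by (auto simp: L2_def)
  have fm [measurable]: "f m \<in> borel_measurable ?M" for m
    by (rule continuous_integrable_U(1)[OF smooth_continuous[OF s]])
  have gm [measurable]: "grad (f m) \<in> borel_measurable ?M" for m
    using smooth_grad_L2[OF s] by (simp add: L2_def)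
  have gf: "grad (\<lambda>x. f m (flip k x)) x = adjoint a (grad (f m) (flip k x))" for m x
    unfolding fe by (rule grad_affine(1)[OF lin smooth_differentiable[OF s]])
  have Gd: "integrable ?M (\<lambda>x. (norm (grad (f m) x - G x))\<^sup>2)" for m
    using L2_diff[OF smooth_grad_L2[OF s] G] by (simp add: L2_def)
  have c1: "\<forall>m. smooth (\<lambda>x. f m (flip k x))" unfolding fe using smooth_affine[OF lin s] by blast
  have c2: "(\<lambda>x. \<Phi> (flip k x)) \<in> L2 ?M"
    unfolding L2_def using S(1)[OF \<Phi>m] S(3)[of "\<lambda>x. (norm (\<Phi> x))\<^sup>2"] \<Phi>i by auto
  have c3: "(\<lambda>x. adjoint a (G (flip k x))) \<in> L2 ?M"
  proof -
    have m: "(\<lambda>x. adjoint a (G (flip k x))) \<in> borel_measurable ?M"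
      by (rule measurable_compose[OF S(1)[OF Gm] am])
    have "integrable ?M (\<lambda>x. K\<^sup>2 * (norm (G (flip k x)))\<^sup>2)"
      using S(3)[of "\<lambda>x. (norm (G x))\<^sup>2"] Gi by auto
    then have "integrable ?M (\<lambda>x. (norm (adjoint a (G (flip k x))))\<^sup>2)"
      by (rule Bochner_Integration.integrable_bound) (use m K2 in auto)
    with m show ?thesis by (simp add: L2_def)
  qed
  have "(\<integral>x. (f m (flip k x) - \<Phi> (flip k x))\<^sup>2 \<partial>?M) = (\<integral>x. (f m x - \<Phi> x)\<^sup>2 \<partial>?M)" for m
    using S(2)[of "\<lambda>x. (f m x - \<Phi> x)\<^sup>2"] by simp
  then have c4: "(\<lambda>m. \<integral>x. (f m (flip k x) - \<Phi> (flip k x))\<^sup>2 \<partial>?M) \<longlonglongrightarrow> 0" using A by simp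
  have c5: "(\<lambda>m. \<integral>x. (norm (grad (\<lambda>x. f m (flip k x)) x - adjoint a (G (flip k x))))\<^sup>2 \<partial>?M) \<longlonglongrightarrow> 0"
  proof (rule tendsto_sandwich[OF _ _ tendsto_const])
    show "(\<lambda>m. K\<^sup>2 * (\<integral>x. (norm (grad (f m) x - G x))\<^sup>2 \<partial>?M)) \<longlonglongrightarrow> 0"
    proof -
      have "(\<lambda>m. \<integral>x. (norm (grad (f m) x - G x))\<^sup>2 \<partial>?M) \<longlonglongrightarrow> 0" using A by simp
      from tendsto_mult_left[OF this, of "K\<^sup>2"] show ?thesis by simp
    qed
    show "\<forall>\<^sub>F m in sequentially. (\<integral>x. (norm (grad (\<lambda>x. f m (flip k x)) x - adjoint a (G (flip k x))))\<^sup>2 \<partial>?M)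
      \<le> K\<^sup>2 * (\<integral>x. (norm (grad (f m) x - G x))\<^sup>2 \<partial>?M)"
    proof (rule always_eventually, rule allI)
      fix m
      have Sd: "integrable ?M (\<lambda>x. (norm (grad (f m) (flip k x) - G (flip k x)))\<^sup>2)"
        "(\<integral>x. (norm (grad (f m) (flip k x) - G (flip k x)))\<^sup>2 \<partial>?M) = (\<integral>x. (norm (grad (f m) x - G x))\<^sup>2 \<partial>?M)"
        using S(2,3)[of "\<lambda>x. (norm (grad (f m) x - G x))\<^sup>2"] Gd[of m] by simp_all
      have "(\<integral>x. (norm (grad (\<lambda>x. f m (flip k x)) x - adjoint a (G (flip k x))))\<^sup>2 \<partial>?M)
        = (\<integral>x. (norm (adjoint a (grad (f m) (flip k x) - G (flip k x))))\<^sup>2 \<partial>?M)"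
        by (simp add: gf linear_diff[OF adj])
      also have "\<dots> \<le> (\<integral>x. K\<^sup>2 * (norm (grad (f m) (flip k x) - G (flip k x)))\<^sup>2 \<partial>?M)"
      proof (rule integral_mono')
        show "integrable ?M (\<lambda>x. K\<^sup>2 * (norm (grad (f m) (flip k x) - G (flip k x)))\<^sup>2)" using Sd(1) by simp
      qed (use K2 in auto)
      also have "\<dots> = K\<^sup>2 * (\<integral>x. (norm (grad (f m) x - G x))\<^sup>2 \<partial>?M)" using Sd(2) by simp
      finally show "(\<integral>x. (norm (grad (\<lambda>x. f m (flip k x)) x - adjoint a (G (flip k x))))\<^sup>2 \<partial>?M)
        \<le> K\<^sup>2 * (\<integral>x. (norm (grad (f m) x - G x))\<^sup>2 \<partial>?M)" .
    qed
  qed auto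
  show ?thesis using c1 c2 c3 c4 c5 unfolding smooth_approx_def a_def[abs_def] by blast
qed

text \<open>The reflection preserves the volume of the cell and permutes the surface measures.\<close>

lemma is_trace_flip:
  assumes t: "is_trace g \<Phi> \<psi>"
  shows "is_trace g (\<lambda>x. \<Phi> (flip k x)) (\<lambda>x. \<psi> (flip k x))"
proof -
  have \<psi>: "\<And>k c. c \<in> {0, 1} \<Longrightarrow> \<psi> \<in> L2 (face_measure g k c)" using t by (auto simp: is_trace_iff)
  obtain f where f: "smooth_approx f \<Phi> (weak_grad U \<Phi>)"
    "\<And>k c. c \<in> {0, 1} \<Longrightarrow> (\<lambda>m. \<integral>x. (f m x - \<psi> x)\<^sup>2 \<partial>face_measure g k c) \<longlonglongrightarrow> 0"
    using t unfolding is_trace_iff by blast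
  have fc: "continuous_on UNIV (f m)" for m using f(1) smooth_continuous by (auto simp: smooth_approx_def)
  have F: "(\<lambda>x. h (flip k x)) \<in> borel_measurable (face_measure g j c)"
    "(\<integral>x. h (flip k x) \<partial>face_measure g j c) = (\<integral>x. h x \<partial>face_measure g j (if j = k then 1 - c else c))"
    "integrable (face_measure g j c) (\<lambda>x. h (flip k x)) \<longleftrightarrow> integrable (face_measure g j (if j = k then 1 - c else c)) h"
    if c: "c \<in> {0, 1}" and h: "h \<in> borel_measurable (face_measure g j (if j = k then 1 - c else c))"
    for j c and h :: "real^'n \<Rightarrow> real"
  proof -
    note m = face_measure_flip[OF c, of "if j = k then 1 - c else c" j k, OF refl]
    show "(\<lambda>x. h (flip k x)) \<in> borel_measurable (face_measure g j c)" by (rule measurable_compose[OF m(1) h])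
    show "(\<integral>x. h (flip k x) \<partial>face_measure g j c) = (\<integral>x. h x \<partial>face_measure g j (if j = k then 1 - c else c))"
      using integral_distr[OF m(1) h] unfolding m(2) by simp
    show "integrable (face_measure g j c) (\<lambda>x. h (flip k x)) \<longleftrightarrow> integrable (face_measure g j (if j = k then 1 - c else c)) h"
      using integrable_distr_eq[OF m(1) h] unfolding m(2) by simp
  qed
  have c': "(if j = k then 1 - c else c) \<in> {0, 1}" if "c \<in> {0, 1}" for c :: real and j using that by auto
  have "(\<lambda>x. \<psi> (flip k x)) \<in> L2 (face_measure g j c)" if c: "c \<in> {0, 1}" for j c
  proof -
    have p: "\<psi> \<in> borel_measurable (face_measure g j (if j = k then 1 - c else c))"
      "integrable (face_measure g j (if j = k then 1 - c else c)) (\<lambda>x. (norm (\<psi> x))\<^sup>2)"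
      using \<psi>[OF c'[OF c]] by (auto simp: L2_def)
    then show ?thesis
      unfolding L2_def using F(1)[OF c p(1)] F(3)[OF c, of "\<lambda>x. (norm (\<psi> x))\<^sup>2"] by auto
  qed
  moreover have "smooth_approx (\<lambda>m x. f m (flip k x)) (\<lambda>x. \<Phi> (flip k x)) (weak_grad U (\<lambda>x. \<Phi> (flip k x)))"
    by (rule smooth_approx_weak_grad(2)[OF smooth_approx_flip[OF f(1)]])
  moreover have "(\<lambda>m. \<integral>x. (f m (flip k x) - \<psi> (flip k x))\<^sup>2 \<partial>face_measure g j c) \<longlonglongrightarrow> 0" if c: "c \<in> {0, 1}" for j c
  proof -
    have p: "\<psi> \<in> borel_measurable (face_measure g j (if j = k then 1 - c else c))"
      using \<psi>[OF c'[OF c]] by (auto simp: L2_def)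
    have "(\<integral>x. (f m (flip k x) - \<psi> (flip k x))\<^sup>2 \<partial>face_measure g j c)
      = (\<integral>x. (f m x - \<psi> x)\<^sup>2 \<partial>face_measure g j (if j = k then 1 - c else c))" for m
      by (rule F(2)[OF c]) (intro borel_measurable_power borel_measurable_diff p continuous_face(1)[OF fc c'[OF c]])
    then show ?thesis using f(2)[OF c'[OF c], of j] by simp
  qed
  ultimately show ?thesis unfolding is_trace_iff by blast
qed

lemma zero_ext_flip:
  "zero_ext (face g k 0) \<phi> (flip k y) = zero_ext (face g k 1) (\<lambda>y. \<phi> (y - g k)) y"
proof (cases "y \<in> face g k 1")
  case True
  then have "w k \<bullet> y = 1" "flip k y \<in> face g k 0" by (auto simp: face_eq flip_in_cell)
  then show ?thesis using True by (simp add: zero_ext_def flip_def)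
next
  case False
  then have "flip k y \<notin> face g k 0" by (auto simp: face_eq flip_in_cell)
  then show ?thesis using False by (simp add: zero_ext_def)
qed

text \<open>Put \<open>\<Phi>\<close> on the cell and its reflection on the cell shifted by \<open>- g k\<close>. On the common face $F_k^-$ both
  take the same values, already for the smooth approximations, so the boundary terms there cancel
  identically. On all other faces the approximations tend to 0.\<close>

lemma pairing_flip:
  assumes t: "is_trace g \<Phi> (zero_ext (face g k 0) \<phi>)"
    and \<mu>: "\<mu> \<in> L2_loc" and d: "d \<in> L2_loc" and wd: "has_weak_div UNIV \<mu> d"
    and per: "AE x in lebesgue. \<mu> (x + g k) = \<mu> x"
  shows "pairing \<mu> d \<Phi> (weak_grad U \<Phi>)
    + pairing \<mu> d (\<lambda>x. \<Phi> (flip k x)) (weak_grad U (\<lambda>x. \<Phi> (flip k x))) = 0"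
proof -
  let ?\<psi> = "zero_ext (face g k 0) \<phi>" let ?M = "lebesgue_on U"
  have \<psi>: "\<And>j c. c \<in> {0, 1} \<Longrightarrow> ?\<psi> \<in> L2 (face_measure g j c)" using t by (auto simp: is_trace_iff)
  obtain f where f: "smooth_approx f \<Phi> (weak_grad U \<Phi>)"
    "\<And>k c. c \<in> {0, 1} \<Longrightarrow> (\<lambda>m. \<integral>x. (f m x - ?\<psi> x)\<^sup>2 \<partial>face_measure g k c) \<longlonglongrightarrow> 0"
    using t unfolding is_trace_iff by blast
  have fc: "continuous_on UNIV (f m)" for m using f(1) smooth_continuous by (auto simp: smooth_approx_def)
  have ffc: "continuous_on UNIV (\<lambda>x. f m (flip k x))" for m
    by (rule continuous_on_compose2[OF fc continuous_flip]) auto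
  have zero: "(\<lambda>m. \<integral>y. (f m (proj j c y))\<^sup>2 \<partial>?M) \<longlonglongrightarrow> 0" if "c \<in> {0, 1}" "(j, c) \<noteq> (k, 0)" for j c
    by (rule face_limit_zero_trace[OF fc that(1) \<psi>[OF that(1)] zero_ext_AE[OF that] f(2)[OF that(1)]])
  have sp: "space (lebesgue :: (real^'n) measure) = UNIV" "U \<in> sets lebesgue" by simp_all
  note S = scales_integral[OF scales_lebesgue[OF scales_flip[of k]] sp, unfolded flip_vimage_U]
  show ?thesis
  proof (rule glue_pairing[where v="g k", OF f(1) smooth_approx_weak_grad(2)[OF smooth_approx_flip[OF f(1)]] _ \<mu> d wd per])
    fix \<eta> :: "real^'n \<Rightarrow> real" and j assume \<eta>: "smooth \<eta>"
    note ce = smooth_continuous[OF \<eta>]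
    have ce': "continuous_on UNIV (\<lambda>x. \<eta> (x - g k))"
      by (rule continuous_on_compose2[OF ce]) (auto intro!: continuous_intros)
    show "(\<lambda>m. jump j (\<lambda>x. f m x * \<eta> x) + jump j (\<lambda>x. f m (flip k x) * \<eta> (x - g k))) \<longlonglongrightarrow> 0"
    proof (cases "j = k")
      case False
      have "(\<lambda>m. jump j (\<lambda>x. f m x * \<eta> x)) \<longlonglongrightarrow> 0"
        by (rule jump_tendsto_0[OF fc ce zero]) (use False in auto)
      moreover have "(\<lambda>m. jump j (\<lambda>x. f m (flip k x) * \<eta> (x - g k))) \<longlonglongrightarrow> 0"
      proof (rule jump_tendsto_0[OF ffc ce'])
        fix c :: real assume c: "c \<in> {0, 1}"
        have "(\<integral>y. (f m (flip k (proj j c y)))\<^sup>2 \<partial>?M) = (\<integral>y. (f m (proj j c y))\<^sup>2 \<partial>?M)" for m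
          using S(2)[of "\<lambda>y. (f m (proj j c y))\<^sup>2"] continuous_integrable_proj(1)[OF fc, of m j c] False
          by (simp add: flip_proj)
        then show "(\<lambda>m. \<integral>y. (f m (flip k (proj j c y)))\<^sup>2 \<partial>?M) \<longlonglongrightarrow> 0"
          using zero[OF c, of j] False by simp
      qed
      ultimately show ?thesis using tendsto_add by fastforce
    next
      case True
      \<comment> \<open>On $F_k^-$ the two cells contribute opposite terms. What remains lies on the two outermost faces,
        where the approximations have the same values and tend to 0.\<close>
      let ?e = "\<lambda>y. \<eta> (proj k 1 y) - \<eta> (proj k 0 y - g k)"
      have "jump k (\<lambda>x. f m x * \<eta> x) + jump k (\<lambda>x. f m (flip k x) * \<eta> (x - g k)) = (\<integral>y. f m (proj k 1 y) * ?e y \<partial>?M)" for m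
      proof -
        note i1 = continuous_integrable_proj(2)[OF continuous_on_mult[OF fc[of m] ce], of k]
        note i2 = continuous_integrable_proj(2)[OF continuous_on_mult[OF ffc[of m] ce'], of k]
        have shift: "proj k 1 y - g k = proj k 0 y" for y using proj_shift[of k 0 1 y] by simp
        have "(f m (proj k 1 y) * \<eta> (proj k 1 y) - f m (proj k 0 y) * \<eta> (proj k 0 y))
            + (f m (flip k (proj k 1 y)) * \<eta> (proj k 1 y - g k) - f m (flip k (proj k 0 y)) * \<eta> (proj k 0 y - g k))
            = f m (proj k 1 y) * ?e y" for y
          unfolding flip_proj_same shift by (simp add: algebra_simps)
        then show ?thesis
          unfolding jump_def
          by (subst Bochner_Integration.integral_add[symmetric])
            (use i1 i2 in auto)
      qed
      moreover have "(\<lambda>m. \<integral>y. f m (proj k 1 y) * ?e y \<partial>?M) \<longlonglongrightarrow> (\<integral>y. 0 * ?e y \<partial>?M)"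
      proof (rule L2_tendsto_integral_mult[where f="\<lambda>y. 0"])
        show "(\<lambda>m. \<integral>y. (f m (proj k 1 y) - 0)\<^sup>2 \<partial>?M) \<longlonglongrightarrow> 0" using zero[of 1 k] by simp
        have "continuous_on UNIV ?e"
          by (intro continuous_intros continuous_on_compose2[OF ce continuous_proj] continuous_on_compose2[OF ce' continuous_proj]) auto
        from continuous_integrable_U(1,3)[OF this]
        show "?e \<in> borel_measurable ?M" "integrable ?M (\<lambda>y. (?e y)\<^sup>2)" .
      qed (use continuous_integrable_proj[OF fc] in auto)
      ultimately show ?thesis using True by simp
    qed
  qed
qed

lemma g_in_lattice: "g k \<in> lattice g"
proof -
  have "(\<Sum>j\<in>UNIV. real_of_int (if j = k then 1 else 0) *\<^sub>R g j) = (\<Sum>j\<in>UNIV. if j = k then g j else 0)"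
    by (rule sum.cong) auto
  also have "\<dots> = g k" by simp
  finally show ?thesis unfolding lattice_def
    by (intro CollectI exI[of _ "\<lambda>j. if j = k then 1 else 0"]) simp
qed

end

section \<open>Equality of the traces on opposite faces\<close>

theorem lemma14:
  fixes g :: "'n::finite \<Rightarrow> real^'n" and \<mu> :: "real^'n \<Rightarrow> real^'n"
  assumes "CARD('n) \<ge> 2"
    and "inj g" and "independent (range g)"
    and "\<mu> \<in> Hdiv_per g"
  shows "\<forall>k. \<forall>\<phi>\<in>H_half_00 g k 0.
           tr_plus g k \<mu> (\<lambda>y. \<phi> (y - g k)) = tr_minus g k \<mu> \<phi>"
proof (intro allI ballI)
  fix k \<phi> assume \<phi>: "\<phi> \<in> H_half_00 g k 0"
  obtain w where "dual_basis g w" using ex_dual_basis[OF assms(2,3)] by blast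
  then interpret dual_basis g w .
  obtain d where \<mu>: "\<mu> \<in> L2_loc" and d: "d \<in> L2_loc" "has_weak_div UNIV \<mu> d" and "periodic g \<mu>"
    using assms(4) by (auto simp: Hdiv_per_def)
  then have per: "AE x in lebesgue. \<mu> (x + g k) = \<mu> x"
    using g_in_lattice by (auto simp: periodic_def)
  obtain \<Phi> where t: "is_trace g \<Phi> (zero_ext (face g k 0) \<phi>)"
    using \<phi> by (auto simp: H_half_00_def H_half_def)
  have t': "is_trace g (\<lambda>x. \<Phi> (flip k x)) (zero_ext (face g k 1) (\<lambda>y. \<phi> (y - g k)))"
    using is_trace_flip[OF t, of k] unfolding zero_ext_flip by simp
  show "tr_plus g k \<mu> (\<lambda>y. \<phi> (y - g k)) = tr_minus g k \<mu> \<phi>"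
    unfolding tr_plus_def tr_minus_def
      normal_trace_eq_pairing[OF t \<mu> d] normal_trace_eq_pairing[OF t' \<mu> d]
    using pairing_flip[OF t \<mu> d per] by simp
qed

end
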